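(* The cohomogeneity one expander degree of $S^1\times\mathbb{D}^3$ equals $1$ up to sign: $\deg^{\mathrm{sym}}_{\mathrm{exp}}(S^1\times\mathbb{D}^3)=1$ (up to sign). Here $\deg^{\mathrm{sym}}_{\mathrm{exp}}(S^1\times\mathbb{D}^3)$ is the topological degree of the continuous proper map $F:(0,\infty)\times(0,\infty)\to(0,\infty)\times(0,\infty)$, $F(a_0,-f_0)=(a'_\infty,b'_\infty)$, attached to the $S^1\times\mathbb{R}^3$ boundary conditions.
   Context: Consider smooth functions $a,b,f$ of $r\ge 0$, with $a,b>0$ for $r>0$, satisfying for $r>0$ the soliton equations $$f''=\frac{a''}{a}+2\frac{b''}{b}-1,\qquad a''=-2\frac{a'b'}{b}+a'f'+a,\qquad b''=\frac{1-(b')^2}{b}-\frac{a'b'}{a}+b'f'+b.$$ These are equivalent to the metric $g=dr^2+a(r)^2g_{S^1}+b(r)^2g_{S^2}$ ($g_{S^1}=d\theta^2$ the standard metric on the circle, $g_{S^2}$ the round unit sphere metric) being a gradient expanding Ricci soliton, $\mathrm{Ric}_g+\nabla^2f+g=0$, with potential $f=f(r)$. $S^1\times\mathbb{R}^3$ boundary conditions with parameters $a_0>0$, $f_0<0$: $a(0)=a_0$, $a'(0)=0$, $b(0)=0$, $b'(0)=1$, $f(0)=f'(0)=0$, $f''(0)=f_0$. For all such parameters there is a unique solution, it is defined on $[0,\infty)$, and the limits $a'_\infty=\lim_{r\to\infty}a'(r)$ and $b'_\infty=\lim_{r\to\infty}b'(r)$ exist and are finite and positive. The map $F:(0,\infty)\times(0,\infty)\to(0,\infty)\times(0,\infty)$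 is defined by $F(a_0,-f_0)=(a'_\infty,b'_\infty)$. It is continuous and proper, so it has a well-defined topological degree as a proper continuous map between connected oriented $2$-manifolds. The cohomogeneity one expander degree $\deg^{\mathrm{sym}}_{\mathrm{exp}}(S^1\times\mathbb{D}^3)$ is defined to be this degree; "up to sign" means up to the choice of orientations. *)

theory Defs
  imports "HOL-Analysis.Analysis" "HOL-Homology.Homology"
begin

section \<open>Cohomogeneity one expanding solitons\<close>

text \<open>Derivative of a function on the half-line \<open>r \<ge> 0\<close>: two-sided for \<open>r > 0\<close>, one-sided at
  \<open>r = 0\<close>. Values at negative arguments play no role anywhere below.\<close>

definition hderiv :: "(real \<Rightarrow> real) \<Rightarrow> real \<Rightarrow> real" where
  "hderiv u r = vector_derivative u (at r within {0..})"

definition smooth_halfline :: "(real \<Rightarrow> real) \<Rightarrow> bool" where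
  "smooth_halfline u \<longleftrightarrow> (\<forall>n. ((hderiv ^^ n) u) differentiable_on {0..})"

text \<open>The metric \<open>dr\<^sup>2 + a(r)\<^sup>2 g_S1 + b(r)\<^sup>2 g_S2\<close> is a gradient expanding soliton
  (\<open>Ric + Hess f + g = 0\<close>).\<close>

definition expander_system ::
  "(real \<Rightarrow> real) \<Rightarrow> (real \<Rightarrow> real) \<Rightarrow> (real \<Rightarrow> real) \<Rightarrow> bool" where
  "expander_system a b f \<longleftrightarrow>
     smooth_halfline a \<and> smooth_halfline b \<and> smooth_halfline f \<and>
     (\<forall>r>0. a r > 0 \<and> b r > 0 \<and>
        hderiv (hderiv f) r =
          hderiv (hderiv a) r / a r + 2 * (hderiv (hderiv b) r / b r) - 1 \<and>
        hderiv (hderiv a) r =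
          - 2 * (hderiv a r * hderiv b r / b r) + hderiv a r * hderiv f r + a r \<and>
        hderiv (hderiv b) r =
          (1 - (hderiv b r)\<^sup>2) / b r - hderiv a r * hderiv b r / a r
            + hderiv b r * hderiv f r + b r)"

definition S1_R3_boundary_conditions ::
  "real \<Rightarrow> real \<Rightarrow> (real \<Rightarrow> real) \<Rightarrow> (real \<Rightarrow> real) \<Rightarrow> (real \<Rightarrow> real) \<Rightarrow> bool" where
  "S1_R3_boundary_conditions a0 f0 a b f \<longleftrightarrow>
     a 0 = a0 \<and> hderiv a 0 = 0 \<and> b 0 = 0 \<and> hderiv b 0 = 1 \<and>
     f 0 = 0 \<and> hderiv f 0 = 0 \<and> hderiv (hderiv f) 0 = f0"

text \<open>The map \<open>F(a0, -f0) = (a'_\<infinity>, b'_\<infinity>)\<close>; note that the second argument is \<open>-f0\<close>.\<close>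

definition expander_map :: "real \<times> real \<Rightarrow> real \<times> real" where
  "expander_map p =
     (THE (\<alpha>, \<beta>). \<exists>a b f. expander_system a b f \<and>
        S1_R3_boundary_conditions (fst p) (- snd p) a b f \<and>
        (hderiv a \<longlongrightarrow> \<alpha>) at_top \<and> (hderiv b \<longlongrightarrow> \<beta>) at_top)"

section \<open>The degree of a proper map between oriented manifolds\<close>

text \<open>The image of a class \<open>c \<in> H_n(M, M - A)\<close> in \<open>H_n(M, M - B)\<close>, for \<open>B \<subseteq> A\<close>.\<close>

definition restrict_class ::
  "nat \<Rightarrow> 'a topology \<Rightarrow> 'a set \<Rightarrow> 'a set \<Rightarrow> 'a chain set \<Rightarrow> 'a chain set" where
  "restrict_class n M A B c =
     hom_induced (int n) M (topspace M - A) M (topspace M - B) id c"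

abbreviation local_homology_group ::
  "nat \<Rightarrow> 'a topology \<Rightarrow> 'a set \<Rightarrow> 'a chain set monoid" where
  "local_homology_group n M A \<equiv> relative_homology_group (int n) M (topspace M - A)"

text \<open>An orientation of an \<open>n\<close>-manifold \<open>M\<close>: a choice of generators of the groups
  \<open>H_n(M, M - {x})\<close>, \<open>x \<in> M\<close>, which near every point is induced by a single class.\<close>

definition orientation :: "nat \<Rightarrow> 'a topology \<Rightarrow> ('a \<Rightarrow> 'a chain set) \<Rightarrow> bool" where
  "orientation n M ori \<longleftrightarrow>
     (\<forall>x\<in>topspace M.
        ori x \<in> carrier (local_homology_group n M {x}) \<and>
        generate (local_homology_group n M {x}) {ori x} =
          carrier (local_homology_group n M {x})) \<and>
     (\<forall>x\<in>topspace M. \<exists>U. openin M U \<and> x \<in> U \<and>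
        (\<exists>c\<in>carrier (local_homology_group n M U).
           \<forall>y\<in>U. restrict_class n M U {y} c = ori y))"

text \<open>The fundamental class of \<open>M\<close> around a compact set \<open>K\<close>, as a predicate.\<close>

definition fundamental_class ::
  "nat \<Rightarrow> 'a topology \<Rightarrow> ('a \<Rightarrow> 'a chain set) \<Rightarrow> 'a set \<Rightarrow> 'a chain set \<Rightarrow> bool" where
  "fundamental_class n M ori K c \<longleftrightarrow>
     c \<in> carrier (local_homology_group n M K) \<and>
     (\<forall>x\<in>K. restrict_class n M K {x} c = ori x)"

text \<open>The degree of a proper continuous map \<open>F: M \<rightarrow> N\<close> of oriented \<open>n\<close>-manifolds, \<open>N\<close> connected:
  for \<open>y \<in> N\<close> with (compact) preimage \<open>K\<close>, the map \<open>H_n(M, M - K) \<rightarrow> H_n(N, N - {y})\<close> takes the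
  fundamental class around \<open>K\<close> to the degree times the orientation class at \<open>y\<close>
  (A. Dold, Lectures on Algebraic Topology, VIII.4).\<close>

definition proper_degree ::
  "nat \<Rightarrow> 'a topology \<Rightarrow> ('a \<Rightarrow> 'a chain set) \<Rightarrow> 'b topology \<Rightarrow> ('b \<Rightarrow> 'b chain set)
     \<Rightarrow> ('a \<Rightarrow> 'b) \<Rightarrow> int" where
  "proper_degree n M oM N oN F =
     (THE d. \<forall>y\<in>topspace N. \<forall>c.
        fundamental_class n M oM {x \<in> topspace M. F x = y} c \<longrightarrow>
        hom_induced (int n) M (topspace M - {x \<in> topspace M. F x = y}) N (topspace N - {y}) F c =
          oN y [^]\<^bsub>local_homology_group n N {y}\<^esub> d)"

definition quadrant :: "(real \<times> real) topology" where
  "quadrant = top_of_set ({0<..} \<times> {0<..})"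

text \<open>The cohomogeneity one expander degree of \<open>S\<^sup>1 \<times> D\<^sup>3\<close> with respect to orientations of the
  domain and the target.\<close>

definition deg_sym_exp_S1_D3 ::
  "(real \<times> real \<Rightarrow> (real \<times> real) chain set) \<Rightarrow> (real \<times> real \<Rightarrow> (real \<times> real) chain set) \<Rightarrow> int"
  where
  "deg_sym_exp_S1_D3 oM oN = proper_degree 2 quadrant oM quadrant oN expander_map"

end

theory Submission
  imports Defs
begin

text \<open>Scaling \<open>a\<close> by a constant preserves the soliton equations, so \<open>F (a0, s) = (a0 * \<phi> s, \<psi> s)\<close> with positive
  functions \<open>\<phi>\<close>, \<open>\<psi>\<close> of \<open>s = - f''(0)\<close> alone. These are continuous, because the solution depends continuously
  on \<open>s\<close> and \<open>a'\<close>, \<open>b'\<close> converge at infinity locally uniformly in \<open>s\<close>. Monotonicity along the flow gives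
  \<open>1 / (3 s) \<le> (\<psi> s)\<^sup>2\<close>, and \<open>(\<psi> s)\<^sup>2 \<le> 2 / s\<close> for \<open>s \<ge> 2\<close>; hence \<open>\<psi>\<close> tends to \<open>\<infinity>\<close> at \<open>0\<close> and to \<open>0\<close> at \<open>\<infinity>\<close>, just
  like \<open>1 / s\<close>. The straight-line homotopy in the second component connects \<open>F\<close> to the homeomorphism
  \<open>(a, s) \<mapsto> (a * \<phi> s, 1 / s)\<close> through proper maps, and a homeomorphism has degree \<open>1\<close> or \<open>- 1\<close>.
  The fibre of \<open>F\<close> over a point lies on an arc, and relative classes around compact subsets of an arc are
  determined by their restrictions to points, by Mayer--Vietoris.\<close>

section \<open>Relative homology\<close>

text \<open>Two definite descriptions shape the argument. \<open>expander_map\<close> takes the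
  limits of whichever smooth soliton meets the boundary conditions, so evaluating it requires
  existence of a smooth solution, uniqueness among all smooth solitons, and convergence. The
  obstacle is the singularity at \<open>r = 0\<close>, where \<open>b\<close> vanishes and 1 / b^2
  is unbounded. The conservation law of gradient solitons expresses 1 / b^2 through the other
  unknowns; what remains has the form r y' + 3 y = G with regular G, a Volterra equation with
  bounded kernel. The price is that positivity of 1 / b^2 must be recovered afterwards from the
  solution. \<open>proper_degree\<close> takes an integer satisfying a condition on every
  fundamental class around every fibre. As \<psi> is not known to be monotone, a fibre may be a
  complicated compact set. Existence of a fundamental class is what pins the integer down;
  uniqueness is what makes the condition consistent. The map 1 / s is merely the simplest function
  with the same behaviour as \<psi> at both ends.\<close>

abbreviation restr :: "int \<Rightarrow> 'a topology \<Rightarrow> 'a set \<Rightarrow> 'a set \<Rightarrow> 'a chain set \<Rightarrow> 'a chain set" where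
  "restr p X S T \<equiv> hom_induced p X S X T id"

lemma id_in_funcset: "S \<subseteq> T \<Longrightarrow> id \<in> S \<rightarrow> T"
  by auto

lemma restr_restr:
  assumes "S \<subseteq> T" "T \<subseteq> U"
  shows "restr p X T U (restr p X S T c) = restr p X S U c"
  using hom_induced_compose'[of X X id S T X id U p c] assms by (simp add: id_in_funcset)

lemma restr_mult:
  assumes "x \<in> carrier (relative_homology_group p X S)" "y \<in> carrier (relative_homology_group p X S)"
  shows "hom_induced p X S Y T f (x \<otimes>\<^bsub>relative_homology_group p X S\<^esub> y)
    = hom_induced p X S Y T f x \<otimes>\<^bsub>relative_homology_group p Y T\<^esub> hom_induced p X S Y T f y"
  using hom_mult[OF hom_induced_hom] assms by blast

lemma hom_induced_one:
  "hom_induced p X S Y T f \<one>\<^bsub>relative_homology_group p X S\<^esub> = \<one>\<^bsub>relative_homology_group p Y T\<^esub>"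
  using hom_one[OF hom_induced_hom] by (metis group_relative_homology_group)

lemma hom_induced_inv:
  assumes "x \<in> carrier (relative_homology_group p X S)"
  shows "hom_induced p X S Y T f (inv\<^bsub>relative_homology_group p X S\<^esub> x)
    = inv\<^bsub>relative_homology_group p Y T\<^esub> hom_induced p X S Y T f x"
  by (meson assms group_hom.hom_inv group_hom.intro group_hom_axioms.intro
      group_relative_homology_group hom_induced_hom)

text \<open>A singular chain has compact support.\<close>
lemma restr_eq_one_near_point:
  assumes X: "Hausdorff_space X" and x: "x \<in> topspace X"
    and c: "c \<in> carrier (relative_homology_group (int p) X S)"
    and S: "S \<subseteq> topspace X - {x}"
    and c0: "restr (int p) X S (topspace X - {x}) c
             = \<one>\<^bsub>relative_homology_group (int p) X (topspace X - {x})\<^esub>"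
  obtains N where "openin X N" "x \<in> N"
    "\<And>T. \<lbrakk>S \<subseteq> T; topspace X - N \<subseteq> T\<rbrakk> \<Longrightarrow>
       restr (int p) X S T c = \<one>\<^bsub>relative_homology_group (int p) X T\<^esub>"
proof -
  obtain z where z: "c = homologous_rel_set p X S z" "singular_relcycle p X S z"
    using c by (auto simp: carrier_relative_homology_group)
  have im: "restr (int p) X S T c = homologous_rel_set p X T z" if "S \<subseteq> T" for T
    using that z hom_induced_chain_map[of X X id S T p z]
    by (simp add: chain_map_ident[of p X z] singular_relcycle id_in_funcset)
  have "singular_relboundary p X (topspace X - {x}) z"
    using c0 im[OF S] homologous_rel_set_eq_relboundary[of p X _ z] by simp
  then obtain d e where de: "singular_chain (Suc p) X d"
      "singular_chain p (subtopology X (topspace X - {x})) e" "chain_boundary (Suc p) d + e = z"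
    by (auto simp: singular_relboundary)
  \<comment> \<open>Modulo the boundary of \<open>d\<close>, the cycle \<open>z\<close> equals
    \<open>e\<close>. The image \<open>C\<close> of \<open>e\<close> is compact and misses
    \<open>x\<close>, so its complement serves as \<open>N\<close> for every \<open>T\<close> at
    once.\<close>
  define C where "C = (\<Union>f\<in>Poly_Mapping.keys e. f ` standard_simplex p)"
  have C1: "C \<subseteq> topspace X - {x}"
    using de(2) unfolding C_def singular_chain_subtopology by blast
  have "compactin X (f ` standard_simplex p)" if "f \<in> Poly_Mapping.keys e" for f
  proof -
    have "singular_simplex p X f"
      using de(2) that by (auto simp: singular_chain_def singular_simplex_subtopology)
    then have "continuous_map (subtopology (powertop_real UNIV) (standard_simplex p)) X f"
      by (simp add: singular_simplex_def)
    moreover have "compactin (subtopology (powertop_real UNIV) (standard_simplex p)) (standard_simplex p)"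
      using compactin_standard_simplex by (simp add: compactin_subtopology)
    ultimately show ?thesis
      using image_compactin by blast
  qed
  then have "compactin X C"
    unfolding C_def by (intro compactin_Union) auto
  then have cl: "closedin X C"
    using X by (simp add: compactin_imp_closedin)
  show thesis
  proof
    show "openin X (topspace X - C)" using cl by blast
    show "x \<in> topspace X - C" using C1 x by auto
    fix T assume T: "S \<subseteq> T" "topspace X - (topspace X - C) \<subseteq> T"
    have "C \<subseteq> T" using C1 T by blast
    then have "singular_chain p (subtopology X T) e"
      using de(2) unfolding singular_chain_subtopology C_def by blast
    then have "singular_relboundary p X T z"
      using de by (auto simp: singular_relboundary)
    then show "restr (int p) X S T c = \<one>\<^bsub>relative_homology_group (int p) X T\<^esub>"
      using im[OF T(1)] homologous_rel_set_eq_relboundary[of p X T z] by simp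
  qed
qed

section \<open>Excision and the relative Mayer-Vietoris sequence of two open sets\<close>

lemma excision_two_open:
  assumes "openin X A" "openin X B"
  shows "hom_induced p (subtopology X A) (A \<inter> B) (subtopology X (A \<union> B)) B id
    \<in> iso (relative_homology_group p (subtopology X A) (A \<inter> B))
          (relative_homology_group p (subtopology X (A \<union> B)) B)"
proof -
  let ?X = "subtopology X (A \<union> B)"
  have AB: "A \<subseteq> topspace X" "B \<subseteq> topspace X"
    using assms by (auto dest: openin_subset)
  have oA: "openin ?X A" and oB: "openin ?X B"
    using assms by (auto simp: openin_open_subtopology openin_Un)
  \<comment> \<open>The set to be excised from the pair (A \<union> B, B). Being closed and
    contained in the open set \<open>B\<close>, it satisfies the closure condition of the excision
    axiom.\<close>
  have "closedin ?X (B - A)"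
  proof -
    have "topspace ?X - A = B - A" using AB by auto
    then show ?thesis using oA by (metis closedin_diff closedin_topspace)
  qed
  then have "?X closure_of (B - A) \<subseteq> ?X interior_of B"
    using oB by (simp add: closure_of_closedin interior_of_openin)
  moreover have "A \<union> B - (B - A) = A" "B - (B - A) = A \<inter> B" by auto
  ultimately show ?thesis
    using homology_excision_axiom[of ?X "B - A" B "A \<union> B" p] AB
    by (simp add: subtopology_subtopology Int_absorb2 Int_absorb1)
qed

lemma iso_eq_one:
  assumes "hom_induced p X S Y T f \<in> iso (relative_homology_group p X S) (relative_homology_group p Y T)"
    and "y \<in> carrier (relative_homology_group p X S)"
    and "hom_induced p X S Y T f y = \<one>\<^bsub>relative_homology_group p Y T\<^esub>"
  shows "y = \<one>\<^bsub>relative_homology_group p X S\<^esub>"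
proof (rule inj_onD[of "hom_induced p X S Y T f" "carrier (relative_homology_group p X S)"])
  show "inj_on (hom_induced p X S Y T f) (carrier (relative_homology_group p X S))"
    using assms(1) by (simp add: iso_def bij_betw_def)
  show "hom_induced p X S Y T f y = hom_induced p X S Y T f \<one>\<^bsub>relative_homology_group p X S\<^esub>"
    using assms(3) by (simp add: hom_induced_one)
  show "\<one>\<^bsub>relative_homology_group p X S\<^esub> \<in> carrier (relative_homology_group p X S)"
    by (simp add: group.is_monoid monoid.one_closed del: one_relative_homology_group)
qed (use assms in auto)

lemma exact_triple_lift:
  assumes "T \<subseteq> S" "z \<in> carrier (relative_homology_group p X T)"
    and "restr p X T S z = \<one>\<^bsub>relative_homology_group p X S\<^esub>"
  obtains y where "y \<in> carrier (relative_homology_group p (subtopology X S) T)"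
    "hom_induced p (subtopology X S) T X T id y = z"
proof -
  have "kernel (relative_homology_group p X T) (relative_homology_group p X S) (restr p X T S)
    = hom_induced p (subtopology X S) T X T id ` carrier (relative_homology_group p (subtopology X S) T)"
    using homology_exactness_triple_3[OF assms(1), of p X] by simp
  then have "z \<in> hom_induced p (subtopology X S) T X T id ` carrier (relative_homology_group p (subtopology X S) T)"
    using assms by (auto simp: kernel_def)
  with that show thesis by auto
qed

text \<open>Since \<open>z\<close> dies in (X, A), it comes from a class \<open>y\<close> of (A, A
  \<inter> B). Excision turns \<open>y\<close> into a class \<open>y'\<close> of (A \<union> B, B)
  that dies in (X, B), hence is the boundary of a class of (X, A \<union> B) in degree p + 1, where
  there is only the trivial one.\<close>

lemma mayer_vietoris_injective:
  assumes "openin X A" "openin X B"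
    and triv: "trivial_group (relative_homology_group (p + 1) X (A \<union> B))"
    and z: "z \<in> carrier (relative_homology_group p X (A \<inter> B))"
    and zA: "restr p X (A \<inter> B) A z = \<one>\<^bsub>relative_homology_group p X A\<^esub>"
    and zB: "restr p X (A \<inter> B) B z = \<one>\<^bsub>relative_homology_group p X B\<^esub>"
  shows "z = \<one>\<^bsub>relative_homology_group p X (A \<inter> B)\<^esub>"
proof -
  let ?XA = "subtopology X A" and ?XU = "subtopology X (A \<union> B)"
  obtain y where y: "y \<in> carrier (relative_homology_group p ?XA (A \<inter> B))"
    and yz: "hom_induced p ?XA (A \<inter> B) X (A \<inter> B) id y = z"
    using exact_triple_lift[of "A \<inter> B" A z p X] z zA by auto
  define y' where "y' = hom_induced p ?XA (A \<inter> B) ?XU B id y"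
  have y': "y' \<in> carrier (relative_homology_group p ?XU B)"
    unfolding y'_def by (rule hom_induced_carrier)
  have cm: "continuous_map ?XA ?XU id"
    by (auto simp: continuous_map_in_subtopology continuous_map_from_subtopology)
  have cm2: "continuous_map ?XU X id" "continuous_map ?XA X id" 
    by (simp_all add: continuous_map_from_subtopology)
  have "hom_induced p ?XU B X B id y' = hom_induced p ?XA (A \<inter> B) X B id y"
    unfolding y'_def using hom_induced_compose'[OF cm, of "A \<inter> B" B X id B p y] cm2 by auto
  also have "\<dots> = restr p X (A \<inter> B) B z"
    using hom_induced_compose'[OF cm2(2), of "A \<inter> B" "A \<inter> B" X id B p y] yz by auto
  finally have y'1: "hom_induced p ?XU B X B id y' = \<one>\<^bsub>relative_homology_group p X B\<^esub>"
    using zB by simp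
  have "kernel (relative_homology_group p ?XU B) (relative_homology_group p X B) (hom_induced p ?XU B X B id)
     = hom_relboundary (p+1) X (A \<union> B) B ` carrier (relative_homology_group (p+1) X (A \<union> B))"
    using homology_exactness_triple_2[of B "A \<union> B" "p+1" X] by simp
  then obtain t where t: "t \<in> carrier (relative_homology_group (p+1) X (A \<union> B))"
     "y' = hom_relboundary (p+1) X (A \<union> B) B t"
    using y' y'1 unfolding kernel_def by blast
  have "t = \<one>\<^bsub>relative_homology_group (p+1) X (A \<union> B)\<^esub>"
    using triv t(1) by (auto simp: trivial_group_def)
  then have "y' = \<one>\<^bsub>relative_homology_group p ?XU B\<^esub>"
    using t(2) hom_one[OF group_homomorphism_hom_relboundary[of "p+1" X "A \<union> B" B]]
    by simp
  then have "y = \<one>\<^bsub>relative_homology_group p ?XA (A \<inter> B)\<^esub>"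
    using iso_eq_one[OF excision_two_open[OF assms(1,2), of p] y] by (simp add: y'_def)
  then show ?thesis
    using yz hom_induced_one by metis
qed

text \<open>By naturality and excision, the boundary of \<open>c1\<close> in (A, A \<inter> B) is
  governed by its image in (X, A \<union> B). That image also comes from \<open>c2\<close>, so the
  boundary vanishes and \<open>c1\<close> lifts. The lift is then corrected over \<open>B\<close>
  without changing its image in (X, A).\<close>

lemma mayer_vietoris_surjective:
  assumes "openin X A" "openin X B"
    and c1: "c1 \<in> carrier (relative_homology_group p X A)"
    and c2: "c2 \<in> carrier (relative_homology_group p X B)"
    and eq: "restr p X A (A \<union> B) c1 = restr p X B (A \<union> B) c2"
  obtains c where "c \<in> carrier (relative_homology_group p X (A \<inter> B))"
    "restr p X (A \<inter> B) A c = c1" "restr p X (A \<inter> B) B c = c2"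
proof -
  let ?XA = "subtopology X A" and ?XU = "subtopology X (A \<union> B)"
  let ?G = "relative_homology_group p X (A \<inter> B)" and ?GB = "relative_homology_group p X B"
  let ?GA = "relative_homology_group p X A" and ?GU = "relative_homology_group p X (A \<union> B)"
  have cm: "continuous_map ?XA ?XU id"
    by (auto simp: continuous_map_in_subtopology continuous_map_from_subtopology)
  have cm2: "continuous_map ?XU X id" "continuous_map ?XA X id" 
    by (simp_all add: continuous_map_from_subtopology)
  have iso: "hom_induced (p-1) ?XA (A \<inter> B) ?XU B id
    \<in> iso (relative_homology_group (p-1) ?XA (A \<inter> B)) (relative_homology_group (p-1) ?XU B)"
    by (rule excision_two_open[OF assms(1,2)])
  have "hom_induced (p-1) ?XA (A \<inter> B) ?XU B id (hom_relboundary p X A (A \<inter> B) c1)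
      = hom_relboundary p X (A \<union> B) B (restr p X A (A \<union> B) c1)"
    using fun_cong[OF naturality_hom_induced_relboundary[of X X id A "A \<union> B" "A \<inter> B" B p], of c1]
    by auto
  also have "\<dots> = hom_relboundary p X (A \<union> B) B (restr p X B (A \<union> B) c2)"
    using eq by simp
  also have "\<dots> = \<one>\<^bsub>relative_homology_group (p-1) ?XU B\<^esub>"
    using homology_exactness_triple_1[of B "A \<union> B" p X] c2 by (auto simp: kernel_def)
  finally have "hom_relboundary p X A (A \<inter> B) c1 = \<one>\<^bsub>relative_homology_group (p-1) ?XA (A \<inter> B)\<^esub>"
    using iso_eq_one[OF iso hom_relboundary] by simp
  then have "c1 \<in> restr p X (A \<inter> B) A ` carrier ?G"
    using homology_exactness_triple_1[of "A \<inter> B" A p X] c1 by (auto simp: kernel_def)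
  then obtain c where c: "c \<in> carrier ?G" "restr p X (A \<inter> B) A c = c1" by auto
  interpret G: comm_group ?G by simp
  interpret GA: comm_group ?GA by simp
  interpret GB: comm_group ?GB by simp
  interpret GU: comm_group ?GU by simp
  \<comment> \<open>\<open>c\<close> is right over \<open>A\<close>; its restriction
    \<open>d\<close> to \<open>B\<close> may miss \<open>c2\<close>. The defect \<open>z\<close>
    dies in (X, A \<union> B), so it comes from (A \<union> B, B) and by excision from (A, A
    \<inter> B). A class of that origin is invisible in (X, A).\<close>
  define d where "d = restr p X (A \<inter> B) B c"
  have d: "d \<in> carrier ?GB" unfolding d_def by (rule hom_induced_carrier)
  have dU: "restr p X B (A \<union> B) d = restr p X B (A \<union> B) c2"
    unfolding d_def using c eq by (simp add: restr_restr flip: c(2))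
  define z where "z = c2 \<otimes>\<^bsub>?GB\<^esub> inv\<^bsub>?GB\<^esub> d"
  have z: "z \<in> carrier ?GB" using c2 d unfolding z_def by simp
  have "restr p X B (A \<union> B) z = \<one>\<^bsub>?GU\<^esub>"
    unfolding z_def using c2 d dU
    by (simp add: restr_mult hom_induced_inv hom_induced_carrier)
  then obtain y where y: "y \<in> carrier (relative_homology_group p ?XU B)"
    "hom_induced p ?XU B X B id y = z"
    using exact_triple_lift[of B "A \<union> B" z p X] z by auto
  have "hom_induced p ?XA (A \<inter> B) ?XU B id ` carrier (relative_homology_group p ?XA (A \<inter> B))
    = carrier (relative_homology_group p ?XU B)"
    using excision_two_open[OF assms(1,2), of p] by (simp add: iso_def bij_betw_def)
  then obtain e where e: "e \<in> carrier (relative_homology_group p ?XA (A \<inter> B))"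
    "hom_induced p ?XA (A \<inter> B) ?XU B id e = y"
    using y(1) by (metis (no_types, lifting) imageE)
  define e' where "e' = hom_induced p ?XA (A \<inter> B) X (A \<inter> B) id e"
  have e': "e' \<in> carrier ?G" unfolding e'_def by (rule hom_induced_carrier)
  have "restr p X (A \<inter> B) B e' = hom_induced p ?XA (A \<inter> B) X B id e"
    using hom_induced_compose'[OF cm2(2), of "A \<inter> B" "A \<inter> B" X id B p e] by (auto simp: e'_def)
  also have "\<dots> = z"
    using hom_induced_compose'[OF cm, of "A \<inter> B" B X id B p e] cm2 e y by auto
  finally have eB: "restr p X (A \<inter> B) B e' = z" .
  have eA: "restr p X (A \<inter> B) A e' = \<one>\<^bsub>?GA\<^esub>"
    using homology_exactness_triple_3[of "A \<inter> B" A p X] e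
    by (auto simp: kernel_def e'_def)
  show thesis
  proof
    show "c \<otimes>\<^bsub>?G\<^esub> e' \<in> carrier ?G" using c e' by simp
    show "restr p X (A \<inter> B) A (c \<otimes>\<^bsub>?G\<^esub> e') = c1"
      using c e' eA c1 by (simp add: restr_mult)
    show "restr p X (A \<inter> B) B (c \<otimes>\<^bsub>?G\<^esub> e') = c2"
      using c e' eB c2 d by (simp add: restr_mult z_def GB.m_lcomm flip: d_def)
  qed
qed

section \<open>Orientations\<close>

text \<open>An isomorphism to the integers sends a generator to 1 or -1. The first two claims give
  exactly two orientations at a point, the third makes the degree unique.\<close>

lemma iso_integer_group_generators:
  assumes "G \<cong> integer_group" "group G"
    and g: "g \<in> carrier G" "generate G {g} = carrier G"
    and h: "h \<in> carrier G" "generate G {h} = carrier G"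
  shows "h = g \<or> h = inv\<^bsub>G\<^esub> g" "g \<noteq> inv\<^bsub>G\<^esub> g"
    "\<And>i j :: int. g [^]\<^bsub>G\<^esub> i = g [^]\<^bsub>G\<^esub> j \<Longrightarrow> i = j"
proof -
  interpret group G by fact
  obtain f where f: "f \<in> iso G integer_group"
    using assms(1) by (auto simp: is_iso_def)
  interpret f: group_hom G integer_group f
    using f by (auto simp: group_hom_def group_hom_axioms_def iso_def assms(2))
  have inj: "inj_on f (carrier G)" and surj: "f ` carrier G = UNIV"
    using f by (auto simp: iso_def bij_betw_def integer_group_def)
  have pow: "f (x [^]\<^bsub>G\<^esub> (k::int)) = k * f x" if "x \<in> carrier G" for x k
    using f.hom_int_pow[OF that] by simp
  have unit: "\<bar>f x\<bar> = 1" if x: "x \<in> carrier G" "generate G {x} = carrier G" for x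
  proof -
    have "1 \<in> f ` carrier G" using surj by simp
    then have "1 \<in> f ` generate G {x}" using x by simp
    then obtain k :: int where "1 = f (x [^]\<^bsub>G\<^esub> k)"
      using generate_pow[OF x(1)] by auto
    then have "k * f x = 1" using pow[OF x(1)] by simp
    then show ?thesis by (auto simp: zmult_eq_1_iff)
  qed
  have finv: "f (inv\<^bsub>G\<^esub> g) = - f g"
    using f.hom_inv[OF g(1)] by simp
  have "f h = f g \<or> f h = f (inv\<^bsub>G\<^esub> g)"
    using unit[OF g] unit[OF h] finv by linarith
  then show "h = g \<or> h = inv\<^bsub>G\<^esub> g"
    using inj_onD[OF inj] g h by blast
  show "g \<noteq> inv\<^bsub>G\<^esub> g" using finv unit[OF g] by auto
  show "i = j" if "g [^]\<^bsub>G\<^esub> i = g [^]\<^bsub>G\<^esub> j" for i j :: int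
    using pow[OF g(1), of i] pow[OF g(1), of j] unit[OF g] that by auto
qed

lemma quadrant_homeomorphic_Euclidean_space:
  obtains f where "homeomorphic_map quadrant (Euclidean_space 2) f"
proof -
  have "homeomorphic_maps (euclidean :: (real \<times> real) topology) quadrant
     (\<lambda>p. (exp (fst p), exp (snd p))) (\<lambda>p. (ln (fst p), ln (snd p)))"
    unfolding homeomorphic_maps_def quadrant_def
    by (auto intro!: continuous_intros simp: continuous_map_in_subtopology)
  then have 1: "quadrant homeomorphic_space (euclidean :: (real \<times> real) topology)"
    using homeomorphic_space_def homeomorphic_space_sym by blast
  have DIM_real_real: "DIM(real \<times> real) = 2" by simp
  obtain f :: "(nat \<Rightarrow> real) \<Rightarrow> real \<times> real" and g
    where "homeomorphic_maps (Euclidean_space (DIM(real \<times> real))) euclidean f g"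
    using homeomorphic_maps_Euclidean_space_euclidean by blast
  then have "Euclidean_space 2 homeomorphic_space (euclidean :: (real \<times> real) topology)"
    unfolding homeomorphic_space_def DIM_real_real by blast
  then have "quadrant homeomorphic_space Euclidean_space 2"
    using 1 homeomorphic_space_sym homeomorphic_space_trans by blast
  then show thesis using that homeomorphic_space by blast
qed

text \<open>Moving the point to the origin of the plane and lowering the dimension twice identifies
  degree p + 2 with degree p of the homology of a point. Degree 2 carries the orientations;
  triviality in degree 3 feeds \<open>mayer_vietoris_injective\<close> at a point where two pieces
  of an arc meet.\<close>

lemma local_homology_quadrant:
  assumes x: "x \<in> topspace quadrant"
  shows "relative_homology_group 2 quadrant (topspace quadrant - {x}) \<cong> integer_group"
    and "trivial_group (relative_homology_group 3 quadrant (topspace quadrant - {x}))"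
proof -
  let ?E = "Euclidean_space 2" and ?Z = "Euclidean_space 0" and ?o = "(\<lambda>i. 0) :: nat \<Rightarrow> real"
  obtain f where f: "homeomorphic_map quadrant ?E f"
    by (rule quadrant_homeomorphic_Euclidean_space)
  have fx: "f x \<in> topspace ?E"
    using f x homeomorphic_imp_surjective_map by blast
  have im: "f ` (topspace quadrant - {x}) = topspace ?E - {f x}"
    using homeomorphic_imp_injective_map[OF f] homeomorphic_imp_surjective_map[OF f] x
    by (auto simp: inj_on_def)
  have o: "?o \<in> topspace ?E" by (simp add: topspace_Euclidean_space)
  have t1: "t1_space ?E"
    by (metis Hausdorff_Euclidean_space Hausdorff_imp_t1_space)
  have topZ: "topspace ?Z = {?o}"
    by (auto simp: topspace_Euclidean_space)
  have 1: "relative_homology_group p quadrant (topspace quadrant - {x})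
      \<cong> relative_homology_group p ?E (topspace ?E - {f x})" for p
    by (rule is_isoI[OF homeomorphic_map_relative_homology_iso[OF f Diff_subset im]])
  have 2: "relative_homology_group p ?E (topspace ?E - {f x})
      \<cong> relative_homology_group p ?E (topspace ?E - {?o})" for p
  proof (rule isomorphic_relative_homology_groups_Euclidean_complements)
    show "closedin ?E {f x}" "closedin ?E {?o}"
      using t1 fx o by (simp_all add: closedin_t1_singleton)
    have "homeomorphic_maps (subtopology ?E {f x}) (subtopology ?E {?o}) (\<lambda>_. ?o) (\<lambda>_. f x)"
      using fx o by (auto simp: homeomorphic_maps_def continuous_map_in_subtopology)
    then show "subtopology ?E {f x} homeomorphic_space subtopology ?E {?o}"
      using homeomorphic_space_def by blast
  qed
  have 3: "relative_homology_group (p + 2) ?E (topspace ?E - {?o}) \<cong> homology_group p ?Z" for p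
  proof -
    have "closedin ?Z {?o}" by (metis closedin_topspace topZ)
    from relative_homology_group_Euclidean_complement_step[OF this, of p 2]
    have "homology_group p ?Z \<cong> relative_homology_group (p + 2) ?E (topspace ?E - {?o})"
      by (simp only: topZ add_0 Diff_cancel of_nat_numeral)
    then show ?thesis by (simp add: group.iso_sym)
  qed
  have 4: "relative_homology_group (p+2) quadrant (topspace quadrant - {x}) \<cong> homology_group p ?Z" for p
    by (rule iso_trans[OF iso_trans[OF 1 2] 3])
  have "relative_homology_group (0+2) quadrant (topspace quadrant - {x}) \<cong> integer_group"
    by (rule iso_trans[OF 4 homology_coefficients[OF topZ]])
  then show "relative_homology_group 2 quadrant (topspace quadrant - {x}) \<cong> integer_group"
    by (simp only: add_0)
  have "trivial_group (homology_group 1 ?Z)"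
    using homology_dimension_axiom[OF topZ] by simp
  then show "trivial_group (relative_homology_group 3 quadrant (topspace quadrant - {x}))"
    using isomorphic_group_triviality[OF 4[of 1]] by simp
qed

section \<open>Restriction of classes and comparison of orientations\<close>

lemma orientation_carrier:
  assumes "orientation n M o1" "x \<in> topspace M"
  shows "o1 x \<in> carrier (local_homology_group n M {x})"
  using assms by (auto simp: orientation_def)

lemma orientation_generate:
  assumes "orientation n M o1" "x \<in> topspace M"
  shows "generate (local_homology_group n M {x}) {o1 x} = carrier (local_homology_group n M {x})"
  using assms by (auto simp: orientation_def)

lemma restrict_class_carrier:
  "restrict_class n M A B c \<in> carrier (local_homology_group n M B)"
  by (simp add: restrict_class_def hom_induced_carrier)

lemma restrict_class_trans:
  assumes "B \<subseteq> A" "C \<subseteq> B"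
  shows "restrict_class n M B C (restrict_class n M A B c) = restrict_class n M A C c"
  using assms by (simp add: restrict_class_def restr_restr Diff_mono)

lemma restrict_class_id:
  assumes "c \<in> carrier (local_homology_group n M A)"
  shows "restrict_class n M A A c = c"
  using assms by (simp add: restrict_class_def hom_induced_id)

lemma restrict_class_diff:
  assumes "c \<in> carrier (local_homology_group n M A)" "d \<in> carrier (local_homology_group n M A)"
  shows "restrict_class n M A B (c \<otimes>\<^bsub>local_homology_group n M A\<^esub> inv\<^bsub>local_homology_group n M A\<^esub> d)
    = restrict_class n M A B c \<otimes>\<^bsub>local_homology_group n M B\<^esub>
      inv\<^bsub>local_homology_group n M B\<^esub> (restrict_class n M A B d)"
  using assms by (simp add: restrict_class_def restr_mult hom_induced_inv)

lemma local_homology_diff_eq_one_iff: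
  assumes "c \<in> carrier (local_homology_group n M A)" "d \<in> carrier (local_homology_group n M A)"
  shows "c \<otimes>\<^bsub>local_homology_group n M A\<^esub> inv\<^bsub>local_homology_group n M A\<^esub> d
     = \<one>\<^bsub>local_homology_group n M A\<^esub> \<longleftrightarrow> c = d"
proof -
  interpret group "local_homology_group n M A" by simp
  show ?thesis
    using assms by (metis inv_equality inv_inv inv_closed r_inv)
qed

lemma orientation_inv:
  assumes "orientation n M o1"
  shows "orientation n M (\<lambda>x. inv\<^bsub>local_homology_group n M {x}\<^esub> o1 x)"
  unfolding orientation_def
proof (intro conjI ballI)
  fix x assume x: "x \<in> topspace M"
  interpret group "local_homology_group n M {x}" by simp
  have c: "o1 x \<in> carrier (local_homology_group n M {x})"
    using orientation_carrier[OF assms x] .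
  then show "inv\<^bsub>local_homology_group n M {x}\<^esub> o1 x \<in> carrier (local_homology_group n M {x})"
    by simp
  have "o1 x \<in> generate (local_homology_group n M {x}) {inv\<^bsub>local_homology_group n M {x}\<^esub> o1 x}"
    by (metis c generate.inv inv_inv insertI1)
  then have "generate (local_homology_group n M {x}) {o1 x}
     \<subseteq> generate (local_homology_group n M {x}) {inv\<^bsub>local_homology_group n M {x}\<^esub> o1 x}"
    using c by (intro generate_subgroup_incl generate_is_subgroup) auto
  then show "generate (local_homology_group n M {x}) {inv\<^bsub>local_homology_group n M {x}\<^esub> o1 x}
      = carrier (local_homology_group n M {x})"
    using orientation_generate[OF assms x] c generate_incl[of "{inv\<^bsub>local_homology_group n M {x}\<^esub> o1 x}"]
    by auto
next
  fix x assume x: "x \<in> topspace M"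
  then obtain U c where U: "openin M U" "x \<in> U" "c \<in> carrier (local_homology_group n M U)"
     "\<forall>y\<in>U. restrict_class n M U {y} c = o1 y"
    using assms unfolding orientation_def by meson
  interpret group "local_homology_group n M U" by simp
  have "\<forall>y\<in>U. restrict_class n M U {y} (inv\<^bsub>local_homology_group n M U\<^esub> c)
      = inv\<^bsub>local_homology_group n M {y}\<^esub> o1 y"
    using U by (simp add: restrict_class_def hom_induced_inv)
  then show "\<exists>U. openin M U \<and> x \<in> U \<and> (\<exists>c\<in>carrier (local_homology_group n M U).
      \<forall>y\<in>U. restrict_class n M U {y} c = inv\<^bsub>local_homology_group n M {y}\<^esub> o1 y)"
    using U inv_closed by blast
qed

text \<open>The difference of the two local inducing classes vanishes at \<open>x\<close>, hence
  near \<open>x\<close>, because chains have compact support.\<close>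

lemma orientations_agree_locally:
  assumes H: "Hausdorff_space M" and o1: "orientation n M o1" and o2: "orientation n M o2"
    and x: "x \<in> topspace M" and eq: "o1 x = o2 x"
  obtains N where "openin M N" "x \<in> N" "\<And>y. y \<in> N \<Longrightarrow> o1 y = o2 y"
proof -
  obtain U c where U: "openin M U" "x \<in> U" "c \<in> carrier (local_homology_group n M U)"
     "\<forall>y\<in>U. restrict_class n M U {y} c = o1 y"
    using o1 x unfolding orientation_def by meson
  obtain V d where V: "openin M V" "x \<in> V" "d \<in> carrier (local_homology_group n M V)"
     "\<forall>y\<in>V. restrict_class n M V {y} d = o2 y"
    using o2 x unfolding orientation_def by meson
  define W where "W = U \<inter> V"
  let ?G = "local_homology_group n M W"
  define c' where "c' = restrict_class n M U W c"
  define d' where "d' = restrict_class n M V W d"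
  have c': "c' \<in> carrier ?G" and d': "d' \<in> carrier ?G"
    by (simp_all add: c'_def d'_def restrict_class_carrier)
  have c'y: "restrict_class n M W {y} c' = o1 y" and d'y: "restrict_class n M W {y} d' = o2 y"
    if "y \<in> W" for y
    using that U(4) V(4) by (simp_all add: c'_def d'_def W_def restrict_class_trans)
  interpret group ?G by simp
  define e where "e = c' \<otimes>\<^bsub>?G\<^esub> inv\<^bsub>?G\<^esub> d'"
  have e: "e \<in> carrier ?G" using c' d' by (simp add: e_def)
  have ey: "restrict_class n M W {y} e = o1 y \<otimes>\<^bsub>local_homology_group n M {y}\<^esub>
      inv\<^bsub>local_homology_group n M {y}\<^esub> o2 y" if "y \<in> W" for y
    unfolding e_def using c' d' that by (simp add: restrict_class_diff c'y d'y)
  have Wt: "W \<subseteq> topspace M" using U V by (auto simp: W_def dest: openin_subset)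
  have "restrict_class n M W {x} e = \<one>\<^bsub>local_homology_group n M {x}\<^esub>"
    using ey[of x] U V eq local_homology_diff_eq_one_iff[OF orientation_carrier[OF o1 x] orientation_carrier[OF o2 x]]
    by (simp add: W_def)
  then obtain N where N: "openin M N" "x \<in> N"
    "\<And>T. \<lbrakk>topspace M - W \<subseteq> T; topspace M - N \<subseteq> T\<rbrakk> \<Longrightarrow>
       restr (int n) M (topspace M - W) T e = \<one>\<^bsub>relative_homology_group (int n) M T\<^esub>"
    using restr_eq_one_near_point[OF H x e] U V unfolding restrict_class_def W_def by blast
  show thesis
  proof
    show "openin M (N \<inter> W)" using N U V by (auto simp: W_def)
    show "x \<in> N \<inter> W" using N U V by (auto simp: W_def)
    fix y assume y: "y \<in> N \<inter> W"
    then have "restrict_class n M W {y} e = \<one>\<^bsub>local_homology_group n M {y}\<^esub>"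
      unfolding restrict_class_def by (intro N(3)) auto
    then show "o1 y = o2 y"
      using ey[of y] y Wt local_homology_diff_eq_one_iff[OF orientation_carrier[OF o1] orientation_carrier[OF o2], of y]
      by (auto simp del: one_relative_homology_group)
  qed
qed

text \<open>At each point one generator is the other or its inverse, never both. Either case holds
  on an open set by \<open>orientations_agree_locally\<close>, so connectedness leaves only one of
  them.\<close>

lemma orientations_connected:
  assumes H: "Hausdorff_space M" and C: "connected_space M"
    and Z: "\<And>x. x \<in> topspace M \<Longrightarrow> local_homology_group n M {x} \<cong> integer_group"
    and o1: "orientation n M o1" and o2: "orientation n M o2"
  obtains "\<And>x. x \<in> topspace M \<Longrightarrow> o1 x = o2 x"
  | "\<And>x. x \<in> topspace M \<Longrightarrow> o1 x = inv\<^bsub>local_homology_group n M {x}\<^esub> o2 x"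
proof -
  let ?o3 = "\<lambda>x. inv\<^bsub>local_homology_group n M {x}\<^esub> o2 x"
  have op: "openin M {x \<in> topspace M. o1 x = o3 x}" if o3: "orientation n M o3" for o3
  proof (subst openin_subopen, clarify)
    fix x assume "x \<in> topspace M" "o1 x = o3 x"
    then obtain N where N: "openin M N" "x \<in> N" "\<And>y. y \<in> N \<Longrightarrow> o1 y = o3 y"
      using orientations_agree_locally[OF H o1 o3 \<open>x \<in> topspace M\<close> \<open>o1 x = o3 x\<close>] by blast
    then show "\<exists>T. openin M T \<and> x \<in> T \<and> T \<subseteq> {x \<in> topspace M. o1 x = o3 x}"
      using openin_subset[OF N(1)] by (intro exI[of _ N]) auto
  qed
  define U where "U = {x \<in> topspace M. o1 x = o2 x}"
  define V where "V = {x \<in> topspace M. o1 x = ?o3 x}"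
  have UV: "openin M U" "openin M V"
    unfolding U_def V_def using op[OF o2] op[OF orientation_inv[OF o2]] by auto
  have gen: "o1 x = o2 x \<or> o1 x = ?o3 x" "o2 x \<noteq> ?o3 x" if "x \<in> topspace M" for x
    using iso_integer_group_generators(1,2)[OF Z[OF that] _ orientation_carrier[OF o2 that] orientation_generate[OF o2 that]
      orientation_carrier[OF o1 that] orientation_generate[OF o1 that]] by auto
  have "topspace M \<subseteq> U \<union> V"
    using gen(1) unfolding U_def V_def by blast
  moreover have "U \<inter> V = {}"
    unfolding U_def V_def using gen(2) by (smt (verit) disjoint_iff mem_Collect_eq)
  ultimately have "U = {} \<or> V = {}"
    using connected_spaceD[OF C UV] by blast
  then show thesis
    using that gen unfolding U_def V_def by blast
qed

text \<open>Orientations can only be compared on one space, so that of the domain is carried over by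
  the homeomorphism. The class inducing it near \<open>y\<close> is the image of the one on a
  neighbourhood \<open>U\<close> of \<open>g y\<close>.\<close>

lemma orientation_homeomorphic_image:
  assumes hm: "homeomorphic_maps M N f g" and o1: "orientation n M o1"
  shows "orientation n N (\<lambda>y. hom_induced (int n) M (topspace M - {g y}) N (topspace N - {y}) f (o1 (g y)))"
    (is "orientation n N ?o2")
  unfolding orientation_def
proof (intro conjI ballI)
  have cf: "continuous_map M N f" and cg: "continuous_map N M g"
    and gf: "\<And>x. x \<in> topspace M \<Longrightarrow> g (f x) = x" and fg: "\<And>y. y \<in> topspace N \<Longrightarrow> f (g y) = y"
    using hm by (auto simp: homeomorphic_maps_def)
  have fM: "\<And>x. x \<in> topspace M \<Longrightarrow> f x \<in> topspace N" and gN: "\<And>y. y \<in> topspace N \<Longrightarrow> g y \<in> topspace M"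
    using cf cg by (auto simp: continuous_map_def)
  fix y assume y: "y \<in> topspace N"
  let ?G = "local_homology_group n M {g y}" and ?H = "local_homology_group n N {y}"
  let ?h = "hom_induced (int n) M (topspace M - {g y}) N (topspace N - {y}) f"
  show "?o2 y \<in> carrier ?H" by (simp add: hom_induced_carrier)
  have iso: "?h \<in> iso ?G ?H"
  proof (rule group_isomorphisms_imp_iso[OF homeomorphic_maps_relative_homology_group_isomorphisms[OF hm]])
    show "f \<in> topspace M - {g y} \<rightarrow> topspace N - {y}"
      using fM gf by auto
    show "g \<in> topspace N - {y} \<rightarrow> topspace M - {g y}"
      using gN fg y by auto (metis)
  qed
  interpret h: group_hom ?G ?H ?h
    using iso by (auto simp: group_hom_def group_hom_axioms_def iso_def)
  have "generate ?H {?o2 y} = ?h ` generate ?G {o1 (g y)}"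
    using h.generate_img[of "{o1 (g y)}"] orientation_carrier[OF o1 gN[OF y]] by simp
  also have "\<dots> = carrier ?H"
    using orientation_generate[OF o1 gN[OF y]] iso by (simp add: iso_def bij_betw_def)
  finally show "generate ?H {?o2 y} = carrier ?H" .
  obtain U c where U: "openin M U" "g y \<in> U" "c \<in> carrier (local_homology_group n M U)"
     "\<forall>x\<in>U. restrict_class n M U {x} c = o1 x"
    using o1 gN[OF y] unfolding orientation_def by meson
  define V where "V = {z \<in> topspace N. g z \<in> U}"
  have V: "openin N V" "y \<in> V"
    using cg U y unfolding V_def by (auto simp: continuous_map)
  define d where "d = hom_induced (int n) M (topspace M - U) N (topspace N - V) f c"
  have "d \<in> carrier (local_homology_group n N V)"
    by (simp add: d_def hom_induced_carrier)
  moreover have "restrict_class n N V {z} d = ?o2 z" if z: "z \<in> V" for z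
  proof -
    have zt: "z \<in> topspace N" and gz: "g z \<in> U" using z by (auto simp: V_def)
    have f1: "f \<in> topspace M - U \<rightarrow> topspace N - V"
      using fM gf by (auto simp: V_def)
    have f2: "f \<in> topspace M - {g z} \<rightarrow> topspace N - {z}"
      using fM gf by auto
    have "restrict_class n N V {z} d = hom_induced (int n) M (topspace M - U) N (topspace N - {z}) f c"
      unfolding d_def restrict_class_def
      using hom_induced_compose'[OF cf f1, of N id "topspace N - {z}" "int n" c] z
      by (simp add: Diff_mono id_in_funcset)
    also have "\<dots> = hom_induced (int n) M (topspace M - {g z}) N (topspace N - {z}) f
         (restrict_class n M U {g z} c)"
      unfolding restrict_class_def
      using hom_induced_compose'[OF continuous_map_id id_in_funcset cf f2, of "topspace M - U" "int n" c] gz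
      by (simp add: Diff_mono)
    finally show ?thesis using U(4) gz by simp
  qed
  ultimately show "\<exists>U. openin N U \<and> y \<in> U \<and> (\<exists>c\<in>carrier (local_homology_group n N U).
      \<forall>z\<in>U. restrict_class n N U {z} c = ?o2 z)"
    using V by blast
qed

section \<open>Fundamental classes along an arc\<close>

text \<open>Complements of adjacent pieces, in the form consumed by Mayer-Vietoris. \<open>K\<close>
  will be a closed subset of the arc or, for the arc itself, \<open>UNIV\<close>. Injectivity keeps
  the two pieces from meeting outside their common end point.\<close>

lemma Diff_arc_subsets:
  fixes \<gamma> :: "real \<Rightarrow> 'a"
  assumes "inj_on \<gamma> {A..B}" "A \<le> a" "a \<le> b" "b \<le> c" "c \<le> B"
  shows "(X - K \<inter> \<gamma> ` {a..b}) \<inter> (X - K \<inter> \<gamma> ` {b..c}) = X - K \<inter> \<gamma> ` {a..c}"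
    and "(X - K \<inter> \<gamma> ` {a..b}) \<union> (X - K \<inter> \<gamma> ` {b..c}) = X - K \<inter> {\<gamma> b}"
proof -
  have "{a..b} \<union> {b..c} = {a..c}" using assms by auto
  then have "\<gamma> ` {a..c} = \<gamma> ` {a..b} \<union> \<gamma> ` {b..c}" by (metis image_Un)
  then show "(X - K \<inter> \<gamma> ` {a..b}) \<inter> (X - K \<inter> \<gamma> ` {b..c}) = X - K \<inter> \<gamma> ` {a..c}" by auto
  have "\<gamma> ` {a..b} \<inter> \<gamma> ` {b..c} = \<gamma> ` ({a..b} \<inter> {b..c})"
    using assms by (intro inj_on_image_Int[OF assms(1), symmetric]) auto
  also have "{a..b} \<inter> {b..c} = {b}" using assms by auto
  finally show "(X - K \<inter> \<gamma> ` {a..b}) \<union> (X - K \<inter> \<gamma> ` {b..c}) = X - K \<inter> {\<gamma> b}" by auto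
qed

text \<open>The conclusion has the shape of the local hypothesis of \<open>Bolzano\<close>: all
  short intervals around \<open>t\<close>.\<close>

lemma continuous_curve_near:
  assumes "continuous_map euclideanreal X \<gamma>" "openin X N" "\<gamma> t \<in> N"
  obtains d where "d > 0" "\<And>a b. \<lbrakk>a \<le> t; t \<le> b; b - a < d\<rbrakk> \<Longrightarrow> \<gamma> ` {a..b} \<subseteq> N"
proof -
  have "open {u. \<gamma> u \<in> N}"
    using openin_continuous_map_preimage[OF assms(1,2)] by simp
  then obtain d where d: "d > 0" "\<forall>u. dist u t < d \<longrightarrow> \<gamma> u \<in> N"
    using assms(3) unfolding open_dist by blast
  show thesis
  proof
    show "d > 0" by fact
    show "\<gamma> ` {a..b} \<subseteq> N" if "a \<le> t" "t \<le> b" "b - a < d" for a b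
      using d(2) that by (auto simp: dist_real_def)
  qed
qed

text \<open>Both lemmas propagate along the arc by Mayer--Vietoris: adjacent pieces meet in one point.\<close>
lemma class_on_arc_eq_one:
  assumes H: "Hausdorff_space X"
    and \<gamma>: "continuous_map euclideanreal X \<gamma>" and inj: "inj_on \<gamma> {A..B}" and "A \<le> B"
    and triv: "\<And>x. x \<in> topspace X \<Longrightarrow> trivial_group (local_homology_group (Suc n) X {x})"
    and K: "closedin X K" "K \<subseteq> \<gamma> ` {A..B}"
    and z: "z \<in> carrier (local_homology_group n X K)"
    and z1: "\<And>x. x \<in> K \<Longrightarrow> restrict_class n X K {x} z = \<one>\<^bsub>local_homology_group n X {x}\<^esub>"
  shows "z = \<one>\<^bsub>local_homology_group n X K\<^esub>"
proof -
  let ?K = "\<lambda>a b. K \<inter> \<gamma> ` {a..b}"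
  have KX: "K \<subseteq> topspace X" using K(1) closedin_subset by blast
  have cl: "closedin X (?K a b)" for a b
  proof -
    have "compactin X (\<gamma> ` {a..b})"
      using image_compactin[OF _ \<gamma>, of "{a..b}"] by simp
    then show ?thesis using K(1) H by (simp add: closedin_Int compactin_imp_closedin)
  qed
  \<comment> \<open>The bounds guard the induction: \<open>Bolzano\<close> ranges over all
    intervals, while the curve is injective only on \<open>{A..B}\<close>.\<close>
  define P where "P a b \<longleftrightarrow> (A \<le> a \<longrightarrow> b \<le> B \<longrightarrow>
    restrict_class n X K (?K a b) z = \<one>\<^bsub>local_homology_group n X (?K a b)\<^esub>)" for a b
  from \<open>A \<le> B\<close> have "P A B"
  proof (induction rule: Bolzano[where P=P])
    case (trans a b c)
    show ?case
      unfolding P_def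
    proof (intro impI)
      assume ac: "A \<le> a" "c \<le> B"
      note D = Diff_arc_subsets[OF inj ac(1) trans(3,4) ac(2), of "topspace X" K]
      let ?P = "topspace X - ?K a b" and ?Q = "topspace X - ?K b c"
      have "restr n X (?P \<inter> ?Q) ?P (restrict_class n X K (?K a c) z)
          = restrict_class n X K (?K a b) z"
        unfolding restrict_class_def D(1) using trans(3,4) by (intro restr_restr) auto
      moreover have "restr n X (?P \<inter> ?Q) ?Q (restrict_class n X K (?K a c) z)
          = restrict_class n X K (?K b c) z"
        unfolding restrict_class_def D(1) using trans(3,4) by (intro restr_restr) auto
      moreover have "trivial_group (relative_homology_group (int n + 1) X (?P \<union> ?Q))"
      \<comment> \<open>The two pieces meet in \<open>K \<inter> {\<gamma> b}\<close>. This is a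
        single point, where \<open>triv\<close> applies, or empty, and then the group is that of the
        pair (X, X).\<close>
      proof (cases "\<gamma> b \<in> K")
        case True
        then show ?thesis using triv[of "\<gamma> b"] KX D(2) by (auto simp: add.commute)
      next
        case False
        then show ?thesis using D(2) by (simp add: trivial_relative_homology_group_topspace)
      qed
      moreover have "restrict_class n X K (?K a c) z \<in> carrier (relative_homology_group n X (?P \<inter> ?Q))"
        unfolding D(1) by (rule restrict_class_carrier)
      ultimately have "restrict_class n X K (?K a c) z = \<one>\<^bsub>relative_homology_group n X (?P \<inter> ?Q)\<^esub>"
        using trans(1,2)[unfolded P_def] ac trans(3,4) openin_diff[OF openin_topspace cl]
        by (intro mayer_vietoris_injective[where A="?P" and B="?Q"]) auto
      then show "restrict_class n X K (?K a c) z = \<one>\<^bsub>local_homology_group n X (?K a c)\<^esub>"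
        unfolding D(1) .
    qed
  next
    case (local t)
    show ?case
    proof (cases "\<gamma> t \<in> K")
      case True
      then obtain N where N: "openin X N" "\<gamma> t \<in> N"
        "\<And>T. \<lbrakk>topspace X - K \<subseteq> T; topspace X - N \<subseteq> T\<rbrakk> \<Longrightarrow>
         restr (int n) X (topspace X - K) T z = \<one>\<^bsub>relative_homology_group (int n) X T\<^esub>"
        using restr_eq_one_near_point[OF H _ z, of "\<gamma> t"] z1[OF True] KX
        unfolding restrict_class_def by blast
      obtain d where d: "d > 0" "\<And>a b. \<lbrakk>a \<le> t; t \<le> b; b - a < d\<rbrakk> \<Longrightarrow> \<gamma> ` {a..b} \<subseteq> N"
        using continuous_curve_near[OF \<gamma> N(1,2)] by metis
      have "restrict_class n X K (?K a b) z = \<one>\<^bsub>local_homology_group n X (?K a b)\<^esub>"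
        if "a \<le> t \<and> t \<le> b \<and> b - a < d" for a b
      proof -
        have "\<gamma> ` {a..b} \<subseteq> N" using d(2) that by blast
        then show ?thesis unfolding restrict_class_def by (intro N(3)) auto
      qed
      then show ?thesis using d(1) unfolding P_def by blast
    next
      case False
      have "\<gamma> t \<in> topspace X - K" using \<gamma> False by (auto simp: continuous_map_def)
      then obtain d where d: "d > 0" "\<And>a b. \<lbrakk>a \<le> t; t \<le> b; b - a < d\<rbrakk> \<Longrightarrow> \<gamma> ` {a..b} \<subseteq> topspace X - K"
        using continuous_curve_near[OF \<gamma> openin_diff[OF openin_topspace K(1)]] by metis
      have "restrict_class n X K (?K a b) z = \<one>\<^bsub>local_homology_group n X (?K a b)\<^esub>"
        if "a \<le> t \<and> t \<le> b \<and> b - a < d" for a b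
      proof -
        have "?K a b = {}" using d(2)[of a b] that by auto
        then show ?thesis
          using trivial_relative_homology_group_topspace[of n X] restrict_class_carrier[of n X K "?K a b" z]
          by (simp add: trivial_group_def)
      qed
      then show ?thesis using d(1) unfolding P_def by blast
    qed
  qed
  moreover have "?K A B = K" using K(2) by auto
  ultimately show ?thesis using restrict_class_id[OF z] by (simp add: P_def)
qed

lemma fundamental_class_on_arc_exists:
  assumes H: "Hausdorff_space X" and ori: "orientation n X ori"
    and \<gamma>: "continuous_map euclideanreal X \<gamma>" and inj: "inj_on \<gamma> {A..B}" and "A \<le> B"
  obtains c where "fundamental_class n X ori (\<gamma> ` {A..B}) c"
proof -
  have \<gamma>X: "\<gamma> t \<in> topspace X" for t using \<gamma> by (auto simp: continuous_map_def)
  have cl: "closedin X (\<gamma> ` {a..b})" for a b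
  proof -
    have "compactin X (\<gamma> ` {a..b})"
      using image_compactin[OF _ \<gamma>, of "{a..b}"] by simp
    then show ?thesis using H by (simp add: compactin_imp_closedin)
  qed
  define P where "P a b \<longleftrightarrow> (A \<le> a \<longrightarrow> b \<le> B \<longrightarrow>
    (\<exists>c. fundamental_class n X ori (\<gamma> ` {a..b}) c))" for a b
  from \<open>A \<le> B\<close> have "P A B"
  proof (induction rule: Bolzano[where P=P])
    case (trans a b c)
    show ?case
      unfolding P_def
    proof (intro impI)
      assume ac: "A \<le> a" "c \<le> B"
      note D = Diff_arc_subsets[OF inj ac(1) trans(3,4) ac(2), of "topspace X" UNIV, simplified]
      obtain c1 where c1: "fundamental_class n X ori (\<gamma> ` {a..b}) c1"
        using trans[unfolded P_def] ac by force
      obtain c2 where c2: "fundamental_class n X ori (\<gamma> ` {b..c}) c2"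
        using trans[unfolded P_def] ac by force
      let ?P = "topspace X - \<gamma> ` {a..b}" and ?Q = "topspace X - \<gamma> ` {b..c}"
      \<comment> \<open>Both sides are the orientation class at the common end point
        \<open>\<gamma> b\<close>.\<close>
      have "restr n X ?P (?P \<union> ?Q) c1 = restr n X ?Q (?P \<union> ?Q) c2"
        using c1 c2 trans(3,4) unfolding D(2) fundamental_class_def restrict_class_def by auto
      then obtain e where e: "e \<in> carrier (relative_homology_group n X (?P \<inter> ?Q))"
        "restr n X (?P \<inter> ?Q) ?P e = c1" "restr n X (?P \<inter> ?Q) ?Q e = c2"
        using mayer_vietoris_surjective[of X ?P ?Q c1 "int n" c2] c1 c2 cl openin_diff[OF openin_topspace]
        unfolding fundamental_class_def by blast
      have "restrict_class n X (\<gamma> ` {a..c}) {\<gamma> t} e = ori (\<gamma> t)" if t: "t \<in> {a..c}" for t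
      proof (cases "t \<le> b")
        case True
        then have "restrict_class n X (\<gamma> ` {a..b}) {\<gamma> t} c1 = ori (\<gamma> t)"
          using c1 t unfolding fundamental_class_def by auto
        moreover have "c1 = restrict_class n X (\<gamma> ` {a..c}) (\<gamma> ` {a..b}) e"
          using e(2) unfolding restrict_class_def D(1) by simp
        ultimately show ?thesis using True t trans(3,4) by (simp add: restrict_class_trans image_mono)
      next
        case False
        then have "restrict_class n X (\<gamma> ` {b..c}) {\<gamma> t} c2 = ori (\<gamma> t)"
          using c2 t unfolding fundamental_class_def by auto
        moreover have "c2 = restrict_class n X (\<gamma> ` {a..c}) (\<gamma> ` {b..c}) e"
          using e(3) unfolding restrict_class_def D(1) by simp
        ultimately show ?thesis using False t trans(3,4) by (simp add: restrict_class_trans image_mono)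
      qed
      then have "fundamental_class n X ori (\<gamma> ` {a..c}) e"
        using e(1) unfolding fundamental_class_def D(1) by auto
      then show "\<exists>c'. fundamental_class n X ori (\<gamma> ` {a..c}) c'" ..
    qed
  next
    case (local t)
    obtain U c where U: "openin X U" "\<gamma> t \<in> U" "c \<in> carrier (local_homology_group n X U)"
      "\<forall>y\<in>U. restrict_class n X U {y} c = ori y"
      using ori \<gamma>X unfolding orientation_def by meson
    obtain d where d: "d > 0" "\<And>a b. \<lbrakk>a \<le> t; t \<le> b; b - a < d\<rbrakk> \<Longrightarrow> \<gamma> ` {a..b} \<subseteq> U"
      using continuous_curve_near[OF \<gamma> U(1,2)] by metis
    have "fundamental_class n X ori (\<gamma> ` {a..b}) (restrict_class n X U (\<gamma> ` {a..b}) c)"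
      if "a \<le> t \<and> t \<le> b \<and> b - a < d" for a b
      unfolding fundamental_class_def
    proof (intro conjI ballI restrict_class_carrier)
      fix x assume x: "x \<in> \<gamma> ` {a..b}"
      then show "restrict_class n X (\<gamma> ` {a..b}) {x} (restrict_class n X U (\<gamma> ` {a..b}) c) = ori x"
        using restrict_class_trans[of "\<gamma> ` {a..b}" U "{x}" n X c] d(2)[of a b] that U(4) by auto
    qed
    then show ?case using d(1) unfolding P_def by blast
  qed
  then show thesis using that by (auto simp: P_def)
qed

section \<open>Degree of a map that splits off a scaling\<close>

lemma topspace_quadrant [simp]: "topspace quadrant = {0<..} \<times> {0<..}"
  by (simp add: quadrant_def)

lemma Hausdorff_quadrant: "Hausdorff_space quadrant"
  by (simp add: quadrant_def Hausdorff_space_subtopology)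

lemma connected_quadrant: "connected_space quadrant"
  by (simp add: quadrant_def connected_space_subtopology connected_Times)

lemma continuous_map_quadrant:
  "continuous_map quadrant quadrant f \<longleftrightarrow>
     continuous_on ({0<..} \<times> {0<..}) f \<and> f \<in> {0<..} \<times> {0<..} \<rightarrow> {0<..} \<times> {0<..}"
  by (auto simp: quadrant_def continuous_map_in_subtopology Pi_iff image_subset_iff)

locale split_map =
  fixes \<phi> \<psi> :: "real \<Rightarrow> real" and F :: "real \<times> real \<Rightarrow> real \<times> real"
  assumes cont_\<phi>: "continuous_on {0<..} \<phi>" and cont_\<psi>: "continuous_on {0<..} \<psi>"
    and pos_\<phi>: "\<And>s. s > 0 \<Longrightarrow> \<phi> s > 0" and pos_\<psi>: "\<And>s. s > 0 \<Longrightarrow> \<psi> s > 0"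
    and \<psi>_0: "filterlim \<psi> at_top (at_right 0)" and \<psi>_top: "(\<psi> \<longlongrightarrow> 0) at_top"
    and F: "\<And>a s. \<lbrakk>a > 0; s > 0\<rbrakk> \<Longrightarrow> F (a, s) = (a * \<phi> s, \<psi> s)"
begin

lemma \<phi>_nonzero: "s > 0 \<Longrightarrow> \<phi> s \<noteq> 0"
  using pos_\<phi>[of s] by simp

definition \<rho> :: "real \<times> real \<Rightarrow> real \<times> real" where
  "\<rho> p = (fst p * \<phi> (snd p), 1 / snd p)"

definition \<rho>' :: "real \<times> real \<Rightarrow> real \<times> real" where
  "\<rho>' p = (fst p / \<phi> (1 / snd p), 1 / snd p)"

lemma continuous_\<phi>_comp [continuous_intros]:
  "continuous_on S f \<Longrightarrow> (\<And>x. x \<in> S \<Longrightarrow> f x > 0) \<Longrightarrow> continuous_on S (\<lambda>x. \<phi> (f x))"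
  by (rule continuous_on_compose2[OF cont_\<phi>]) auto

lemma continuous_\<psi>_comp [continuous_intros]:
  "continuous_on S f \<Longrightarrow> (\<And>x. x \<in> S \<Longrightarrow> f x > 0) \<Longrightarrow> continuous_on S (\<lambda>x. \<psi> (f x))"
  by (rule continuous_on_compose2[OF cont_\<psi>]) auto

lemma \<rho>_homeomorphic: "homeomorphic_maps quadrant quadrant \<rho> \<rho>'"
proof -
  have "continuous_on ({0<..} \<times> {0<..}) \<rho>" unfolding \<rho>_def
    by (intro continuous_intros) auto
  moreover have "continuous_on ({0<..} \<times> {0<..}) \<rho>'" unfolding \<rho>'_def
    by (intro continuous_intros) (auto simp: \<phi>_nonzero)
  moreover have "\<rho> \<in> {0<..} \<times> {0<..} \<rightarrow> {0<..} \<times> {0<..}" "\<rho>' \<in> {0<..} \<times> {0<..} \<rightarrow> {0<..} \<times> {0<..}"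
    by (auto simp: \<rho>_def \<rho>'_def intro!: mult_pos_pos divide_pos_pos pos_\<phi>)
  moreover have "\<rho>' (\<rho> p) = p" "\<rho> (\<rho>' p) = p" if "p \<in> {0<..} \<times> {0<..}" for p
    using that \<phi>_nonzero[of "snd p"] \<phi>_nonzero[of "1 / snd p"]
    by (auto simp: \<rho>_def \<rho>'_def mem_Times_iff intro!: prod_eqI)
  ultimately show ?thesis
    unfolding homeomorphic_maps_def continuous_map_quadrant by simp
qed

text \<open>The first component does not move during the homotopy, so a point sent to
  \<open>y\<close> at any time has the form (fst y / \<phi> s, s). Outside \<open>{s1..s2}\<close>
  both \<psi> s and 1 / s lie on the same side of \<open>snd y\<close>, and so do their convex
  combinations. Hence \<open>y\<close> is attained only on the compact arc \<open>L\<close>.\<close>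

lemma F_homotopic_\<rho>:
  assumes y: "y \<in> topspace quadrant"
    and low: "\<And>s. \<lbrakk>0 < s; s < s1\<rbrakk> \<Longrightarrow> \<psi> s > snd y \<and> 1 / s > snd y"
    and high: "\<And>s. s > s2 \<Longrightarrow> \<psi> s < snd y \<and> 1 / s < snd y"
    and L: "L = (\<lambda>s. (fst y / \<phi> s, s)) ` {s1..s2}"
  shows "homotopic_with (\<lambda>h. h \<in> topspace quadrant - L \<rightarrow> topspace quadrant - {y}) quadrant quadrant F \<rho>"
proof -
  define h where "h = (\<lambda>(t, p). (fst p * \<phi> (snd p), (1 - t) * \<psi> (snd p) + t / snd p))"
  have h0: "h (0, p) = F p" if "p \<in> topspace quadrant" for p
    using that F[of "fst p" "snd p"] by (auto simp: h_def)
  have h1: "h (1, p) = \<rho> p" if "p \<in> topspace quadrant" for p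
    by (auto simp: h_def \<rho>_def)
  have pos: "(1 - t) * \<psi> s + t / s > 0" if "t \<in> {0..1}" "s > 0" for t s
  proof (cases "t = 0")
    case False
    then have "t / s > 0" "(1 - t) * \<psi> s \<ge> 0"
      using that pos_\<psi>[OF that(2)] by auto
    then show ?thesis by linarith
  qed (use pos_\<psi> that in auto)
  have "h \<in> {0..1} \<times> ({0<..} \<times> {0<..}) \<rightarrow> {0<..} \<times> {0<..}"
    using pos pos_\<phi> by (auto simp: h_def)
  moreover have "continuous_on ({0..1} \<times> ({0<..} \<times> {0<..})) h"
    unfolding h_def split_def by (intro continuous_intros) auto
  ultimately have cont: "continuous_map (prod_topology (top_of_set {0..1}) quadrant) quadrant h"
    by (auto simp: quadrant_def prod_topology_subtopology_eu continuous_map_in_subtopology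
      simp flip: euclidean_product_topology)
  have "h (t, p) \<noteq> y" if t: "t \<in> {0..1}" and p: "p \<in> topspace quadrant - L" for t p
  proof
    assume "h (t, p) = y"
    obtain a s where as: "p = (a, s)" "a > 0" "s > 0" using p by auto
    have y1: "a * \<phi> s = fst y" and y2: "(1 - t) * \<psi> s + t / s = snd y"
      using \<open>h (t, p) = y\<close> as by (auto simp: h_def)
    have "a = fst y / \<phi> s" using y1 pos_\<phi>[OF as(3)] by (auto simp: field_simps)
    then have "s \<notin> {s1..s2}" using p L as by auto
    then consider "s < s1" | "s > s2" by force
    then show False
    proof cases
      case 1
      have "convex {snd y<..}" by simp
      then have "(1 - t) *\<^sub>R \<psi> s + t *\<^sub>R (1 / s) \<in> {snd y<..}"
        using low[OF as(3) 1] t by (intro convexD) auto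
      then show False using y2 by simp
    next
      case 2
      have "convex {..<snd y}" by simp
      then have "(1 - t) *\<^sub>R \<psi> s + t *\<^sub>R (1 / s) \<in> {..<snd y}"
        using high[OF 2] t by (intro convexD) auto
      then show False using y2 by simp
    qed
  qed
  moreover have "h (t, p) \<in> topspace quadrant" if "t \<in> {0..1}" "p \<in> topspace quadrant" for t p
    using that pos pos_\<phi> by (auto simp: h_def)
  ultimately have maps: "(\<lambda>p. h (t, p)) \<in> topspace quadrant - L \<rightarrow> topspace quadrant - {y}"
    if "t \<in> {0..1}" for t
    using that by auto
  have "homotopic_with (\<lambda>h. h \<in> topspace quadrant - L \<rightarrow> topspace quadrant - {y}) quadrant quadrant
     (\<lambda>p. h (0, p)) (\<lambda>p. h (1, p))"
    unfolding homotopic_with_def using cont maps by (intro exI[of _ h]) auto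
  then show ?thesis
  proof (rule homotopic_with_eq)
    show "\<And>p. p \<in> topspace quadrant \<Longrightarrow> F p = h (0, p)" using h0 by simp
    show "\<And>p. p \<in> topspace quadrant \<Longrightarrow> \<rho> p = h (1, p)" using h1 by simp
  qed (auto simp: Pi_iff)
qed

text \<open>\<open>1 / c\<close> is kept inside the interval so that the preimage of
  \<open>y\<close> under \<rho> lies on the same arc as the fibre of \<open>F\<close>.\<close>

lemma crossing_interval:
  assumes "c > 0"
  obtains s1 s2 where "0 < s1" "s1 \<le> 1 / c" "1 / c \<le> s2"
    "\<And>s. \<lbrakk>0 < s; s < s1\<rbrakk> \<Longrightarrow> \<psi> s > c \<and> 1 / s > c"
    "\<And>s. s > s2 \<Longrightarrow> \<psi> s < c \<and> 1 / s < c"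
proof -
  have "\<forall>\<^sub>F s in at_right 0. \<psi> s > c" using \<psi>_0 by (simp add: filterlim_at_top_dense)
  then obtain b1 where b1: "b1 > 0" "\<And>s. \<lbrakk>0 < s; s < b1\<rbrakk> \<Longrightarrow> \<psi> s > c"
    unfolding eventually_at_right_field by auto
  have "\<forall>\<^sub>F s in at_top. \<psi> s < c" using \<psi>_top assms by (rule order_tendstoD)
  then obtain b2 where b2: "\<And>s. s \<ge> b2 \<Longrightarrow> \<psi> s < c"
    unfolding eventually_at_top_linorder by auto
  show thesis
  proof
    show "0 < min b1 (1 / c)" using b1 assms by simp
    show "\<psi> s > c \<and> 1 / s > c" if "0 < s" "s < min b1 (1 / c)" for s
      using that b1(2)[of s] assms by (auto simp: field_simps)
    show "\<psi> s < c \<and> 1 / s < c" if "s > max b2 (1 / c)" for s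
    proof -
      have "s > 1 / c" "1 / c > 0" using that assms by auto
      then have "s > 0" by linarith
      then show ?thesis using that b2[of s] assms by (auto simp: field_simps)
    qed
  qed auto
qed

lemma degree_setup:
  assumes y: "y \<in> topspace quadrant"
  obtains \<gamma> s1 s2 where "continuous_map euclideanreal quadrant \<gamma>" "inj_on \<gamma> {s1..s2}" "s1 \<le> s2"
    "closedin quadrant {x \<in> topspace quadrant. F x = y}"
    "{x \<in> topspace quadrant. F x = y} \<subseteq> \<gamma> ` {s1..s2}" "\<rho>' y \<in> \<gamma> ` {s1..s2}"
    "homotopic_with (\<lambda>h. h \<in> topspace quadrant - \<gamma> ` {s1..s2} \<rightarrow> topspace quadrant - {y}) quadrant quadrant F \<rho>"
proof -
  have y0: "fst y > 0" "snd y > 0" using y by auto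
  obtain s1 s2 where s: "0 < s1" "s1 \<le> 1 / snd y" "1 / snd y \<le> s2"
    and low: "\<And>s. \<lbrakk>0 < s; s < s1\<rbrakk> \<Longrightarrow> \<psi> s > snd y \<and> 1 / s > snd y"
    and high: "\<And>s. s > s2 \<Longrightarrow> \<psi> s < snd y \<and> 1 / s < snd y"
    using crossing_interval[OF y0(2)] by metis
  \<comment> \<open>The graph of fst y / \<phi> over \<open>{s1..s2}\<close>, with the parameter
    frozen below \<open>s1\<close>: the arc lemmas ask for a curve on the whole line, while \<phi>
    is controlled only for positive arguments.\<close>
  define \<gamma> where "\<gamma> t = (fst y / \<phi> (max s1 t), max s1 t)" for t
  have m: "max s1 t > 0" for t using s(1) by (simp add: less_max_iff_disj)
  have \<gamma>im: "\<gamma> ` {s1..s2} = (\<lambda>s. (fst y / \<phi> s, s)) ` {s1..s2}"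
    by (intro image_cong) (auto simp: \<gamma>_def max_def)
  have F': "F x = (fst x * \<phi> (snd x), \<psi> (snd x))" if "x \<in> topspace quadrant" for x
    using that F[of "fst x" "snd x"] by (simp add: mem_Times_iff)
  have contF: "continuous_map quadrant quadrant F"
  proof (rule continuous_map_eq)
    show "continuous_map quadrant quadrant (\<lambda>x. (fst x * \<phi> (snd x), \<psi> (snd x)))"
      unfolding continuous_map_quadrant
    proof
      show "continuous_on ({0<..} \<times> {0<..}) (\<lambda>x. (fst x * \<phi> (snd x), \<psi> (snd x)))"
        by (intro continuous_intros) auto
      show "(\<lambda>x. (fst x * \<phi> (snd x), \<psi> (snd x))) \<in> {0<..} \<times> {0<..} \<rightarrow> {0<..} \<times> {0<..}"
        by (auto intro!: mult_pos_pos pos_\<phi> pos_\<psi>)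
    qed
  qed (simp add: F')
  show thesis
  proof
    have "continuous_on UNIV \<gamma>"
      unfolding \<gamma>_def using m \<phi>_nonzero[OF m] by (intro continuous_intros) auto
    moreover have "range \<gamma> \<subseteq> {0<..} \<times> {0<..}"
      using m pos_\<phi>[OF m] y0 by (auto simp: \<gamma>_def)
    ultimately show "continuous_map euclideanreal quadrant \<gamma>"
      by (auto simp: quadrant_def continuous_map_in_subtopology)
    show "inj_on \<gamma> {s1..s2}" by (auto simp: inj_on_def \<gamma>_def max_def)
    show "s1 \<le> s2" using s by linarith
    have "closedin quadrant {y}"
      using y by (intro closedin_Hausdorff_singleton Hausdorff_quadrant)
    from closedin_continuous_map_preimage[OF contF this]
    show "closedin quadrant {x \<in> topspace quadrant. F x = y}" by simp
    show "{x \<in> topspace quadrant. F x = y} \<subseteq> \<gamma> ` {s1..s2}"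
    proof
      fix x assume "x \<in> {x \<in> topspace quadrant. F x = y}"
      then obtain a u where x: "x = (a, u)" "a > 0" "u > 0" "F (a, u) = y" by auto
      have *: "a * \<phi> u = fst y" "\<psi> u = snd y" using F[OF x(2,3)] x(4) by auto
      have "u \<in> {s1..s2}" using low[OF x(3)] high[of u] *(2) by force
      moreover have "a = fst y / \<phi> u" using *(1) pos_\<phi>[OF x(3)] by (auto simp: field_simps)
      ultimately show "x \<in> \<gamma> ` {s1..s2}" unfolding \<gamma>im x(1) by auto
    qed
    show "\<rho>' y \<in> \<gamma> ` {s1..s2}" unfolding \<gamma>im \<rho>'_def using s by auto
    show "homotopic_with (\<lambda>h. h \<in> topspace quadrant - \<gamma> ` {s1..s2} \<rightarrow> topspace quadrant - {y}) quadrant quadrant F \<rho>"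
      using F_homotopic_\<rho>[OF y low high \<gamma>im] .
  qed
qed

text \<open>Every fundamental class around the fibre is the restriction of one class
  \<open>e\<close> on the arc, since differences vanish by \<open>class_on_arc_eq_one\<close>. On
  the arc the homotopy applies, so the image of \<open>e\<close> may be computed with \<rho> in
  place of \<open>F\<close>; and \<rho> only sees the single point \<open>\<rho>' y\<close>.\<close>

lemma fundamental_class_image:
  assumes oM: "orientation 2 quadrant oM" and y: "y \<in> topspace quadrant"
  defines "K \<equiv> {x \<in> topspace quadrant. F x = y}"
  shows "\<exists>c. fundamental_class 2 quadrant oM K c"
    and "fundamental_class 2 quadrant oM K c \<Longrightarrow>
      hom_induced 2 quadrant (topspace quadrant - K) quadrant (topspace quadrant - {y}) F c =
      hom_induced 2 quadrant (topspace quadrant - {\<rho>' y}) quadrant (topspace quadrant - {y}) \<rho> (oM (\<rho>' y))"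
proof -
  note topspace_quadrant [simp del]
  obtain \<gamma> s1 s2 where \<gamma>: "continuous_map euclideanreal quadrant \<gamma>" "inj_on \<gamma> {s1..s2}" "s1 \<le> s2"
    and K: "closedin quadrant K" "K \<subseteq> \<gamma> ` {s1..s2}" and \<rho>y: "\<rho>' y \<in> \<gamma> ` {s1..s2}"
    and hom: "homotopic_with (\<lambda>h. h \<in> topspace quadrant - \<gamma> ` {s1..s2} \<rightarrow> topspace quadrant - {y}) quadrant quadrant F \<rho>"
    by (rule degree_setup[OF y, folded K_def]) (rule that)
  define L where "L = \<gamma> ` {s1..s2}"
  obtain e where e: "fundamental_class 2 quadrant oM L e"
    using fundamental_class_on_arc_exists[OF Hausdorff_quadrant oM \<gamma>] unfolding L_def by metis
  have KL: "K \<subseteq> L" using K(2) by (simp add: L_def)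
  let ?G = "local_homology_group 2 quadrant K"
  interpret G: group ?G by simp
  define c' where "c' = restrict_class 2 quadrant L K e"
  have c': "fundamental_class 2 quadrant oM K c'"
    unfolding fundamental_class_def
  proof (intro conjI ballI)
    show "c' \<in> carrier ?G" unfolding c'_def by (rule restrict_class_carrier)
    fix x assume "x \<in> K"
    then have "restrict_class 2 quadrant K {x} c' = restrict_class 2 quadrant L {x} e"
      unfolding c'_def using KL by (intro restrict_class_trans) auto
    then show "restrict_class 2 quadrant K {x} c' = oM x"
      using e \<open>x \<in> K\<close> KL by (auto simp: fundamental_class_def)
  qed
  then show "\<exists>c. fundamental_class 2 quadrant oM K c" ..
  assume c: "fundamental_class 2 quadrant oM K c"
  have KX: "x \<in> topspace quadrant" if "x \<in> K" for x using that by (simp add: K_def)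
  have "c = c'"
  proof -
    have cc: "c \<in> carrier ?G" "c' \<in> carrier ?G"
      using c c' by (auto simp: fundamental_class_def)
    let ?z = "c \<otimes>\<^bsub>?G\<^esub> inv\<^bsub>?G\<^esub> c'"
    have "?z = \<one>\<^bsub>?G\<^esub>"
    proof (rule class_on_arc_eq_one[OF Hausdorff_quadrant \<gamma> _ K])
      show "trivial_group (local_homology_group (Suc 2) quadrant {x})" if "x \<in> topspace quadrant" for x
        using local_homology_quadrant(2)[OF that] by simp
      show "?z \<in> carrier ?G" using cc by (intro G.m_closed G.inv_closed)
      fix x assume x: "x \<in> K"
      have "restrict_class 2 quadrant K {x} ?z = oM x \<otimes>\<^bsub>local_homology_group 2 quadrant {x}\<^esub>
        inv\<^bsub>local_homology_group 2 quadrant {x}\<^esub> oM x"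
        using restrict_class_diff[OF cc] c c' x unfolding fundamental_class_def by metis
      also have "\<dots> = \<one>\<^bsub>local_homology_group 2 quadrant {x}\<^esub>"
        using orientation_carrier[OF oM KX[OF x]] by (intro group.r_inv) auto
      finally show "restrict_class 2 quadrant K {x} ?z = \<one>\<^bsub>local_homology_group 2 quadrant {x}\<^esub>" .
    qed
    then show ?thesis using local_homology_diff_eq_one_iff[OF cc] by blast
  qed
  let ?X = "topspace quadrant"
  have contF: "continuous_map quadrant quadrant F" and cont\<rho>: "continuous_map quadrant quadrant \<rho>"
    using hom homotopic_with_imp_continuous_maps by blast+
  have \<rho>\<rho>: "\<rho> x = y \<Longrightarrow> x = \<rho>' y" "\<rho> x \<in> ?X" if "x \<in> ?X" for x
    using \<rho>_homeomorphic that unfolding homeomorphic_maps_def continuous_map_def by auto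
  have F1: "F \<in> ?X - K \<rightarrow> ?X - {y}"
    using contF unfolding K_def continuous_map_def by blast
  have \<rho>1: "\<rho> \<in> ?X - {\<rho>' y} \<rightarrow> ?X - {y}"
    using \<rho>\<rho> by blast
  have "hom_induced 2 quadrant (?X - K) quadrant (?X - {y}) F c
    = hom_induced 2 quadrant (?X - L) quadrant (?X - {y}) F e"
    unfolding \<open>c = c'\<close> c'_def restrict_class_def
    using hom_induced_compose'[OF continuous_map_id id_in_funcset contF F1, of "?X - L" 2 e] KL
    by (simp add: Diff_mono)
  also have "\<dots> = hom_induced 2 quadrant (?X - L) quadrant (?X - {y}) \<rho> e"
    using homology_homotopy_axiom[OF hom] unfolding L_def by metis
  also have "\<dots> = hom_induced 2 quadrant (?X - {\<rho>' y}) quadrant (?X - {y}) \<rho>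
      (restrict_class 2 quadrant L {\<rho>' y} e)"
    unfolding restrict_class_def
    using hom_induced_compose'[OF continuous_map_id id_in_funcset cont\<rho> \<rho>1, of "?X - L" 2 e] \<rho>y
    by (simp add: Diff_mono L_def)
  also have "restrict_class 2 quadrant L {\<rho>' y} e = oM (\<rho>' y)"
    using e \<rho>y by (auto simp: fundamental_class_def L_def)
  finally show "hom_induced 2 quadrant (?X - K) quadrant (?X - {y}) F c =
      hom_induced 2 quadrant (?X - {\<rho>' y}) quadrant (?X - {y}) \<rho> (oM (\<rho>' y))" .
qed

theorem abs_proper_degree:
  assumes oM: "orientation 2 quadrant oM" and oN: "orientation 2 quadrant oN"
  shows "\<bar>proper_degree 2 quadrant oM quadrant oN F\<bar> = 1"
proof -
  note topspace_quadrant [simp del]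
  let ?X = "topspace quadrant"
  let ?G = "\<lambda>y. local_homology_group 2 quadrant {y}"
  \<comment> \<open>By \<open>fundamental_class_image\<close>, \<open>oR y\<close> is the image of
    each fundamental class around the fibre over \<open>y\<close>. It varies with \<open>y\<close>
    as an orientation, so it is \<open>oN\<close> throughout or its inverse throughout.\<close>
  define oR where "oR y = hom_induced 2 quadrant (?X - {\<rho>' y}) quadrant (?X - {y}) \<rho> (oM (\<rho>' y))" for y
  have oR: "orientation 2 quadrant oR"
    using orientation_homeomorphic_image[OF \<rho>_homeomorphic oM] unfolding oR_def by simp
  have Z: "?G y \<cong> integer_group" if "y \<in> ?X" for y
    using local_homology_quadrant(1)[OF that] by simp
  have "\<exists>d::int. \<bar>d\<bar> = 1 \<and> (\<forall>y\<in>?X. oR y = oN y [^]\<^bsub>?G y\<^esub> d)"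
  proof (rule orientations_connected[OF Hausdorff_quadrant connected_quadrant Z oR oN])
    assume *: "\<And>x. x \<in> ?X \<Longrightarrow> oR x = oN x"
    show ?thesis
      using orientation_carrier[OF oN] * by (intro exI[of _ 1]) (auto simp: group.int_pow_1)
  next
    assume *: "\<And>x. x \<in> ?X \<Longrightarrow> oR x = inv\<^bsub>?G x\<^esub> oN x"
    have "oN y [^]\<^bsub>?G y\<^esub> (-1::int) = inv\<^bsub>?G y\<^esub> oN y" if "y \<in> ?X" for y
      using group.int_pow_neg[OF group_relative_homology_group orientation_carrier[OF oN that], of 1]
        group.int_pow_1[OF group_relative_homology_group orientation_carrier[OF oN that]] by simp
    then show ?thesis using * by (intro exI[of _ "-1"]) auto
  qed
  then obtain d :: int where d: "\<bar>d\<bar> = 1" "\<And>y. y \<in> ?X \<Longrightarrow> oR y = oN y [^]\<^bsub>?G y\<^esub> d"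
    by blast
  have "proper_degree 2 quadrant oM quadrant oN F = d"
    unfolding proper_degree_def
  proof (rule the_equality, intro ballI allI impI)
    fix y c assume "y \<in> ?X" "fundamental_class 2 quadrant oM {x \<in> ?X. F x = y} c"
    then show "hom_induced (int 2) quadrant (?X - {x \<in> ?X. F x = y}) quadrant (?X - {y}) F c
      = oN y [^]\<^bsub>?G y\<^esub> d"
      using fundamental_class_image(2)[OF oM] d(2) by (simp add: oR_def)
  next
    fix d' :: int assume d': "\<forall>y\<in>?X. \<forall>c. fundamental_class 2 quadrant oM {x \<in> ?X. F x = y} c \<longrightarrow>
       hom_induced (int 2) quadrant (?X - {x \<in> ?X. F x = y}) quadrant (?X - {y}) F c = oN y [^]\<^bsub>?G y\<^esub> d'"
    \<comment> \<open>Uniqueness of the exponent is read off at one fibre that carries a fundamental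
      class; without such a class the defining condition would be vacuous.\<close>
    have y: "(1, 1) \<in> ?X" by (simp add: topspace_quadrant)
    obtain c where c: "fundamental_class 2 quadrant oM {x \<in> ?X. F x = (1, 1)} c"
      using fundamental_class_image(1)[OF oM y] by blast
    have "oR (1, 1) = oN (1, 1) [^]\<^bsub>?G (1, 1)\<^esub> d'"
      unfolding oR_def fundamental_class_image(2)[OF oM y c, symmetric]
      using d'[rule_format, OF y c] by (simp only: of_nat_numeral)
    then have "oN (1, 1) [^]\<^bsub>?G (1, 1)\<^esub> d' = oN (1, 1) [^]\<^bsub>?G (1, 1)\<^esub> d"
      using d(2)[OF y] by (simp only:)
    then show "d' = d"
      by (rule iso_integer_group_generators(3)[OF Z[OF y] group_relative_homology_group orientation_carrier[OF oN y]
        orientation_generate[OF oN y] orientation_carrier[OF oN y] orientation_generate[OF oN y]])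
  qed
  then show ?thesis using d(1) by simp
qed

end

section \<open>The averaging operator\<close>

text \<open>For r > 0 this is r^(-m-1) times the integral of t^m g t over \<open>{0..r}\<close>: the
  solution of r y' + (m + 1) y = g that stays bounded at 0. Integrating over the fixed interval
  \<open>{0..1}\<close> covers r = 0 and permits differentiation under the integral.\<close>

definition J :: "nat \<Rightarrow> (real \<Rightarrow> real) \<Rightarrow> real \<Rightarrow> real" where
  "J m g r = integral {0..1} (\<lambda>t. t ^ m * g (r * t))"

lemma mult_unit_mem:
  fixes r t R :: real
  assumes "r \<in> {0..R}" "t \<in> {0..1}"
  shows "r * t \<in> {0..R}"
  using assms mult_left_le[of t r] by auto

lemma continuous_on_scaled:
  fixes g :: "real \<Rightarrow> real"
  assumes "continuous_on {0..R} g" "r \<in> {0..R}"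
  shows "continuous_on {0..1} (\<lambda>t. t ^ m * g (r * t))"
proof -
  have "continuous_on {0..1} (\<lambda>t. g (r * t))"
    using mult_unit_mem[OF assms(2)]
    by (intro continuous_on_compose2[OF assms(1)] continuous_intros) auto
  then show ?thesis by (intro continuous_intros)
qed

lemma J_integrable:
  fixes g :: "real \<Rightarrow> real"
  assumes "continuous_on {0..R} g" "r \<in> {0..R}"
  shows "(\<lambda>t. t ^ m * g (r * t)) integrable_on {0..1}"
  by (rule integrable_continuous_real[OF continuous_on_scaled[OF assms]])

lemma continuous_on_J:
  assumes "continuous_on {0..R} g"
  shows "continuous_on {0..R} (J m g)"
proof -
  have "continuous_on {0..R} (\<lambda>r. integral (cbox 0 1) (\<lambda>t. t ^ m * g (r * t)))"
  proof (rule integral_continuous_on_param)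
    show "continuous_on ({0..R} \<times> cbox 0 1) (\<lambda>(r, t). t ^ m * g (r * t))"
      unfolding split_def using mult_unit_mem
      by (intro continuous_intros continuous_on_compose2[OF assms]) auto
  qed
  then show ?thesis by (simp add: J_def[abs_def])
qed

lemma J_cong:
  assumes "\<And>t. t \<in> {0..r} \<Longrightarrow> f t = g t" "r \<ge> 0"
  shows "J m f r = J m g r"
  unfolding J_def using assms mult_unit_mem[of r r]
  by (intro integral_cong) auto

lemma J_0: "J m g 0 = g 0 / (m + 1)"
proof -
  have "((\<lambda>t. t ^ Suc m / (m + 1)) has_real_derivative t ^ m) (at t within {0..1})" for t :: real
    using DERIV_cdivide[OF DERIV_pow[of "Suc m" t "{0..1}"], of "real m + 1"]
    by (simp add: add.commute del: power_Suc)
  from fundamental_theorem_of_calculus[OF zero_le_one this[unfolded has_real_derivative_iff_has_vector_derivative]]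
  have "((\<lambda>t. t ^ m) has_integral 1 / (m + 1)) {0..1::real}" by simp
  from has_integral_mult_right[OF this, of "g 0"]
  show ?thesis unfolding J_def by (subst integral_unique[symmetric]) (auto simp: mult.commute add.commute)
qed

lemma J_diff:
  assumes "continuous_on {0..R} f" "continuous_on {0..R} g" "r \<in> {0..R}"
  shows "J m f r - J m g r = J m (\<lambda>t. f t - g t) r"
  unfolding J_def using J_integrable[OF assms(1,3)] J_integrable[OF assms(2,3)]
  by (simp add: Henstock_Kurzweil_Integration.integral_diff[symmetric] algebra_simps)

lemma J_nonneg:
  assumes "\<And>t. t \<in> {0..r} \<Longrightarrow> 0 \<le> g t" "r \<ge> 0" "continuous_on {0..r} g"
  shows "0 \<le> J m g r"
  unfolding J_def using assms(1,2) mult_unit_mem[of r r]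
  by (intro Henstock_Kurzweil_Integration.integral_nonneg J_integrable[OF assms(3)]) auto

lemma power_mult_J:
  assumes "continuous_on {0..R} g" "r \<in> {0..R}"
  shows "r ^ Suc m * J m g r = integral {0..r} (\<lambda>t. t ^ m * g t)"
proof -
  have "((\<lambda>t. r *\<^sub>R ((r * t) ^ m * g (r * t))) has_integral integral {r * 0..r * 1} (\<lambda>t. t ^ m * g t)) {0..1}"
  proof (rule has_integral_substitution)
    show "(\<lambda>t. r * t) ` {0..1} \<subseteq> {0..R}" using assms(2) mult_unit_mem by auto
    show "continuous_on {0..R} (\<lambda>t. t ^ m * g t)" using assms(1) by (intro continuous_intros)
  qed (use assms(2) in \<open>auto intro!: derivative_eq_intros\<close>)
  then have "integral {0..1} (\<lambda>t. r ^ Suc m * (t ^ m * g (r * t))) = integral {0..r} (\<lambda>t. t ^ m * g t)"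
    by (subst integral_unique[symmetric]) (auto simp: power_mult_distrib mult_ac)
  then show ?thesis by (simp add: J_def)
qed

lemma has_real_derivative_power_mult_J:
  assumes "continuous_on {0..R} g" "r \<in> {0..R}"
  shows "((\<lambda>r. r ^ Suc m * J m g r) has_real_derivative r ^ m * g r) (at r within {0..R})"
proof -
  have "((\<lambda>r. integral {0..r} (\<lambda>t. t ^ m * g t)) has_real_derivative r ^ m * g r) (at r within {0..R})"
    using assms by (intro integral_has_real_derivative continuous_intros)
  then show ?thesis
    by (rule has_field_derivative_transform_within[OF _ zero_less_one assms(2)])
      (use power_mult_J[OF assms(1)] in auto)
qed

lemma has_real_derivative_J:
  assumes "continuous_on {0..R} g" "r \<in> {0<..R}"
  shows "(J m g has_real_derivative (g r - (real m + 1) * J m g r) / r) (at r within {0..R})"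
proof -
  have r: "r \<in> {0..R}" "r > 0" using assms by auto
  have "((\<lambda>r. (r ^ Suc m * J m g r) / r ^ Suc m) has_real_derivative
      (r ^ m * g r * r ^ Suc m - (r ^ Suc m * J m g r) * (Suc m * r ^ m)) / (r ^ Suc m * r ^ Suc m)) (at r within {0..R})"
    using r DERIV_pow[of "Suc m" r "{0..R}"]
    by (intro DERIV_divide has_real_derivative_power_mult_J[OF assms(1) r(1)]) auto
  moreover have "(r ^ m * g r * r ^ Suc m - (r ^ Suc m * J m g r) * (Suc m * r ^ m)) / (r ^ Suc m * r ^ Suc m)
     = (g r - (real m + 1) * J m g r) / r"
    using r by (simp add: field_simps)
  ultimately have *: "((\<lambda>r. (r ^ Suc m * J m g r) / r ^ Suc m) has_real_derivative (g r - (real m + 1) * J m g r) / r) (at r within {0..R})"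
    by simp
  show ?thesis
    using * by (rule has_field_derivative_transform_within[where d = r])
      (use r in \<open>auto simp: dist_real_def\<close>)
qed

text \<open>Multiplied by r^(m+1), the difference of two solutions is constant, and continuity of
  \<open>Y\<close> at 0 makes this constant 0. Excluded is the homogeneous solution r^(-m-1), which
  is unbounded.\<close>

lemma J_unique:
  assumes g: "continuous_on {0..R} g" and Y: "continuous_on {0..R} Y"
    and D: "\<And>r. r \<in> {0<..<R} \<Longrightarrow> (Y has_real_derivative (g r - (real m + 1) * Y r) / r) (at r)"
    and r: "r \<in> {0..R}" and R: "R > 0"
  shows "Y r = J m g r"
proof -
  define Z where "Z r = r ^ Suc m * (Y r - J m g r)" for r
  have contZ: "continuous_on {0..R} Z"
    unfolding Z_def by (intro continuous_intros Y continuous_on_J g)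
  have Z': "(Z has_real_derivative 0) (at t)" if t: "t \<in> {0<..<R}" for t
  proof -
    have "(J m g has_real_derivative (g t - (real m + 1) * J m g t) / t) (at t within {0..R})"
      using has_real_derivative_J[OF g, of t m] t by (simp add: add.commute)
    then have "(J m g has_real_derivative (g t - (real m + 1) * J m g t) / t) (at t)"
      using t by (metis at_within_Icc_at greaterThanLessThan_iff)
    from DERIV_mult[OF DERIV_pow[of "Suc m" t UNIV] DERIV_diff[OF D[OF t] this]]
    show ?thesis
      unfolding Z_def using t by (simp add: field_simps)
  qed
  have Z0: "Z t = 0" if "t \<in> {0..R}" for t
  proof -
    have "Z t = Z 0"
      using DERIV_isconst2[OF R contZ, of t] Z' that by auto
    then show ?thesis by (simp add: Z_def)
  qed
  have eq: "Y t = J m g t" if "t \<in> {0<..R}" for t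
    using Z0[of t] that by (auto simp: Z_def)
  show ?thesis
  proof (cases "r = 0")
    case True
    have "((\<lambda>t. Y t - J m g t) \<longlongrightarrow> Y 0 - J m g 0) (at 0 within {0..R})"
      using continuous_on_diff[OF Y continuous_on_J[OF g, of m]] R unfolding continuous_on_def by auto
    moreover have "((\<lambda>t. Y t - J m g t) \<longlongrightarrow> 0) (at 0 within {0..R})"
      by (rule tendsto_eventually) (auto simp: eventually_at_filter eq)
    moreover have "at 0 within {0..R} \<noteq> bot"
      using R by (simp add: at_within_Icc_at_right)
    ultimately have "Y 0 - J m g 0 = 0"
      using tendsto_unique by blast
    with True show ?thesis by simp
  next
    case False
    then show ?thesis using eq r by auto
  qed
qed

lemma abs_J_le_exp:
  assumes g: "continuous_on {0..r} g" "\<And>t. t \<in> {0..r} \<Longrightarrow> \<bar>g t\<bar> \<le> A * exp (l * t)"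
    and "r \<ge> 0" "l \<ge> 0" "A \<ge> 0"
  shows "\<bar>J m g r\<bar> \<le> A * exp (l * r) / (m + 1)"
proof -
  have r: "r \<in> {0..r}" using assms by simp
  have "norm (J m g r) \<le> J m (\<lambda>_. A * exp (l * r)) r"
    unfolding J_def
  proof (rule integral_norm_bound_integral)
    show "(\<lambda>t. t ^ m * g (r * t)) integrable_on {0..1}" by (rule J_integrable[OF g(1) r])
    show "(\<lambda>t. t ^ m * (A * exp (l * r))) integrable_on {0..1}"
      by (intro integrable_continuous_real continuous_intros)
    fix t :: real assume t: "t \<in> {0..1}"
    have "\<bar>g (r * t)\<bar> \<le> A * exp (l * (r * t))" using g(2) mult_unit_mem[OF r t] by blast
    also have "\<dots> \<le> A * exp (l * r)"
      using assms mult_unit_mem[OF r t] by (auto intro!: mult_left_mono)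
    finally show "norm (t ^ m * g (r * t)) \<le> t ^ m * (A * exp (l * r))"
      using t by (simp add: abs_mult mult_left_mono)
  qed
  also have "J m (\<lambda>_. A * exp (l * r)) r = J m (\<lambda>_. A * exp (l * r)) 0" by (simp add: J_def)
  finally show ?thesis by (simp add: J_0)
qed

text \<open>The factor \<open>t\<close> in the bound is what gains 1 / l on integrating exp (l t);
  without it, \<open>abs_J_le_exp\<close> gains only 1 / (m + 1). Terms carrying a power of r thus
  become small for large \<open>l\<close>.\<close>

lemma abs_J_le_exp_linear:
  assumes g: "continuous_on {0..r} g" "\<And>t. t \<in> {0..r} \<Longrightarrow> \<bar>g t\<bar> \<le> A * t * exp (l * t)"
    and "r \<ge> 0" "l > 0" "A \<ge> 0"
  shows "\<bar>J m g r\<bar> \<le> A / l * exp (l * r)"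
proof (cases "r = 0")
  case True
  then have "g 0 = 0" using g(2)[of 0] by simp
  then show ?thesis using True assms by (simp add: J_0)
next
  case False
  have r: "r \<in> {0..r}" using assms by simp
  have D: "((\<lambda>t. A / l * exp (l * (r * t))) has_real_derivative A * r * exp (l * (r * t))) (at t within {0..1})" for t
    using assms by (auto intro!: derivative_eq_intros)
  have I: "((\<lambda>t. A * r * exp (l * (r * t))) has_integral A / l * exp (l * (r * 1)) - A / l * exp (l * (r * 0))) {0..1}"
    by (rule fundamental_theorem_of_calculus[OF zero_le_one D[unfolded has_real_derivative_iff_has_vector_derivative]])
  have "norm (J m g r) \<le> integral {0..1} (\<lambda>t. A * r * exp (l * (r * t)))"
    unfolding J_def
  proof (rule integral_norm_bound_integral)
    show "(\<lambda>t. t ^ m * g (r * t)) integrable_on {0..1}" by (rule J_integrable[OF g(1) r])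
    show "(\<lambda>t. A * r * exp (l * (r * t))) integrable_on {0..1}" using I by blast
    fix t :: real assume t: "t \<in> {0..1}"
    have "t ^ m * t \<le> 1" using t by (auto intro: mult_le_one power_le_one)
    then have "(t ^ m * t) * (A * r * exp (l * (r * t))) \<le> 1 * (A * r * exp (l * (r * t)))"
      using assms by (intro mult_right_mono) auto
    moreover have "t ^ m * \<bar>g (r * t)\<bar> \<le> t ^ m * (A * (r * t) * exp (l * (r * t)))"
      using g(2)[OF mult_unit_mem[OF r t]] t by (intro mult_left_mono) auto
    ultimately show "norm (t ^ m * g (r * t)) \<le> A * r * exp (l * (r * t))"
      using t by (simp add: abs_mult algebra_simps)
  qed
  also have "\<dots> \<le> A / l * exp (l * r)"
    using integral_unique[OF I] assms by simp
  finally show ?thesis by simp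
qed

section \<open>A fixed point theorem of Volterra type\<close>

text \<open>Banach's theorem in the norm sup |y t| exp (- l t), the usual device for Volterra
  equations: a large weight can make the map a contraction on an interval of any length.\<close>

lemma volterra_fixed_point:
  fixes T :: "(real \<Rightarrow> 'a::banach) \<Rightarrow> real \<Rightarrow> 'a"
  assumes R: "R \<ge> 0" and q: "0 \<le> q" "q < 1"
    and cont: "\<And>y. continuous_on {0..R} y \<Longrightarrow> continuous_on {0..R} (T y)"
    and contr: "\<And>y z A. \<lbrakk>continuous_on {0..R} y; continuous_on {0..R} z; A \<ge> 0;
        \<And>t. t \<in> {0..R} \<Longrightarrow> norm (y t - z t) \<le> A * exp (l * t)\<rbrakk> \<Longrightarrow>
        \<forall>t\<in>{0..R}. norm (T y t - T z t) \<le> q * A * exp (l * t)"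
  obtains y where "continuous_on {0..R} y" "\<And>t. t \<in> {0..R} \<Longrightarrow> y t = T y t"
proof -
  \<comment> \<open>Clamping to \<open>{0..R}\<close> turns functions on the interval into bounded
    continuous functions on the line; \<open>un\<close> undoes the weighting by exp (- l t).\<close>
  define c where "c t = max 0 (min R t)" for t
  have c: "c t \<in> {0..R}" "t \<in> {0..R} \<Longrightarrow> c t = t" for t using R by (auto simp: c_def)
  define un where "un f t = exp (l * t) *\<^sub>R apply_bcontfun f t" for f :: "real \<Rightarrow>\<^sub>C 'a" and t
  define P where "P f t = exp (- (l * c t)) *\<^sub>R T (un f) (c t)" for f :: "real \<Rightarrow>\<^sub>C 'a" and t
  have cun: "continuous_on S (un f)" for f S
    unfolding un_def by (intro continuous_intros continuous_on_apply_bcontfun)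
  have cc: "continuous_on UNIV c" unfolding c_def by (intro continuous_intros)
  have Pb: "P f \<in> bcontfun" for f
  proof -
    have "continuous_on {0..R} (\<lambda>t. exp (- (l * t)) *\<^sub>R T (un f) t)"
      by (intro continuous_intros cont cun)
    then have "continuous_on UNIV (P f)" "range (P f) \<subseteq> (\<lambda>t. exp (- (l * t)) *\<^sub>R T (un f) t) ` {0..R}"
      and "compact ((\<lambda>t. exp (- (l * t)) *\<^sub>R T (un f) t) ` {0..R})"
      unfolding P_def using continuous_on_compose2[OF _ cc, of "{0..R}" "\<lambda>t. exp (- (l * t)) *\<^sub>R T (un f) t"] c
      by (auto simp: image_subset_iff intro: compact_continuous_image)
    then show ?thesis
      unfolding bcontfun_def using bounded_subset compact_imp_bounded by blast
  qed
  define \<Phi> where "\<Phi> f = Bcontfun (P f)" for f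
  have \<Phi>: "apply_bcontfun (\<Phi> f) t = P f t" for f t
    unfolding \<Phi>_def using Pb by (simp add: Bcontfun_inverse)
  have "dist (\<Phi> f) (\<Phi> g) \<le> q * dist f g" for f g
  proof (rule dist_bound)
    fix t
    have *: "norm (un f u - un g u) \<le> dist f g * exp (l * u)" for u
      using dist_bounded[of f u g]
      by (simp add: un_def dist_norm flip: scaleR_diff_right)
    have "norm (T (un f) (c t) - T (un g) (c t)) \<le> q * dist f g * exp (l * c t)"
      using contr[OF cun cun, of "dist f g"] * c by auto
    then have "exp (- (l * c t)) * norm (T (un f) (c t) - T (un g) (c t)) \<le> exp (- (l * c t)) * (q * dist f g * exp (l * c t))"
      by (intro mult_left_mono) auto
    also have "\<dots> = q * dist f g" by (simp add: exp_minus field_simps)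
    finally show "dist (apply_bcontfun (\<Phi> f) t) (apply_bcontfun (\<Phi> g) t) \<le> q * dist f g"
      by (simp add: \<Phi> P_def dist_norm flip: scaleR_diff_right)
  qed
  then have "\<exists>!f. f \<in> UNIV \<and> \<Phi> f = f"
    by (intro Banach_fix[OF complete_UNIV _ q]) auto
  then obtain f where f: "\<Phi> f = f" by auto
  show thesis
  proof
    show "continuous_on {0..R} (un f)" by (rule cun)
    show "un f t = T (un f) t" if "t \<in> {0..R}" for t
    proof -
      have "apply_bcontfun f t = P f t" using f \<Phi> by metis
      then show ?thesis using c(2)[OF that] by (simp add: un_def P_def exp_minus)
    qed
  qed
qed

section \<open>The regularised soliton equations\<close>

text \<open>For a soliton with \<open>f''(0) = - s\<close>, put \<open>U = - f' / r\<close>, \<open>W = a' / (a r)\<close> and \<open>V = (b' / b - 1 / r) / r\<close>.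
  Then \<open>U\<close>, \<open>W\<close>, \<open>V\<close> solve \<open>r y' + 3 y = G\<close> with \<open>G\<close> = \<open>GU\<close>, \<open>GW\<close>, \<open>GV\<close>, where the term \<open>1 / b\<^sup>2\<close> has been
  eliminated by the conserved quantity. The bounded solution of such an equation is \<open>J 2 G\<close>.\<close>

definition GU :: "real \<Rightarrow> (real \<Rightarrow> real) \<Rightarrow> (real \<Rightarrow> real) \<Rightarrow> real \<Rightarrow> real" where
  "GU s U N r = 3 * s + 2 * (r\<^sup>2 * J 1 U r) - r\<^sup>2 * N r"
definition GW :: "(real \<Rightarrow> real) \<Rightarrow> real \<Rightarrow> real" where
  "GW N r = 1 - r\<^sup>2 * N r"
definition GV :: "real \<Rightarrow> (real \<Rightarrow> real) \<Rightarrow> (real \<Rightarrow> real) \<Rightarrow> (real \<Rightarrow> real) \<Rightarrow> real \<Rightarrow> real" where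
  "GV s U W N r = U r + W r - 3 * s / 2 - r\<^sup>2 * J 1 U r + r\<^sup>2 * N r"

text \<open>With u = r U, w = r W, v = 1 / r + r V and x = u + w + 2 v one has x u = 2 U + r^2 N1
  and x w = 2 W + r^2 N2. Likewise r^2 N3 collects the terms of the equation for V that are
  quadratic in U, W, V.\<close>

definition N1 :: "real \<Rightarrow> real \<Rightarrow> real \<Rightarrow> real" where "N1 u w v = (u + w + 2 * v) * u"
definition N2 :: "real \<Rightarrow> real \<Rightarrow> real \<Rightarrow> real" where "N2 u w v = (u + w + 2 * v) * w"
definition N3 :: "real \<Rightarrow> real \<Rightarrow> real \<Rightarrow> real" where "N3 u w v = u\<^sup>2 / 2 + u * w + v * (u + w) - v\<^sup>2"

text \<open>Truncation makes the quadratic terms globally Lipschitz, so that the fixed point theorem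
  applies on all of \<open>{0..R}\<close>; \<open>sol_exists_on\<close> removes it again.\<close>

definition clip :: "real \<Rightarrow> real \<Rightarrow> real" where "clip B x = max (- B) (min B x)"

lemma clip_bound: "B \<ge> 0 \<Longrightarrow> \<bar>clip B x\<bar> \<le> B"
  and clip_lipschitz: "\<bar>clip B x - clip B y\<bar> \<le> \<bar>x - y\<bar>"
  and clip_eq: "\<bar>x\<bar> \<le> B \<Longrightarrow> clip B x = x"
  by (auto simp: clip_def)

lemma continuous_on_clip [continuous_intros]:
  "continuous_on S f \<Longrightarrow> continuous_on S (\<lambda>x. clip B (f x))"
  unfolding clip_def by (intro continuous_intros)

section \<open>Contraction estimates and dependence on the parameter\<close>

lemma abs_diff_mult_le:
  fixes a b c d :: real
  assumes "\<bar>a\<bar> \<le> p" "\<bar>d\<bar> \<le> q" "\<bar>a - c\<bar> \<le> x" "\<bar>b - d\<bar> \<le> y"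
  shows "\<bar>a * b - c * d\<bar> \<le> p * y + x * q"
proof -
  have "a * b - c * d = a * (b - d) + (a - c) * d" by (simp add: algebra_simps)
  also have "\<bar>\<dots>\<bar> \<le> \<bar>a\<bar> * \<bar>b - d\<bar> + \<bar>a - c\<bar> * \<bar>d\<bar>"
    by (metis abs_mult abs_triangle_ineq)
  also have "\<dots> \<le> p * y + x * q"
    using assms by (intro add_mono mult_mono) auto
  finally show ?thesis .
qed

text \<open>The constant 9 comes from \<open>N3\<close>, whose four terms contribute 1 + 2 + 4 +
  2.\<close>

lemma N_lipschitz:
  assumes "\<bar>u\<bar> \<le> B" "\<bar>w\<bar> \<le> B" "\<bar>v\<bar> \<le> B" "\<bar>u'\<bar> \<le> B" "\<bar>w'\<bar> \<le> B" "\<bar>v'\<bar> \<le> B"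
    and "\<bar>u - u'\<bar> \<le> d" "\<bar>w - w'\<bar> \<le> d" "\<bar>v - v'\<bar> \<le> d"
  shows "\<bar>N1 u w v - N1 u' w' v'\<bar> \<le> 9 * B * d"
    and "\<bar>N2 u w v - N2 u' w' v'\<bar> \<le> 9 * B * d"
    and "\<bar>N3 u w v - N3 u' w' v'\<bar> \<le> 9 * B * d"
proof -
  have Bd: "0 \<le> B * d" using assms(1,7) by (intro mult_nonneg_nonneg) auto
  have chi: "\<bar>u + w + 2 * v\<bar> \<le> 4 * B" "\<bar>u + w + 2 * v - (u' + w' + 2 * v')\<bar> \<le> 4 * d"
    and uw: "\<bar>u' + w'\<bar> \<le> 2 * B" "\<bar>u + w - (u' + w')\<bar> \<le> 2 * d"
    using assms by (simp_all add: abs_le_iff)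
  show "\<bar>N1 u w v - N1 u' w' v'\<bar> \<le> 9 * B * d"
    using abs_diff_mult_le[OF chi(1) assms(4) chi(2) assms(7)] Bd
    unfolding N1_def by (simp add: algebra_simps)
  show "\<bar>N2 u w v - N2 u' w' v'\<bar> \<le> 9 * B * d"
    using abs_diff_mult_le[OF chi(1) assms(5) chi(2) assms(8)] Bd
    unfolding N2_def by (simp add: algebra_simps)
  have tri: "\<bar>p / 2 + q + r - t\<bar> \<le> \<bar>p\<bar> / 2 + \<bar>q\<bar> + \<bar>r\<bar> + \<bar>t\<bar>" for p q r t :: real
    by linarith
  have "N3 u w v - N3 u' w' v' = (u * u - u' * u') / 2 + (u * w - u' * w')
      + (v * (u + w) - v' * (u' + w')) - (v * v - v' * v')"
    by (simp add: N3_def power2_eq_square field_simps)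
  then have "\<bar>N3 u w v - N3 u' w' v'\<bar> \<le> \<bar>u * u - u' * u'\<bar> / 2 + \<bar>u * w - u' * w'\<bar>
      + \<bar>v * (u + w) - v' * (u' + w')\<bar> + \<bar>v * v - v' * v'\<bar>"
    by (simp only: tri)
  also have "\<dots> \<le> (B * d + d * B) / 2 + (B * d + d * B) + (B * (2 * d) + d * (2 * B)) + (B * d + d * B)"
    using assms uw by (intro add_mono divide_right_mono abs_diff_mult_le) auto
  finally show "\<bar>N3 u w v - N3 u' w' v'\<bar> \<le> 9 * B * d"
    using Bd by (simp add: algebra_simps)
qed

lemma continuous_on_N [continuous_intros]:
  assumes "continuous_on S u" "continuous_on S w" "continuous_on S v"
  shows "continuous_on S (\<lambda>t. N1 (u t) (w t) (v t))"
    and "continuous_on S (\<lambda>t. N2 (u t) (w t) (v t))"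
    and "continuous_on S (\<lambda>t. N3 (u t) (w t) (v t))"
  unfolding N1_def N2_def N3_def using assms by (intro continuous_intros; simp)+

lemma continuous_on_G [continuous_intros]:
  assumes "continuous_on {0..R} U" "continuous_on {0..R} W" "continuous_on {0..R} N"
  shows "continuous_on {0..R} (GU s U N)" "continuous_on {0..R} (GW N)" "continuous_on {0..R} (GV s U W N)"
  unfolding GU_def[abs_def] GW_def[abs_def] GV_def[abs_def]
  using assms continuous_on_J[OF assms(1)] by (intro continuous_intros; simp)+

lemma abs_J2_le:
  assumes "continuous_on {0..r} p" "continuous_on {0..r} q"
    and "\<And>t. t \<in> {0..r} \<Longrightarrow> \<bar>p t\<bar> \<le> P * exp (l * t)"
    and "\<And>t. t \<in> {0..r} \<Longrightarrow> \<bar>q t\<bar> \<le> Q * t * exp (l * t)"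
    and "r \<ge> 0" "l > 0" "P \<ge> 0" "Q \<ge> 0"
  shows "\<bar>J 2 (\<lambda>t. p t + q t) r\<bar> \<le> (P / 3 + Q / l) * exp (l * r)"
proof -
  have r: "r \<in> {0..r}" using assms by simp
  have "J 2 (\<lambda>t. p t + q t) r - J 2 p r = J 2 q r"
    using J_diff[OF continuous_on_add[OF assms(1,2)] assms(1) r, of 2] by simp
  moreover have "\<bar>J 2 p r\<bar> \<le> P * exp (l * r) / 3"
    using abs_J_le_exp[OF assms(1,3), of 2] assms by simp
  moreover have "\<bar>J 2 q r\<bar> \<le> Q / l * exp (l * r)"
    using assms by (intro abs_J_le_exp_linear) auto
  ultimately have "\<bar>J 2 (\<lambda>t. p t + q t) r\<bar> \<le> P * exp (l * r) / 3 + Q / l * exp (l * r)" by linarith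
  then show ?thesis by (simp add: algebra_simps)
qed

text \<open>In the weighted norm the terms with a factor r^2 gain 1 / l and make up \<kappa>. The
  summands U + W of \<open>GV\<close> have no such factor, but averaging with weight t^2 brings them
  down to 2 / 3, still below 1. Two parameters \<open>s\<close> and \<open>s'\<close> let one lemma
  serve the contraction and the dependence on the parameter.\<close>

lemma step_estimate:
  assumes cont: "continuous_on {0..R} U" "continuous_on {0..R} W" "continuous_on {0..R} N"
      "continuous_on {0..R} U'" "continuous_on {0..R} W'" "continuous_on {0..R} N'"
    and U: "\<And>t. t \<in> {0..R} \<Longrightarrow> \<bar>U t - U' t\<bar> \<le> A * exp (l * t)"
    and W: "\<And>t. t \<in> {0..R} \<Longrightarrow> \<bar>W t - W' t\<bar> \<le> A * exp (l * t)"
    and N: "\<And>t. t \<in> {0..R} \<Longrightarrow> \<bar>N t - N' t\<bar> \<le> C * (A * exp (l * t))"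
    and A: "A \<ge> 0" "C \<ge> 0" "l > 0" and r: "r \<in> {0..R}"
  defines "\<kappa> \<equiv> (R + C * R) / l"
  shows "\<bar>J 2 (GU s U N) r - J 2 (GU s' U' N') r\<bar> \<le> (\<bar>s - s'\<bar> + \<kappa> * A) * exp (l * r)"
    and "\<bar>J 2 (GW N) r - J 2 (GW N') r\<bar> \<le> \<kappa> * A * exp (l * r)"
    and "\<bar>J 2 (GV s U W N) r - J 2 (GV s' U' W' N') r\<bar> \<le> (\<bar>s - s'\<bar> + (2 / 3 + \<kappa>) * A) * exp (l * r)"
proof -
  have r0: "0 \<le> r" "r \<le> R" using r by auto
  have sub: "continuous_on {0..r} f" if "continuous_on {0..R} f" for f :: "real \<Rightarrow> real"
    using continuous_on_subset[OF that] r0 by simp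
  note cr = cont[THEN sub]
  have e1: "1 \<le> exp (l * t)" if "t \<ge> 0" for t using A that by simp
  have lin: "\<bar>t\<^sup>2 * X - t\<^sup>2 * Y\<bar> \<le> R * t * Z" if "t \<in> {0..r}" "\<bar>X - Y\<bar> \<le> Z" for t X Y Z
  proof -
    have Z: "0 \<le> Z" using that(2) by linarith
    have "\<bar>t\<^sup>2 * X - t\<^sup>2 * Y\<bar> = t\<^sup>2 * \<bar>X - Y\<bar>" by (simp add: abs_mult flip: right_diff_distrib)
    also have "\<dots> \<le> t * t * Z" using that by (simp add: power2_eq_square mult_left_mono)
    also have "\<dots> \<le> R * t * Z" using that r0 Z by (intro mult_right_mono) auto
    finally show ?thesis .
  qed
  have dN: "\<bar>t\<^sup>2 * N t - t\<^sup>2 * N' t\<bar> \<le> C * R * A * t * exp (l * t)" if t: "t \<in> {0..r}" for t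
    using lin[OF t N, of t] t r0 by (simp add: mult_ac)
  have dh: "\<bar>t\<^sup>2 * J 1 U t - t\<^sup>2 * J 1 U' t\<bar> \<le> R * A / 2 * t * exp (l * t)" if t: "t \<in> {0..r}" for t
  proof -
    have c: "continuous_on {0..t} (\<lambda>t. U t - U' t)"
      using t cr by (intro continuous_on_diff; auto elim!: continuous_on_subset)
    have "J 1 U t - J 1 U' t = J 1 (\<lambda>t. U t - U' t) t"
      using J_diff[OF cr(1,4) t] .
    moreover have "\<bar>J 1 (\<lambda>t. U t - U' t) t\<bar> \<le> A * exp (l * t) / 2"
      using abs_J_le_exp[OF c, of A l 1] U t r0 A by simp
    ultimately have "\<bar>J 1 U t - J 1 U' t\<bar> \<le> A * exp (l * t) / 2" by simp
    from lin[OF t this] show ?thesis by (simp add: mult_ac)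
  qed
  have abs2: "\<bar>2 * x - y\<bar> \<le> 2 * a + b" if "\<bar>x\<bar> \<le> a" "\<bar>y\<bar> \<le> b" for x y a b :: real
    using that by linarith
  have abs3: "\<bar>y - x\<bar> \<le> 2 * a + b" if "\<bar>x\<bar> \<le> a" "\<bar>y\<bar> \<le> b" for x y a b :: real
    using that by linarith
  have abs4: "\<bar>x + y - z\<bar> \<le> 2 * a + b" if "\<bar>x\<bar> \<le> a" "\<bar>y\<bar> \<le> a" "\<bar>z\<bar> \<le> b" for x y z a b :: real
    using that by linarith
  have k: "(R * A + C * R * A) / l = \<kappa> * A" by (simp add: \<kappa>_def field_simps)
  have RA: "0 \<le> R * A" "0 \<le> C * R * A" using r0 A by auto
  have cJ: "continuous_on {0..r} (J 1 U)" "continuous_on {0..r} (J 1 U')"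
    using cr by (auto intro: continuous_on_J)
  have "J 2 (GU s U N) r - J 2 (GU s' U' N') r = J 2 (\<lambda>t. GU s U N t - GU s' U' N' t) r"
    using cont r by (intro J_diff[of R] continuous_intros)
  also have "\<dots> = J 2 (\<lambda>t. 3 * (s - s') + (2 * (t\<^sup>2 * J 1 U t - t\<^sup>2 * J 1 U' t) - (t\<^sup>2 * N t - t\<^sup>2 * N' t))) r"
    by (rule arg_cong[where f="\<lambda>g. J 2 g r"]) (auto simp: GU_def algebra_simps)
  also have "\<bar>\<dots>\<bar> \<le> (3 * \<bar>s - s'\<bar> / 3 + (R * A + C * R * A) / l) * exp (l * r)"
  proof (rule abs_J2_le)
    show "\<bar>3 * (s - s')\<bar> \<le> 3 * \<bar>s - s'\<bar> * exp (l * t)" if "t \<in> {0..r}" for t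
      using mult_left_mono[OF e1[of t], of "3 * \<bar>s - s'\<bar>"] that by (simp add: abs_mult)
    show "\<bar>2 * (t\<^sup>2 * J 1 U t - t\<^sup>2 * J 1 U' t) - (t\<^sup>2 * N t - t\<^sup>2 * N' t)\<bar>
        \<le> (R * A + C * R * A) * t * exp (l * t)" if "t \<in> {0..r}" for t
    proof -
      have "\<bar>2 * (t\<^sup>2 * J 1 U t - t\<^sup>2 * J 1 U' t) - (t\<^sup>2 * N t - t\<^sup>2 * N' t)\<bar>
        \<le> 2 * (R * A / 2 * t * exp (l * t)) + C * R * A * t * exp (l * t)"
        by (rule abs2[OF dh[OF that] dN[OF that]])
      then show ?thesis by (simp add: distrib_right)
    qed
  qed (use r0 A RA cr cJ in \<open>auto intro!: continuous_intros\<close>)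
  finally show "\<bar>J 2 (GU s U N) r - J 2 (GU s' U' N') r\<bar> \<le> (\<bar>s - s'\<bar> + \<kappa> * A) * exp (l * r)"
    unfolding k by simp
  have "J 2 (GW N) r - J 2 (GW N') r = J 2 (\<lambda>t. GW N t - GW N' t) r"
    using cont r by (intro J_diff[of R] continuous_intros)
  also have "\<dots> = J 2 (\<lambda>t. 0 + - (t\<^sup>2 * N t - t\<^sup>2 * N' t)) r"
    by (rule arg_cong[where f="\<lambda>g. J 2 g r"]) (auto simp: GW_def algebra_simps)
  also have "\<bar>\<dots>\<bar> \<le> (0 / 3 + (R * A + C * R * A) / l) * exp (l * r)"
  proof (rule abs_J2_le)
    show "\<bar>- (t\<^sup>2 * N t - t\<^sup>2 * N' t)\<bar> \<le> (R * A + C * R * A) * t * exp (l * t)" if t: "t \<in> {0..r}" for t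
    proof -
      have "0 \<le> R * A * t * exp (l * t)" using RA t by auto
      then show ?thesis using dN[OF t] by (simp add: algebra_simps)
    qed
  qed (use r0 A RA cr cJ in \<open>auto intro!: continuous_intros\<close>)
  finally show "\<bar>J 2 (GW N) r - J 2 (GW N') r\<bar> \<le> \<kappa> * A * exp (l * r)"
    unfolding k by simp
  have "J 2 (GV s U W N) r - J 2 (GV s' U' W' N') r = J 2 (\<lambda>t. GV s U W N t - GV s' U' W' N' t) r"
    using cont r by (intro J_diff[of R] continuous_intros)
  also have "\<dots> = J 2 (\<lambda>t. (U t - U' t + (W t - W' t) - 3 / 2 * (s - s'))
      + ((t\<^sup>2 * N t - t\<^sup>2 * N' t) - (t\<^sup>2 * J 1 U t - t\<^sup>2 * J 1 U' t))) r"
    by (rule arg_cong[where f="\<lambda>g. J 2 g r"]) (auto simp: GV_def algebra_simps diff_divide_distrib)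
  also have "\<bar>\<dots>\<bar> \<le> ((2 * A + 3 * \<bar>s - s'\<bar>) / 3 + (R * A + C * R * A) / l) * exp (l * r)"
  proof (rule abs_J2_le)
    fix t assume t: "t \<in> {0..r}"
    have "\<bar>3 / 2 * (s - s')\<bar> \<le> 3 * \<bar>s - s'\<bar> * exp (l * t)"
      using mult_left_mono[OF e1[of t], of "3 * \<bar>s - s'\<bar>"] t by (simp add: abs_mult)
    then have "\<bar>U t - U' t + (W t - W' t) - 3 / 2 * (s - s')\<bar>
        \<le> 2 * (A * exp (l * t)) + 3 * \<bar>s - s'\<bar> * exp (l * t)"
      using t r0 by (intro abs4 U W) auto
    then show "\<bar>U t - U' t + (W t - W' t) - 3 / 2 * (s - s')\<bar> \<le> (2 * A + 3 * \<bar>s - s'\<bar>) * exp (l * t)"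
      by (simp add: distrib_right)
    have "0 \<le> R * A * t * exp (l * t)" using RA t by auto
    then show "\<bar>(t\<^sup>2 * N t - t\<^sup>2 * N' t) - (t\<^sup>2 * J 1 U t - t\<^sup>2 * J 1 U' t)\<bar>
        \<le> (R * A + C * R * A) * t * exp (l * t)"
      using abs3[OF dh[OF t] dN[OF t]] by (simp add: distrib_right)
  qed (use r0 A RA cr cJ in \<open>auto intro!: continuous_intros\<close>)
  finally show "\<bar>J 2 (GV s U W N) r - J 2 (GV s' U' W' N') r\<bar>
      \<le> (\<bar>s - s'\<bar> + (2 / 3 + \<kappa>) * A) * exp (l * r)"
    unfolding k by (simp add: algebra_simps add_divide_distrib)
qed

lemma clipped_solution_exists:
  assumes R: "R \<ge> 0" and B: "B \<ge> 0"
  obtains U W V where "continuous_on {0..R} U" "continuous_on {0..R} W" "continuous_on {0..R} V"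
    "\<And>r. r \<in> {0..R} \<Longrightarrow> U r = J 2 (GU s U (\<lambda>t. N1 (clip B (U t)) (clip B (W t)) (clip B (V t)))) r"
    "\<And>r. r \<in> {0..R} \<Longrightarrow> W r = J 2 (GW (\<lambda>t. N2 (clip B (U t)) (clip B (W t)) (clip B (V t)))) r"
    "\<And>r. r \<in> {0..R} \<Longrightarrow> V r = J 2 (GV s U W (\<lambda>t. N3 (clip B (U t)) (clip B (W t)) (clip B (V t)))) r"
proof -
  define c where "c N y t = N (clip B (fst (y t))) (clip B (fst (snd (y t)))) (clip B (snd (snd (y t))))"
    for N :: "real \<Rightarrow> real \<Rightarrow> real \<Rightarrow> real" and y :: "real \<Rightarrow> real \<times> real \<times> real" and t :: real
  define T where "T y r = (J 2 (GU s (\<lambda>t. fst (y t)) (c N1 y)) r, J 2 (GW (c N2 y)) r,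
     J 2 (GV s (\<lambda>t. fst (y t)) (\<lambda>t. fst (snd (y t))) (c N3 y)) r)" for y r
  \<comment> \<open>Large enough for \<kappa> \<le> 1 / 12. The three components then add up to 2 /
    3 + 3 / 12 = 11 / 12.\<close>
  define l where "l = 12 * (R + 9 * B * R) + 1"
  have l: "l > 0" using R B by (simp add: l_def add_nonneg_pos)
  have k: "(R + 9 * B * R) / l \<le> 1 / 12" using l by (simp add: divide_le_eq l_def)
  have cc: "continuous_on {0..R} (c N1 y)" "continuous_on {0..R} (c N2 y)" "continuous_on {0..R} (c N3 y)"
    "continuous_on {0..R} (\<lambda>t. fst (y t))" "continuous_on {0..R} (\<lambda>t. fst (snd (y t)))"
    if "continuous_on {0..R} y" for y
    unfolding c_def using that by (auto intro!: continuous_intros)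
  obtain y where y: "continuous_on {0..R} y" "\<And>t. t \<in> {0..R} \<Longrightarrow> y t = T y t"
  proof (rule volterra_fixed_point[OF R, of "11 / 12" T l])
    show "continuous_on {0..R} (T y)" if "continuous_on {0..R} y" for y
      unfolding T_def[abs_def] using cc[OF that]
      by (intro continuous_on_Pair continuous_on_J continuous_on_G)
  next
    fix y z :: "real \<Rightarrow> real \<times> real \<times> real" and A
    assume yz: "continuous_on {0..R} y" "continuous_on {0..R} z" and A: "A \<ge> 0"
      and d: "\<And>t. t \<in> {0..R} \<Longrightarrow> norm (y t - z t) \<le> A * exp (l * t)"
    have d': "\<bar>fst (y t) - fst (z t)\<bar> \<le> A * exp (l * t)"
      "\<bar>fst (snd (y t)) - fst (snd (z t))\<bar> \<le> A * exp (l * t)"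
      "\<bar>snd (snd (y t)) - snd (snd (z t))\<bar> \<le> A * exp (l * t)" if "t \<in> {0..R}" for t
    proof -
      have "\<bar>fst p\<bar> \<le> norm p" "\<bar>fst (snd p)\<bar> \<le> norm p" "\<bar>snd (snd p)\<bar> \<le> norm p"
        for p :: "real \<times> real \<times> real"
        by (cases p, metis norm_fst_le norm_snd_le order_trans real_norm_def fst_conv snd_conv)+
      from this[of "y t - z t"] d[OF that] show
        "\<bar>fst (y t) - fst (z t)\<bar> \<le> A * exp (l * t)"
        "\<bar>fst (snd (y t)) - fst (snd (z t))\<bar> \<le> A * exp (l * t)"
        "\<bar>snd (snd (y t)) - snd (snd (z t))\<bar> \<le> A * exp (l * t)" by auto
    qed
    have dN: "\<bar>c N1 y t - c N1 z t\<bar> \<le> 9 * B * (A * exp (l * t))"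
      "\<bar>c N2 y t - c N2 z t\<bar> \<le> 9 * B * (A * exp (l * t))"
      "\<bar>c N3 y t - c N3 z t\<bar> \<le> 9 * B * (A * exp (l * t))" if "t \<in> {0..R}" for t
      unfolding c_def using d'[OF that] B
      by (intro N_lipschitz clip_bound order_trans[OF clip_lipschitz]; simp)+
    show "\<forall>t\<in>{0..R}. norm (T y t - T z t) \<le> 11 / 12 * A * exp (l * t)"
    proof
      fix t assume t: "t \<in> {0..R}"
      define k where "k = (R + 9 * B * R) / l"
      have k: "k \<le> 1 / 12" unfolding k_def by fact
      have B9: "0 \<le> 9 * B" using B by simp
      note cy = cc[OF yz(1)] and cz = cc[OF yz(2)]
      have 1: "\<bar>fst (T y t) - fst (T z t)\<bar> \<le> (0 + k * A) * exp (l * t)"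
        using step_estimate(1)[OF cy(4,5,1) cz(4,5,1) d'(1,2) dN(1) A B9 l t, of s s] by (simp add: T_def k_def)
      have 2: "\<bar>fst (snd (T y t)) - fst (snd (T z t))\<bar> \<le> k * A * exp (l * t)"
        using step_estimate(2)[OF cy(4,5,2) cz(4,5,2) d'(1,2) dN(2) A B9 l t] by (simp add: T_def k_def)
      have 3: "\<bar>snd (snd (T y t)) - snd (snd (T z t))\<bar> \<le> (0 + (2 / 3 + k) * A) * exp (l * t)"
        using step_estimate(3)[OF cy(4,5,3) cz(4,5,3) d'(1,2) dN(3) A B9 l t, of s s] by (simp add: T_def k_def)
      have "norm (p, q, w) \<le> \<bar>p\<bar> + \<bar>q\<bar> + \<bar>w\<bar>" for p q w :: real
        using norm_Pair_le[of p "(q, w)"] norm_Pair_le[of q w] by simp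
      moreover have "T y t - T z t = (fst (T y t) - fst (T z t), fst (snd (T y t)) - fst (snd (T z t)),
          snd (snd (T y t)) - snd (snd (T z t)))"
        by (simp add: prod_eq_iff)
      ultimately have "norm (T y t - T z t) \<le> (0 + k * A) * exp (l * t) + k * A * exp (l * t)
          + (0 + (2 / 3 + k) * A) * exp (l * t)"
        using 1 2 3 by (smt (verit))
      also have "\<dots> = (2 / 3 + 3 * k) * (A * exp (l * t))"
        by (simp add: algebra_simps)
      also have "\<dots> \<le> 11 / 12 * (A * exp (l * t))"
        using k A by (intro mult_right_mono) auto
      finally show "norm (T y t - T z t) \<le> 11 / 12 * A * exp (l * t)" by simp
    qed
  qed auto
  define U W V where "U t = fst (y t)" and "W t = fst (snd (y t))" and "V t = snd (snd (y t))" for t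
  show thesis
  proof
    show "continuous_on {0..R} U" "continuous_on {0..R} W" "continuous_on {0..R} V"
      unfolding U_def V_def W_def using y(1) by (auto intro!: continuous_intros)
    fix r assume r: "r \<in> {0..R}"
    have "y r = T y r" using y(2) r by blast
    then show "U r = J 2 (GU s U (\<lambda>t. N1 (clip B (U t)) (clip B (W t)) (clip B (V t)))) r"
      "W r = J 2 (GW (\<lambda>t. N2 (clip B (U t)) (clip B (W t)) (clip B (V t)))) r"
      "V r = J 2 (GV s U W (\<lambda>t. N3 (clip B (U t)) (clip B (W t)) (clip B (V t)))) r"
      by (simp_all add: T_def c_def[abs_def] U_def[abs_def] W_def[abs_def] V_def[abs_def] prod_eq_iff)
  qed
qed

text \<open>The integral form of the regularised equations; it already determines the values at the
  singular point, see \<open>sol_at_0\<close>.\<close>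

definition sol :: "real \<Rightarrow> real \<Rightarrow> (real \<Rightarrow> real) \<Rightarrow> (real \<Rightarrow> real) \<Rightarrow> (real \<Rightarrow> real) \<Rightarrow> bool" where
  "sol R s U W V \<longleftrightarrow>
     continuous_on {0..R} U \<and> continuous_on {0..R} W \<and> continuous_on {0..R} V \<and>
     (\<forall>r\<in>{0..R}. U r = J 2 (GU s U (\<lambda>t. N1 (U t) (W t) (V t))) r \<and>
        W r = J 2 (GW (\<lambda>t. N2 (U t) (W t) (V t))) r \<and>
        V r = J 2 (GV s U W (\<lambda>t. N3 (U t) (W t) (V t))) r)"

text \<open>Let \<open>A\<close> be the maximum of the weighted difference. At a maximum point
  \<open>step_estimate\<close> gives A \<le> |s - s'| + 3/4 A, with 3/4 = 2/3 + 1/12, hence A \<le>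
  4 |s - s'|. For s = s' this is uniqueness.\<close>

lemma sol_dependence:
  assumes s1: "sol R s U W V" and s2: "sol R s' U' W' V'"
    and b1: "\<And>t. t \<in> {0..R} \<Longrightarrow> \<bar>U t\<bar> \<le> B \<and> \<bar>W t\<bar> \<le> B \<and> \<bar>V t\<bar> \<le> B"
    and b2: "\<And>t. t \<in> {0..R} \<Longrightarrow> \<bar>U' t\<bar> \<le> B \<and> \<bar>W' t\<bar> \<le> B \<and> \<bar>V' t\<bar> \<le> B"
    and r: "r \<in> {0..R}"
  defines "l \<equiv> 12 * (R + 9 * B * R) + 1"
  shows "\<bar>U r - U' r\<bar> \<le> 4 * \<bar>s - s'\<bar> * exp (l * R)"
    and "\<bar>W r - W' r\<bar> \<le> 4 * \<bar>s - s'\<bar> * exp (l * R)"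
    and "\<bar>V r - V' r\<bar> \<le> 4 * \<bar>s - s'\<bar> * exp (l * R)"
proof -
  have R: "R \<ge> 0" and B: "B \<ge> 0" using r b1[OF r] by auto
  have l: "l > 0" using R B by (simp add: l_def add_nonneg_pos)
  have k: "(R + 9 * B * R) / l \<le> 1 / 12" using l by (simp add: divide_le_eq l_def)
  have cont: "continuous_on {0..R} U" "continuous_on {0..R} W" "continuous_on {0..R} V"
    "continuous_on {0..R} U'" "continuous_on {0..R} W'" "continuous_on {0..R} V'"
    using s1 s2 unfolding sol_def by blast+
  define m where "m t = max \<bar>U t - U' t\<bar> (max \<bar>W t - W' t\<bar> \<bar>V t - V' t\<bar>) * exp (- (l * t))" for t
  have "continuous_on {0..R} m" unfolding m_def using cont by (intro continuous_intros)
  then obtain t0 where t0: "t0 \<in> {0..R}" "\<And>t. t \<in> {0..R} \<Longrightarrow> m t \<le> m t0"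
    using continuous_attains_sup[of "{0..R}" m] r by auto
  define A where "A = m t0"
  have A: "A \<ge> 0" by (auto simp: A_def m_def)
  have d: "max \<bar>U t - U' t\<bar> (max \<bar>W t - W' t\<bar> \<bar>V t - V' t\<bar>) \<le> A * exp (l * t)" if "t \<in> {0..R}" for t
  proof -
    have "max \<bar>U t - U' t\<bar> (max \<bar>W t - W' t\<bar> \<bar>V t - V' t\<bar>) = m t * exp (l * t)"
      by (simp add: m_def exp_minus)
    then show ?thesis using t0(2)[OF that] by (simp add: A_def)
  qed
  have d': "\<bar>U t - U' t\<bar> \<le> A * exp (l * t)" "\<bar>W t - W' t\<bar> \<le> A * exp (l * t)"
    "\<bar>V t - V' t\<bar> \<le> A * exp (l * t)" if "t \<in> {0..R}" for t
    using d[OF that] by auto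
  have dN: "\<bar>N1 (U t) (W t) (V t) - N1 (U' t) (W' t) (V' t)\<bar> \<le> 9 * B * (A * exp (l * t))"
    "\<bar>N2 (U t) (W t) (V t) - N2 (U' t) (W' t) (V' t)\<bar> \<le> 9 * B * (A * exp (l * t))"
    "\<bar>N3 (U t) (W t) (V t) - N3 (U' t) (W' t) (V' t)\<bar> \<le> 9 * B * (A * exp (l * t))" if "t \<in> {0..R}" for t
    using d'[OF that] b1[OF that] b2[OF that] by (intro N_lipschitz; simp)+
  have B9: "0 \<le> 9 * B" using B by simp
  define \<kappa> where "\<kappa> = (R + 9 * B * R) / l"
  have eqs: "U t0 = J 2 (GU s U (\<lambda>t. N1 (U t) (W t) (V t))) t0"
    "W t0 = J 2 (GW (\<lambda>t. N2 (U t) (W t) (V t))) t0"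
    "V t0 = J 2 (GV s U W (\<lambda>t. N3 (U t) (W t) (V t))) t0"
    "U' t0 = J 2 (GU s' U' (\<lambda>t. N1 (U' t) (W' t) (V' t))) t0"
    "W' t0 = J 2 (GW (\<lambda>t. N2 (U' t) (W' t) (V' t))) t0"
    "V' t0 = J 2 (GV s' U' W' (\<lambda>t. N3 (U' t) (W' t) (V' t))) t0"
    using s1 s2 t0(1) unfolding sol_def by blast+
  have 1: "\<bar>U t0 - U' t0\<bar> \<le> (\<bar>s - s'\<bar> + \<kappa> * A) * exp (l * t0)"
    unfolding eqs(1,4) \<kappa>_def
    by (rule step_estimate(1)[OF cont(1,2) _ cont(4,5) _ d'(1,2) dN(1) A B9 l t0(1)])
      (intro continuous_intros cont)+
  have 2: "\<bar>W t0 - W' t0\<bar> \<le> \<kappa> * A * exp (l * t0)"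
    unfolding eqs(2,5) \<kappa>_def
    by (rule step_estimate(2)[OF cont(1,2) _ cont(4,5) _ d'(1,2) dN(2) A B9 l t0(1)])
      (intro continuous_intros cont)+
  have 3: "\<bar>V t0 - V' t0\<bar> \<le> (\<bar>s - s'\<bar> + (2 / 3 + \<kappa>) * A) * exp (l * t0)"
    unfolding eqs(3,6) \<kappa>_def
    by (rule step_estimate(3)[OF cont(1,2) _ cont(4,5) _ d'(1,2) dN(3) A B9 l t0(1)])
      (intro continuous_intros cont)+
  have kA: "\<kappa> * A \<le> 1 / 12 * A" using k A unfolding \<kappa>_def by (rule mult_right_mono)
  have e: "(\<bar>s - s'\<bar> + \<kappa> * A) * exp (l * t0) \<le> (\<bar>s - s'\<bar> + 3 / 4 * A) * exp (l * t0)"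
    "\<kappa> * A * exp (l * t0) \<le> (\<bar>s - s'\<bar> + 3 / 4 * A) * exp (l * t0)"
    "(\<bar>s - s'\<bar> + (2 / 3 + \<kappa>) * A) * exp (l * t0) \<le> (\<bar>s - s'\<bar> + 3 / 4 * A) * exp (l * t0)"
    using kA A by (intro mult_right_mono; simp add: distrib_right)+
  define M where "M = max \<bar>U t0 - U' t0\<bar> (max \<bar>W t0 - W' t0\<bar> \<bar>V t0 - V' t0\<bar>)"
  have "M \<le> (\<bar>s - s'\<bar> + 3 / 4 * A) * exp (l * t0)"
    unfolding M_def
    by (intro max.boundedI order_trans[OF 1 e(1)] order_trans[OF 2 e(2)] order_trans[OF 3 e(3)])
  moreover have "A = M / exp (l * t0)"
    by (simp add: A_def m_def M_def exp_minus divide_inverse)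
  ultimately have "A \<le> \<bar>s - s'\<bar> + 3 / 4 * A"
    by (simp add: pos_divide_le_eq)
  then have A4: "A \<le> 4 * \<bar>s - s'\<bar>" by simp
  have "A * exp (l * r) \<le> 4 * \<bar>s - s'\<bar> * exp (l * R)"
    using A4 A l r by (intro mult_mono) auto
  then show "\<bar>U r - U' r\<bar> \<le> 4 * \<bar>s - s'\<bar> * exp (l * R)"
    "\<bar>W r - W' r\<bar> \<le> 4 * \<bar>s - s'\<bar> * exp (l * R)"
    "\<bar>V r - V' r\<bar> \<le> 4 * \<bar>s - s'\<bar> * exp (l * R)"
    using d'[OF r] by linarith+
qed

section \<open>Barrier arguments and a priori bounds\<close>

lemma first_zero:
  fixes f :: "real \<Rightarrow> real"
  assumes f: "continuous_on {0..R} f" "f 0 > 0" and r: "r \<in> {0..R}" "f r \<le> 0"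
  obtains z where "z \<in> {0<..R}" "f z = 0" "\<And>t. t \<in> {0..<z} \<Longrightarrow> f t > 0"
proof -
  have "closed {t \<in> {0..R}. f t \<le> 0}"
    using continuous_closed_preimage[OF f(1) closed_atLeastAtMost, of "{..0}"]
    by (simp add: vimage_def Int_def conj_commute)
  moreover have "bounded {t \<in> {0..R}. f t \<le> 0}" by (rule bounded_subset[of "{0..R}"]) auto
  moreover have "{t \<in> {0..R}. f t \<le> 0} \<noteq> {}" using r by auto
  ultimately obtain z where z: "z \<in> {0..R}" "f z \<le> 0" "\<And>t. t \<in> {0..R} \<Longrightarrow> f t \<le> 0 \<Longrightarrow> z \<le> t"
    using compact_attains_inf[of "{t \<in> {0..R}. f t \<le> 0}"] by (auto simp: compact_eq_bounded_closed)
  have "continuous_on {0..z} f" using z(1) by (auto intro: continuous_on_subset[OF f(1)])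
  then obtain c where c: "0 \<le> c" "c \<le> z" "f c = 0"
    using IVT2'[of f z 0 0] z f(2) by auto
  then have "c = z" using z(3)[of c] z(1) by auto
  show thesis
  proof
    show "z \<in> {0<..R}" using z(1,2) f(2) by (cases "z = 0") auto
    show "f z = 0" using c \<open>c = z\<close> by simp
    show "f t > 0" if "t \<in> {0..<z}" for t using z(1) z(3)[of t] that by force
  qed
qed

text \<open>A positive derivative at the first zero would force negative values just before it. The
  a priori bounds below consult the differential equation only at such a first contact.\<close>

lemma positive_barrier:
  fixes f :: "real \<Rightarrow> real"
  assumes f: "continuous_on {0..R} f" "f 0 > 0" and r: "r \<in> {0..R}"
    and D: "\<And>z. \<lbrakk>z \<in> {0<..R}; f z = 0; \<And>t. t \<in> {0..<z} \<Longrightarrow> f t > 0\<rbrakk> \<Longrightarrow>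
       \<exists>D>0. (f has_real_derivative D) (at z within {0..R})"
  shows "f r > 0"
proof (rule ccontr)
  assume "\<not> f r > 0"
  then have le: "f r \<le> 0" by simp
  obtain z where z: "z \<in> {0<..R}" "f z = 0" "\<And>t. t \<in> {0..<z} \<Longrightarrow> f t > 0"
    by (rule first_zero[OF f r le]) (rule that)
  obtain D where "D > 0" "(f has_real_derivative D) (at z within {0..R})"
    using D[OF z] by blast
  then obtain d where d: "d > 0" "\<And>h. \<lbrakk>h > 0; z - h \<in> {0..R}; h < d\<rbrakk> \<Longrightarrow> f (z - h) < f z"
    using has_real_derivative_pos_inc_left by metis
  define h where "h = min (d / 2) (z / 2)"
  have "h > 0" "z - h \<in> {0..R}" "h < d" "z - h \<in> {0..<z}" using d(1) z(1) by (auto simp: h_def min_def)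
  then show False using d(2)[of h] z(2) z(3)[of "z - h"] by simp
qed

lemma sol_continuous:
  assumes "sol R s U W V"
  shows "continuous_on {0..R} U" "continuous_on {0..R} W" "continuous_on {0..R} V"
  using assms unfolding sol_def by blast+

lemma sol_eqs:
  assumes "sol R s U W V" "r \<in> {0..R}"
  shows "U r = J 2 (GU s U (\<lambda>t. N1 (U t) (W t) (V t))) r"
    "W r = J 2 (GW (\<lambda>t. N2 (U t) (W t) (V t))) r"
    "V r = J 2 (GV s U W (\<lambda>t. N3 (U t) (W t) (V t))) r"
  using assms unfolding sol_def by blast+

lemma sol_at_0:
  assumes "sol R s U W V" "R \<ge> 0"
  shows "U 0 = s" "W 0 = 1 / 3" "V 0 = (1 / 3 - s / 2) / 3"
proof -
  have 0: "0 \<in> {0..R}" using assms by simp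
  show U: "U 0 = s" by (subst sol_eqs(1)[OF assms(1) 0]) (simp add: J_0 GU_def)
  show W: "W 0 = 1 / 3" by (subst sol_eqs(2)[OF assms(1) 0]) (simp add: J_0 GW_def)
  show "V 0 = (1 / 3 - s / 2) / 3" by (subst sol_eqs(3)[OF assms(1) 0]) (simp add: J_0 GV_def U W field_simps)
qed

lemma sol_derivs:
  assumes sol: "sol R s U W V" and r: "r \<in> {0<..R}"
  shows "(U has_real_derivative (GU s U (\<lambda>t. N1 (U t) (W t) (V t)) r - 3 * U r) / r) (at r within {0..R})"
    and "(W has_real_derivative (GW (\<lambda>t. N2 (U t) (W t) (V t)) r - 3 * W r) / r) (at r within {0..R})"
    and "(V has_real_derivative (GV s U W (\<lambda>t. N3 (U t) (W t) (V t)) r - 3 * V r) / r) (at r within {0..R})"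
    and "((\<lambda>r. r\<^sup>2 * J 1 U r) has_real_derivative r * U r) (at r within {0..R})"
    and "((\<lambda>r. r\<^sup>2 * J 1 V r) has_real_derivative r * V r) (at r within {0..R})"
    and "((\<lambda>r. r\<^sup>2 * J 1 W r) has_real_derivative r * W r) (at r within {0..R})"
proof -
  note c = sol_continuous[OF sol]
  have r': "r \<in> {0..R}" using r by auto
  have 3: "real 2 + 1 = 3" by simp
  note c' = continuous_on_G[OF c(1,2)] continuous_on_N[OF c]
  note e = sol_eqs[OF sol r', symmetric]
  have *: "(f has_real_derivative (g r - 3 * f r) / r) (at r within {0..R})"
    if "continuous_on {0..R} g" "\<And>t. t \<in> {0..R} \<Longrightarrow> f t = J 2 g t" for f g
  proof (rule has_field_derivative_transform_within[OF _ zero_less_one r'])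
    show "(J 2 g has_real_derivative (g r - 3 * f r) / r) (at r within {0..R})"
      using has_real_derivative_J[OF that(1) r, of 2] that(2)[OF r'] by simp
  qed (use that(2) in auto)
  show "(U has_real_derivative (GU s U (\<lambda>t. N1 (U t) (W t) (V t)) r - 3 * U r) / r) (at r within {0..R})"
    by (intro * c' sol_eqs[OF sol])
  show "(W has_real_derivative (GW (\<lambda>t. N2 (U t) (W t) (V t)) r - 3 * W r) / r) (at r within {0..R})"
    by (intro * c' sol_eqs[OF sol])
  show "(V has_real_derivative (GV s U W (\<lambda>t. N3 (U t) (W t) (V t)) r - 3 * V r) / r) (at r within {0..R})"
    by (intro * c' sol_eqs[OF sol])
  show "((\<lambda>r. r\<^sup>2 * J 1 U r) has_real_derivative r * U r) (at r within {0..R})"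
    "((\<lambda>r. r\<^sup>2 * J 1 V r) has_real_derivative r * V r) (at r within {0..R})"
    "((\<lambda>r. r\<^sup>2 * J 1 W r) has_real_derivative r * W r) (at r within {0..R})"
    using has_real_derivative_power_mult_J[OF c(1) r', of 1] has_real_derivative_power_mult_J[OF c(3) r', of 1]
      has_real_derivative_power_mult_J[OF c(2) r', of 1]
    by (simp_all add: power2_eq_square)
qed

lemma sol_mono: "sol R s U W V \<Longrightarrow> R' \<le> R \<Longrightarrow> sol R' s U W V"
  unfolding sol_def by (auto intro: continuous_on_subset)

text \<open>At a first zero z of U the equation reduces to z U' = 3 s + 2 z^2 J 1 U > 0, and at a
  zero of W to z W' = 1.\<close>

lemma sol_pos:
  assumes sol: "sol R s U W V" and s: "s > 0" and r: "r \<in> {0..R}"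
  shows "U r > 0" "W r > 0"
proof -
  note c = sol_continuous[OF sol]
  have R: "R \<ge> 0" using r by simp
  note at0 = sol_at_0[OF sol R]
  show "U r > 0"
  proof (rule positive_barrier[OF c(1) _ r])
    fix z assume z: "z \<in> {0<..R}" "U z = 0" "\<And>t. t \<in> {0..<z} \<Longrightarrow> U t > 0"
    have "0 \<le> J 1 U z"
    proof (rule J_nonneg)
      show "0 \<le> U t" if "t \<in> {0..z}" for t using z(2) z(3)[of t] that by (cases "t = z") auto
      show "continuous_on {0..z} U" using c(1) z(1) by (auto intro: continuous_on_subset)
    qed (use z in auto)
    then have "(GU s U (\<lambda>t. N1 (U t) (W t) (V t)) z - 3 * U z) / z > 0"
      using z s by (auto simp: GU_def N1_def intro!: divide_pos_pos add_pos_nonneg)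
    then show "\<exists>D>0. (U has_real_derivative D) (at z within {0..R})"
      using sol_derivs(1)[OF sol z(1)] by blast
  qed (use at0 s in auto)
  show "W r > 0"
  proof (rule positive_barrier[OF c(2) _ r])
    fix z assume z: "z \<in> {0<..R}" "W z = 0"
    then have "(GW (\<lambda>t. N2 (U t) (W t) (V t)) z - 3 * W z) / z > 0"
      by (auto simp: GW_def N2_def)
    then show "\<exists>D>0. (W has_real_derivative D) (at z within {0..R})"
      using sol_derivs(2)[OF sol z(1)] by blast
  qed (use at0 s in auto)
qed

lemma sol_h_nonneg:
  assumes sol: "sol R s U W V" and s: "s > 0" and r: "r \<in> {0..R}"
  shows "0 \<le> r\<^sup>2 * J 1 U r"
proof -
  have "0 \<le> J 1 U r"
  proof (rule J_nonneg)
    show "0 \<le> U t" if "t \<in> {0..r}" for t using sol_pos(1)[OF sol s, of t] that r by auto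
    show "continuous_on {0..r} U" using sol_continuous(1)[OF sol] r by (auto intro: continuous_on_subset)
  qed (use r in auto)
  then show ?thesis by simp
qed

text \<open>\<open>k2\<close> is \<open>r\<^sup>2 / b(r)\<^sup>2\<close>, expressed through the conserved quantity.\<close>
definition k2 :: "real \<Rightarrow> (real \<Rightarrow> real) \<Rightarrow> (real \<Rightarrow> real) \<Rightarrow> (real \<Rightarrow> real) \<Rightarrow> real \<Rightarrow> real" where
  "k2 s U W V r = ((2 + r\<^sup>2 * (U r + W r + 2 * V r))\<^sup>2 - r ^ 4 * (W r)\<^sup>2 - 2 * (1 + r\<^sup>2 * V r)\<^sup>2
      - r\<^sup>2 * (2 + 2 * (r\<^sup>2 * J 1 U r) + 3 * s)) / 2"

text \<open>\<open>a\<close>, \<open>b\<close>, \<open>c\<close> stand for U', W', V', so the left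
  side is the derivative of \<open>k2\<close>. That it is a multiple of \<open>k2\<close> reflects
  (1 / b^2)' = - 2 (b' / b) / b^2.\<close>

lemma k2_derivative_identity:
  fixes r u w v h s a b c :: real
  assumes "r * a = 3 * s + 2 * h - r\<^sup>2 * ((u + w + 2 * v) * u) - 3 * u"
    and "r * b = 1 - r\<^sup>2 * ((u + w + 2 * v) * w) - 3 * w"
    and "r * c = u + w - 3 * s / 2 - h + r\<^sup>2 * (u\<^sup>2 / 2 + u * w + v * (u + w) - v\<^sup>2) - 3 * v"
  shows "(2 * (2 + r\<^sup>2 * (u + w + 2 * v)) * (2 * r * (u + w + 2 * v) + r\<^sup>2 * (a + b + 2 * c))
      - (4 * r ^ 3 * w\<^sup>2 + r ^ 4 * (2 * w * b)) - 4 * (1 + r\<^sup>2 * v) * (2 * r * v + r\<^sup>2 * c)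
      - (2 * r * (2 + 2 * h + 3 * s) + r\<^sup>2 * (2 * (r * u)))) / 2
    = - 2 * r * v * (((2 + r\<^sup>2 * (u + w + 2 * v))\<^sup>2 - r ^ 4 * w\<^sup>2 - 2 * (1 + r\<^sup>2 * v)\<^sup>2
      - r\<^sup>2 * (2 + 2 * h + 3 * s)) / 2)"
proof -
  have e: "r\<^sup>2 * a = r * (r * a)" "r\<^sup>2 * b = r * (r * b)" "r\<^sup>2 * c = r * (r * c)"
    "r ^ 4 * (2 * w * b) = 2 * r ^ 3 * w * (r * b)" "r\<^sup>2 * (a + b + 2 * c) = r * (r * a + r * b + 2 * (r * c))"
    by (simp_all add: power2_eq_square power3_eq_cube power4_eq_xxxx algebra_simps)
  show ?thesis
    unfolding e assms
    by (simp add: power2_eq_square power3_eq_cube power4_eq_xxxx field_simps)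
qed

text \<open>Here the eliminated term 1 / b^2 is recovered: \<open>k2\<close> solves the linear
  equation y' = - 2 r V y, as does the exponential, and both are 1 at 0. In particular
  \<open>k2\<close> is positive, which its definition does not show.\<close>

lemma k2_eq:
  assumes sol: "sol R s U W V" and r: "r \<in> {0..R}"
  shows "k2 s U W V r = exp (- 2 * (r\<^sup>2 * J 1 V r))"
proof -
  note c = sol_continuous[OF sol]
  define E where "E t = k2 s U W V t * exp (2 * (t\<^sup>2 * J 1 V t))" for t
  have cE: "continuous_on {0..R} E"
    unfolding E_def k2_def by (intro continuous_intros c continuous_on_J) auto
  have E0: "E 0 = 1" by (simp add: E_def k2_def)
  have E': "(E has_real_derivative 0) (at t)" if t: "0 < t" "t < R" for t
  proof -
    have tR: "t \<in> {0<..R}" using t by auto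
    note D = sol_derivs[OF sol tR]
    have at: "at t within {0..R} = at t" using t by (rule at_within_Icc_at)
    note D = D[unfolded at]
    define a where "a = (GU s U (\<lambda>t. N1 (U t) (W t) (V t)) t - 3 * U t) / t"
    define b where "b = (GW (\<lambda>t. N2 (U t) (W t) (V t)) t - 3 * W t) / t"
    define d where "d = (GV s U W (\<lambda>t. N3 (U t) (W t) (V t)) t - 3 * V t) / t"
    define hh where "hh = (\<lambda>t. t\<^sup>2 * J 1 U t)"
    define gg where "gg = (\<lambda>t. t\<^sup>2 * J 1 V t)"
    have D': "(U has_real_derivative a) (at t)" "(W has_real_derivative b) (at t)" "(V has_real_derivative d) (at t)"
      "(hh has_real_derivative t * U t) (at t)" "(gg has_real_derivative t * V t) (at t)"
      using D by (simp_all add: a_def b_def d_def hh_def gg_def)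
    have K: "k2 s U W V = (\<lambda>r. ((2 + r\<^sup>2 * (U r + W r + 2 * V r))\<^sup>2 - r ^ 4 * (W r)\<^sup>2 - 2 * (1 + r\<^sup>2 * V r)\<^sup>2
      - r\<^sup>2 * (2 + 2 * hh r + 3 * s)) / 2)"
      by (auto simp: k2_def hh_def)
    define dk where "dk = (2 * (2 + t\<^sup>2 * (U t + W t + 2 * V t)) * (2 * t * (U t + W t + 2 * V t) + t\<^sup>2 * (a + b + 2 * d))
      - (4 * t ^ 3 * (W t)\<^sup>2 + t ^ 4 * (2 * W t * b)) - 4 * (1 + t\<^sup>2 * V t) * (2 * t * V t + t\<^sup>2 * d)
      - (2 * t * (2 + 2 * hh t + 3 * s) + t\<^sup>2 * (2 * (t * U t)))) / 2"
    have "(k2 s U W V has_real_derivative dk) (at t)"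
      unfolding K dk_def
      by (rule derivative_eq_intros D' refl | simp)+
         (simp add: power2_eq_square power3_eq_cube algebra_simps)
    moreover have "dk = - 2 * t * V t * k2 s U W V t" unfolding K dk_def
    proof (rule k2_derivative_identity)
      show "t * a = 3 * s + 2 * hh t - t\<^sup>2 * ((U t + W t + 2 * V t) * U t) - 3 * U t"
        "t * b = 1 - t\<^sup>2 * ((U t + W t + 2 * V t) * W t) - 3 * W t"
        "t * d = U t + W t - 3 * s / 2 - hh t + t\<^sup>2 * ((U t)\<^sup>2 / 2 + U t * W t + V t * (U t + W t) - (V t)\<^sup>2) - 3 * V t"
        using t by (simp_all add: a_def b_def d_def GU_def GW_def GV_def N1_def N2_def N3_def hh_def)
    qed
    ultimately have K': "(k2 s U W V has_real_derivative - 2 * t * V t * k2 s U W V t) (at t)" by simp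
    have "E = (\<lambda>t. k2 s U W V t * exp (2 * gg t))" by (auto simp: E_def gg_def)
    then show ?thesis
      by simp (rule derivative_eq_intros K' D' refl | simp)+
  qed
  have "E r = 1"
  proof (cases "r = 0")
    case False
    then have "R > 0" using r by auto
    then have "E r = E 0" using DERIV_isconst2[OF _ cE, of r] E' r by auto
    then show ?thesis using E0 by simp
  qed (use E0 in simp)
  then show ?thesis by (simp add: E_def exp_minus field_simps)
qed

text \<open>Reinserts \<open>k2\<close> and so brings back the term 1 / b^2 of the original equation
  for b'' that \<open>GV\<close> had eliminated.\<close>

lemma k2_V_identity:
  fixes r u w v h s :: real
  assumes "k = ((2 + r\<^sup>2 * (u + w + 2 * v))\<^sup>2 - r ^ 4 * w\<^sup>2 - 2 * (1 + r\<^sup>2 * v)\<^sup>2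
      - r\<^sup>2 * (2 + 2 * h + 3 * s)) / 2"
  shows "r\<^sup>2 * (u + w - 3 * s / 2 - h + r\<^sup>2 * (u\<^sup>2 / 2 + u * w + v * (u + w) - v\<^sup>2) - v)
     = r\<^sup>2 + k - (1 + r\<^sup>2 * (u + w + 2 * v)) * (1 + r\<^sup>2 * v)"
  unfolding assms by (simp add: power2_eq_square power3_eq_cube power4_eq_xxxx field_simps)

text \<open>1 + r^2 V is r b' / b, so this amounts to b' > 0. At a zero z the equation leaves z^2 +
  k2 up to a positive factor, and \<open>k2\<close> is an exponential.\<close>

lemma sol_v_pos:
  assumes sol: "sol R s U W V" and s: "s > 0" and r: "r \<in> {0..R}"
  shows "1 + r\<^sup>2 * V r > 0"
proof (rule positive_barrier[OF _ _ r])
  note c = sol_continuous[OF sol]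
  show "continuous_on {0..R} (\<lambda>r. 1 + r\<^sup>2 * V r)" by (intro continuous_intros c)
  fix z assume z: "z \<in> {0<..R}" "1 + z\<^sup>2 * V z = 0"
  let ?G = "GV s U W (\<lambda>t. N3 (U t) (W t) (V t)) z"
  have z': "z \<in> {0..R}" "z > 0" using z by auto
  have "z\<^sup>2 * (?G - V z) = z\<^sup>2 + k2 s U W V z - (1 + z\<^sup>2 * (U z + W z + 2 * V z)) * (1 + z\<^sup>2 * V z)"
    using k2_V_identity[OF k2_def[of s U W V z]] by (simp add: GV_def N3_def)
  then have "z\<^sup>2 * (?G - V z) = z\<^sup>2 + exp (- 2 * (z\<^sup>2 * J 1 V z))"
    using z(2) k2_eq[OF sol z'(1)] by simp
  then have "z\<^sup>2 * (?G - V z) > 0" by (simp add: add_nonneg_pos)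
  then have "z * (?G - V z) > 0" using z' by (simp add: zero_less_mult_iff power2_eq_square)
  moreover have "((\<lambda>r. 1 + r\<^sup>2 * V r) has_real_derivative z * (?G - V z)) (at z within {0..R})"
    using z' by (auto intro!: derivative_eq_intros sol_derivs(3)[OF sol z(1)] simp: field_simps power2_eq_square)
  ultimately show "\<exists>D>0. ((\<lambda>r. 1 + r\<^sup>2 * V r) has_real_derivative D) (at z within {0..R})" by blast
qed simp

lemma sol_rx_pos:
  assumes sol: "sol R s U W V" and s: "s > 0" and r: "r \<in> {0..R}"
  shows "2 + r\<^sup>2 * (U r + W r + 2 * V r) > 0"
proof -
  have "0 \<le> r\<^sup>2 * U r" "0 \<le> r\<^sup>2 * W r"
    using sol_pos[OF sol s r] by auto
  then show ?thesis using sol_v_pos[OF sol s r] by (simp add: algebra_simps)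
qed

text \<open>At W = 1 the right-hand side of the equation for r W' is minus the quantity of
  \<open>sol_rx_pos\<close>.\<close>

lemma sol_W_less_1:
  assumes sol: "sol R s U W V" and s: "s > 0" and r: "r \<in> {0..R}"
  shows "W r < 1"
proof -
  have "0 < 1 - W r"
  proof (rule positive_barrier[OF _ _ r])
    show "continuous_on {0..R} (\<lambda>r. 1 - W r)" by (intro continuous_intros sol_continuous[OF sol])
    show "0 < 1 - W 0" using sol_at_0[OF sol] r by simp
    fix z assume z: "z \<in> {0<..R}" "1 - W z = 0"
    have "2 + z\<^sup>2 * (U z + W z + 2 * V z) > 0" using sol_rx_pos[OF sol s, of z] z by auto
    then have "- ((GW (\<lambda>t. N2 (U t) (W t) (V t)) z - 3 * W z) / z) > 0"
      using z by (auto simp: GW_def N2_def field_simps)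
    moreover have "((\<lambda>r. 1 - W r) has_real_derivative - ((GW (\<lambda>t. N2 (U t) (W t) (V t)) z - 3 * W z) / z)) (at z within {0..R})"
      by (auto intro!: derivative_eq_intros sol_derivs(2)[OF sol z(1)])
    ultimately show "\<exists>D>0. ((\<lambda>r. 1 - W r) has_real_derivative D) (at z within {0..R})" by blast
  qed
  then show ?thesis by simp
qed

text \<open>The barrier C exp (r^2), C = 3 s + 1, is adapted to the nonlocal term: U \<le> C exp
  (t^2) before z integrates to 2 z^2 J 1 U \<le> C (exp (z^2) - 1). At a first contact the terms of
  size C exp (z^2) cancel and at least C - 3 s = 1 remains.\<close>

lemma sol_U_bound:
  assumes sol: "sol R s U W V" and s: "s > 0" and r: "r \<in> {0..R}"
  shows "U r < (3 * s + 1) * exp (r\<^sup>2)" "2 * (r\<^sup>2 * J 1 U r) \<le> (3 * s + 1) * (exp (r\<^sup>2) - 1)"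
proof -
  define C where "C = 3 * s + 1"
  note c = sol_continuous[OF sol]
  have h: "2 * (z\<^sup>2 * J 1 U z) \<le> C * (exp (z\<^sup>2) - 1)"
    if z: "z \<in> {0..R}" and le: "\<And>t. t \<in> {0..<z} \<Longrightarrow> U t \<le> C * exp (t\<^sup>2)" for z
  proof -
    let ?f = "\<lambda>r. C * exp (r\<^sup>2) - 2 * (r\<^sup>2 * J 1 U r)"
    have sz: "continuous_on {0..z} U" using c(1) z by (auto intro: continuous_on_subset)
    have "?f 0 \<le> ?f z"
    proof (rule DERIV_nonneg_imp_increasing_open[where f = ?f])
      show "continuous_on {0..z} ?f" by (intro continuous_intros continuous_on_J sz)
      fix t assume t: "0 < t" "t < z"
      have D1: "((\<lambda>r. C * exp (r\<^sup>2)) has_real_derivative 2 * t * (C * exp (t\<^sup>2))) (at t)"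
        by (auto intro!: derivative_eq_intros)
      have D2: "((\<lambda>r. r\<^sup>2 * J 1 U r) has_real_derivative t * U t) (at t)"
        using sol_derivs(4)[OF sol, of t] t z at_within_Icc_at[of 0 t R] by simp
      have "(?f has_real_derivative 2 * t * (C * exp (t\<^sup>2)) - 2 * (t * U t)) (at t)"
        by (rule DERIV_diff[OF D1 DERIV_cmult[OF D2]])
      moreover have "2 * t * (C * exp (t\<^sup>2)) - 2 * (t * U t) \<ge> 0"
        using mult_left_mono[OF le, of t "2 * t"] t by simp
      ultimately show "\<exists>y. (?f has_real_derivative y) (at t) \<and> 0 \<le> y" by blast
    qed (use z in auto)
    then show ?thesis by (simp add: algebra_simps)
  qed
  have *: "C * exp (r\<^sup>2) - U r > 0" if r: "r \<in> {0..R}" for r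
  proof (rule positive_barrier[OF _ _ r])
    show "continuous_on {0..R} (\<lambda>r. C * exp (r\<^sup>2) - U r)" by (intro continuous_intros c)
    show "C * exp (0\<^sup>2) - U 0 > 0" using sol_at_0(1)[OF sol] r s by (simp add: C_def)
    fix z assume z: "z \<in> {0<..R}" "C * exp (z\<^sup>2) - U z = 0" "\<And>t. t \<in> {0..<z} \<Longrightarrow> C * exp (t\<^sup>2) - U t > 0"
    define D where "D = 2 * z * (C * exp (z\<^sup>2)) - (GU s U (\<lambda>t. N1 (U t) (W t) (V t)) z - 3 * U z) / z"
    define P where "P = (2 + z\<^sup>2 * (U z + W z + 2 * V z)) * U z"
    have z': "z \<in> {0..R}" "z > 0" using z by auto
    have hz: "2 * (z\<^sup>2 * J 1 U z) \<le> C * exp (z\<^sup>2) - C"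
      using h[OF z'(1)] z(3) by (force simp: right_diff_distrib)
    have "0 \<le> P"
      using sol_rx_pos[OF sol s z'(1)] sol_pos(1)[OF sol s z'(1)] by (simp add: P_def)
    moreover have "z * D = 2 * z\<^sup>2 * (C * exp (z\<^sup>2)) - 3 * s - 2 * (z\<^sup>2 * J 1 U z) + P + U z"
      using z' by (simp add: D_def P_def GU_def N1_def field_simps power2_eq_square)
    moreover have "2 * z\<^sup>2 * (C * exp (z\<^sup>2)) \<ge> 0" using s by (simp add: C_def)
    ultimately have "z * D \<ge> C - 3 * s"
      using hz z(2) by argo
    then have "z * D > 0" by (simp add: C_def)
    then have "D > 0" using z' by (simp add: zero_less_mult_iff)
    moreover have "((\<lambda>r. C * exp (r\<^sup>2) - U r) has_real_derivative D) (at z within {0..R})"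
      unfolding D_def by (auto intro!: derivative_eq_intros sol_derivs(1)[OF sol z(1)])
    ultimately show "\<exists>D>0. ((\<lambda>r. C * exp (r\<^sup>2) - U r) has_real_derivative D) (at z within {0..R})" by blast
  qed
  show "U r < (3 * s + 1) * exp (r\<^sup>2)" using *[OF r] by (simp add: C_def)
  show "2 * (r\<^sup>2 * J 1 U r) \<le> (3 * s + 1) * (exp (r\<^sup>2) - 1)"
    using h[OF r] *[of] r unfolding C_def by (smt (verit) atLeastAtMost_iff atLeastLessThan_iff)
qed

text \<open>With M = (3 s + 1) exp (R^2), a bound for U, this is 3 s + 2 (M + 1) + R^2 (M + 1)^2. It
  is chosen so that the linear term - 3 V decides the sign of V' when |V| reaches this
  level.\<close>

definition bd :: "real \<Rightarrow> real \<Rightarrow> real" where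
  "bd s R = 3 * s + 2 * ((3 * s + 1) * exp (R\<^sup>2) + 1) + R\<^sup>2 * ((3 * s + 1) * exp (R\<^sup>2) + 1)\<^sup>2"

lemma bd_mono: "0 < s \<Longrightarrow> s \<le> S \<Longrightarrow> bd s R \<le> bd S R"
  unfolding bd_def
  by (intro add_mono mult_left_mono power_mono mult_right_mono) (auto intro: add_nonneg_nonneg)

text \<open>At V = C the part C (U + W) - C^2 is harmless, as C exceeds U + W. At V = - C the term -
  r^2 C^2 points the wrong way; but 1 + r^2 V > 0 gives r^2 C \<le> 1 there, so it costs at most C
  and loses against 3 C. Strictness of the bounds is what lets \<open>sol_exists_on\<close> remove
  the truncation.\<close>

lemma sol_bounds:
  assumes sol: "sol R s U W V" and s: "s > 0" and r: "r \<in> {0..R}"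
  shows "\<bar>U r\<bar> < bd s R" "\<bar>W r\<bar> < bd s R" "\<bar>V r\<bar> < bd s R"
proof -
  define M where "M = (3 * s + 1) * exp (R\<^sup>2)"
  define C where "C = bd s R"
  note c = sol_continuous[OF sol]
  have R: "R \<ge> 0" using r by simp
  have M1: "M \<ge> 1" unfolding M_def using s mult_mono[of 1 "3 * s + 1" 1 "exp (R\<^sup>2)"] by simp
  have C: "C = 3 * s + 2 * (M + 1) + R\<^sup>2 * (M + 1)\<^sup>2" by (simp add: C_def bd_def M_def)
  define Q where "Q = R\<^sup>2 * (M + 1)\<^sup>2"
  note C = C[folded Q_def]
  have RM: "0 \<le> Q" by (simp add: Q_def)
  have CM: "C > M + 1" using C s M1 RM by simp
  have UM: "U t < M" "t\<^sup>2 * J 1 U t \<le> M" if t: "t \<in> {0..R}" for t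
  proof -
    have e: "exp (t\<^sup>2) \<le> exp (R\<^sup>2)" using t by (simp add: power_mono)
    have "(3 * s + 1) * exp (t\<^sup>2) \<le> M" unfolding M_def using e s by (intro mult_left_mono) auto
    moreover have "(3 * s + 1) * (exp (t\<^sup>2) - 1) = (3 * s + 1) * exp (t\<^sup>2) - (3 * s + 1)"
      by (simp add: right_diff_distrib)
    ultimately show "U t < M" "t\<^sup>2 * J 1 U t \<le> M"
      using sol_U_bound[OF sol s t] sol_h_nonneg[OF sol s t] s by linarith+
  qed
  show "\<bar>U r\<bar> < bd s R" using sol_pos(1)[OF sol s r] UM(1)[OF r] CM by (simp add: C_def)
  show "\<bar>W r\<bar> < bd s R" using sol_pos(2)[OF sol s r] sol_W_less_1[OF sol s r] CM M1 by (simp add: C_def)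
  have bounds: "0 < U z" "0 < W z" "U z + W z \<le> M + 1" "0 \<le> (U z)\<^sup>2 / 2 + U z * W z"
     "(U z)\<^sup>2 / 2 + U z * W z \<le> (M + 1)\<^sup>2" "0 \<le> z\<^sup>2 * J 1 U z" "z\<^sup>2 * J 1 U z \<le> M" "z\<^sup>2 \<le> R\<^sup>2"
     if z: "z \<in> {0..R}" for z
  proof -
    show p: "0 < U z" "0 < W z" using sol_pos[OF sol s z] by auto
    show q: "U z + W z \<le> M + 1" using UM[OF z] sol_W_less_1[OF sol s z] by simp
    show "0 \<le> (U z)\<^sup>2 / 2 + U z * W z" using p by simp
    have "(U z)\<^sup>2 / 2 + U z * W z \<le> (U z + W z)\<^sup>2" using p by (simp add: power2_eq_square algebra_simps)
    also have "\<dots> \<le> (M + 1)\<^sup>2" using p q by (intro power_mono) auto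
    finally show "(U z)\<^sup>2 / 2 + U z * W z \<le> (M + 1)\<^sup>2" .
    show "0 \<le> z\<^sup>2 * J 1 U z" by (rule sol_h_nonneg[OF sol s z])
    show "z\<^sup>2 * J 1 U z \<le> M" by (rule UM(2)[OF z])
    show "z\<^sup>2 \<le> R\<^sup>2" using z by (simp add: power_mono)
  qed
  let ?G = "\<lambda>z. GV s U W (\<lambda>t. N3 (U t) (W t) (V t)) z"
  have V0: "C - V 0 > 0" "C + V 0 > 0"
    using sol_at_0(3)[OF sol R] CM M1 s C RM by simp_all
  have "C - V r > 0"
  proof (rule positive_barrier[where f = "\<lambda>r. C - V r", OF _ V0(1) r])
    show "continuous_on {0..R} (\<lambda>r. C - V r)" by (intro continuous_intros c)
    fix z assume z: "z \<in> {0<..R}" "C - V z = 0"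
    have z': "z \<in> {0..R}" "z > 0" using z by auto
    note b = bounds[OF z'(1)]
    have "V z = C" using z by simp
    define Y where "Y = (U z)\<^sup>2 / 2 + U z * W z + C * (U z + W z) - C\<^sup>2"
    have "C * (U z + W z) - C\<^sup>2 = C * (U z + W z - C)" by (simp add: power2_eq_square algebra_simps)
    also have "\<dots> \<le> 0" using b CM M1 by (intro mult_nonneg_nonpos) auto
    finally have "Y \<le> (M + 1)\<^sup>2" using b by (simp add: Y_def)
    then have "z\<^sup>2 * Y \<le> z\<^sup>2 * (M + 1)\<^sup>2" by (intro mult_left_mono) auto
    also have "\<dots> \<le> Q" unfolding Q_def using b by (intro mult_right_mono) auto
    finally have "z\<^sup>2 * Y \<le> Q" .
    moreover have "?G z - 3 * V z = U z + W z - 3 * s / 2 - z\<^sup>2 * J 1 U z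
        + z\<^sup>2 * Y - 3 * C"
      by (simp add: GV_def N3_def \<open>V z = C\<close> Y_def)
    ultimately have "?G z - 3 * V z < 0" using b C s M1 RM by argo
    then have "- ((?G z - 3 * V z) / z) > 0" using z' by (simp add: divide_less_0_iff)
    moreover have "((\<lambda>r. C - V r) has_real_derivative - ((?G z - 3 * V z) / z)) (at z within {0..R})"
      by (auto intro!: derivative_eq_intros sol_derivs(3)[OF sol z(1)])
    ultimately show "\<exists>D>0. ((\<lambda>r. C - V r) has_real_derivative D) (at z within {0..R})" by blast
  qed
  moreover have "C + V r > 0"
  proof (rule positive_barrier[where f = "\<lambda>r. C + V r", OF _ V0(2) r])
    show "continuous_on {0..R} (\<lambda>r. C + V r)" by (intro continuous_intros c)
    fix z assume z: "z \<in> {0<..R}" "C + V z = 0"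
    have z': "z \<in> {0..R}" "z > 0" using z by auto
    note b = bounds[OF z'(1)]
    have V: "V z = - C" using z by simp
    have zC: "z\<^sup>2 * C \<le> 1" using sol_v_pos[OF sol s z'(1)] V by simp
    have 1: "z\<^sup>2 * C * (U z + W z) \<le> M + 1"
      using mult_mono[OF zC b(3)] b M1 by simp
    have 2: "z\<^sup>2 * C * C \<le> C"
      using mult_right_mono[OF zC, of C] CM M1 by simp
    have 3: "0 \<le> z\<^sup>2 * ((U z)\<^sup>2 / 2 + U z * W z)" using b by simp
    define Y1 Y2 Y3 where "Y1 = z\<^sup>2 * C * (U z + W z)" and "Y2 = z\<^sup>2 * C * C"
      and "Y3 = z\<^sup>2 * ((U z)\<^sup>2 / 2 + U z * W z)"
    note 1 = 1[folded Y1_def] and 2 = 2[folded Y2_def] and 3 = 3[folded Y3_def]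
    have "?G z - 3 * V z = U z + W z - 3 * s / 2 - z\<^sup>2 * J 1 U z + (Y3 - Y1 - Y2) + 3 * C"
      by (simp add: GV_def N3_def V power2_eq_square algebra_simps Y1_def Y2_def Y3_def)
    then have "?G z - 3 * V z > 0" using b C s M1 RM 1 2 3 by argo
    then have "(?G z - 3 * V z) / z > 0" using z' by simp
    moreover have "((\<lambda>r. C + V r) has_real_derivative (?G z - 3 * V z) / z) (at z within {0..R})"
      by (auto intro!: derivative_eq_intros sol_derivs(3)[OF sol z(1)])
    ultimately show "\<exists>D>0. ((\<lambda>r. C + V r) has_real_derivative D) (at z within {0..R})" by blast
  qed
  ultimately show "\<bar>V r\<bar> < bd s R" by (simp add: C_def abs_less_iff)
qed

section \<open>Uniqueness and global existence for the regularised equations\<close>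

lemma sol_unique:
  assumes "sol R s U W V" "sol R s U' W' V'" "s > 0" "r \<in> {0..R}"
  shows "U r = U' r" "W r = W' r" "V r = V' r"
proof -
  have b1: "\<bar>U t\<bar> \<le> bd s R \<and> \<bar>W t\<bar> \<le> bd s R \<and> \<bar>V t\<bar> \<le> bd s R" if "t \<in> {0..R}" for t
    using sol_bounds[OF assms(1,3) that] by simp
  have b2: "\<bar>U' t\<bar> \<le> bd s R \<and> \<bar>W' t\<bar> \<le> bd s R \<and> \<bar>V' t\<bar> \<le> bd s R" if "t \<in> {0..R}" for t
    using sol_bounds[OF assms(2,3) that] by simp
  show "U r = U' r" "W r = W' r" "V r = V' r"
    using sol_dependence[OF assms(1,2) b1 b2 assms(4)] by simp_all
qed

lemma sol_cong:
  assumes "sol R s U W V" "\<And>t. t \<in> {0..R} \<Longrightarrow> U t = U' t \<and> W t = W' t \<and> V t = V' t"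
  shows "sol R s U' W' V'"
  unfolding sol_def
proof (intro conjI ballI)
  show "continuous_on {0..R} U'" "continuous_on {0..R} W'" "continuous_on {0..R} V'"
    by (rule continuous_on_eq[OF sol_continuous(1)[OF assms(1)]]
        continuous_on_eq[OF sol_continuous(2)[OF assms(1)]]
        continuous_on_eq[OF sol_continuous(3)[OF assms(1)]]; simp add: assms(2))+
  fix r assume r: "r \<in> {0..R}"
  then have *: "t \<in> {0..R}" if "t \<in> {0..r}" for t using that by auto
  have J1: "J 1 U t = J 1 U' t" if "t \<in> {0..r}" for t
    using assms(2) that r by (intro J_cong) auto
  have "GU s U (\<lambda>t. N1 (U t) (W t) (V t)) t = GU s U' (\<lambda>t. N1 (U' t) (W' t) (V' t)) t"
    "GW (\<lambda>t. N2 (U t) (W t) (V t)) t = GW (\<lambda>t. N2 (U' t) (W' t) (V' t)) t"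
    "GV s U W (\<lambda>t. N3 (U t) (W t) (V t)) t = GV s U' W' (\<lambda>t. N3 (U' t) (W' t) (V' t)) t"
    if "t \<in> {0..r}" for t
    unfolding GU_def GW_def GV_def J1[OF that] using assms(2)[OF *[OF that]] by simp_all
  then have "J 2 (GU s U (\<lambda>t. N1 (U t) (W t) (V t))) r = J 2 (GU s U' (\<lambda>t. N1 (U' t) (W' t) (V' t))) r"
    "J 2 (GW (\<lambda>t. N2 (U t) (W t) (V t))) r = J 2 (GW (\<lambda>t. N2 (U' t) (W' t) (V' t))) r"
    "J 2 (GV s U W (\<lambda>t. N3 (U t) (W t) (V t))) r = J 2 (GV s U' W' (\<lambda>t. N3 (U' t) (W' t) (V' t))) r"
    using r by (intro J_cong; auto)+
  then show "U' r = J 2 (GU s U' (\<lambda>t. N1 (U' t) (W' t) (V' t))) r"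
    "W' r = J 2 (GW (\<lambda>t. N2 (U' t) (W' t) (V' t))) r"
    "V' r = J 2 (GV s U' W' (\<lambda>t. N3 (U' t) (W' t) (V' t))) r"
    using sol_eqs[OF assms(1) r] assms(2)[OF r] by metis+
qed

text \<open>The truncation at \<open>B = bd s R\<close> is inactive until a component reaches size
  \<open>B\<close>. Up to a first such time the truncated solution is a true one, and
  \<open>sol_bounds\<close> keeps it strictly below \<open>B\<close>, a contradiction.\<close>

lemma sol_exists_on:
  assumes s: "s > 0" and R: "R \<ge> 0"
  obtains U W V where "sol R s U W V"
proof -
  define B where "B = bd s R"
  define M where "M = (3 * s + 1) * exp (R\<^sup>2)"
  have "0 \<le> R\<^sup>2 * (M + 1)\<^sup>2" "0 < M" using s by (auto simp: M_def)
  moreover have "B = 3 * s + 2 * (M + 1) + R\<^sup>2 * (M + 1)\<^sup>2" by (simp add: B_def bd_def M_def)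
  ultimately have B: "B > s + 1" using s by argo
  then have B0: "B \<ge> 0" using s by simp
  obtain U W V where c: "continuous_on {0..R} U" "continuous_on {0..R} W" "continuous_on {0..R} V"
    and e: "\<And>r. r \<in> {0..R} \<Longrightarrow> U r = J 2 (GU s U (\<lambda>t. N1 (clip B (U t)) (clip B (W t)) (clip B (V t)))) r"
    "\<And>r. r \<in> {0..R} \<Longrightarrow> W r = J 2 (GW (\<lambda>t. N2 (clip B (U t)) (clip B (W t)) (clip B (V t)))) r"
    "\<And>r. r \<in> {0..R} \<Longrightarrow> V r = J 2 (GV s U W (\<lambda>t. N3 (clip B (U t)) (clip B (W t)) (clip B (V t)))) r"
    by (rule clipped_solution_exists[OF R B0]) (rule that)
  have sol: "sol r s U W V" if r: "r \<in> {0..R}" and b: "\<And>t. t \<in> {0..r} \<Longrightarrow> \<bar>U t\<bar> \<le> B \<and> \<bar>W t\<bar> \<le> B \<and> \<bar>V t\<bar> \<le> B" for r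
    unfolding sol_def
  proof (intro conjI ballI)
    show "continuous_on {0..r} U" "continuous_on {0..r} W" "continuous_on {0..r} V"
      using c r by (auto intro: continuous_on_subset)
    fix t assume t: "t \<in> {0..r}"
    then have tR: "t \<in> {0..R}" and t0: "t \<ge> 0" using r by auto
    have b': "clip B (U u) = U u" "clip B (W u) = W u" "clip B (V u) = V u" if "u \<in> {0..t}" for u
      using b[of u] that t by (auto simp: clip_eq)
    show "U t = J 2 (GU s U (\<lambda>t. N1 (U t) (W t) (V t))) t"
      by (subst e(1)[OF tR], rule J_cong) (use b' t0 in \<open>auto simp: GU_def\<close>)
    show "W t = J 2 (GW (\<lambda>t. N2 (U t) (W t) (V t))) t"
      by (subst e(2)[OF tR], rule J_cong) (use b' t0 in \<open>auto simp: GW_def\<close>)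
    show "V t = J 2 (GV s U W (\<lambda>t. N3 (U t) (W t) (V t))) t"
      by (subst e(3)[OF tR], rule J_cong) (use b' t0 in \<open>auto simp: GV_def\<close>)
  qed
  define f where "f t = B - max \<bar>U t\<bar> (max \<bar>W t\<bar> \<bar>V t\<bar>)" for t
  have f: "continuous_on {0..R} f" unfolding f_def using c by (intro continuous_intros)
  have 0: "(0::real) \<in> {0..R}" using R by simp
  have U0: "U 0 = s" by (subst e(1)[OF 0]) (simp add: J_0 GU_def)
  have W0: "W 0 = 1 / 3" by (subst e(2)[OF 0]) (simp add: J_0 GW_def)
  have V0: "V 0 = (1 / 3 - s / 2) / 3" by (subst e(3)[OF 0]) (simp add: J_0 GV_def U0 W0 field_simps)
  have "f 0 > 0" using B s by (simp add: f_def U0 W0 V0)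
  have "f r > 0" if r: "r \<in> {0..R}" for r
  proof (rule ccontr)
    assume "\<not> f r > 0"
    then have le: "f r \<le> 0" by simp
    obtain z where z: "z \<in> {0<..R}" "f z = 0" "\<And>t. t \<in> {0..<z} \<Longrightarrow> f t > 0"
      by (rule first_zero[OF f \<open>f 0 > 0\<close> r le]) (rule that)
    have zR: "z \<in> {0..R}" "z \<in> {0..z}" using z by auto
    have "f t \<ge> 0" if "t \<in> {0..z}" for t using z(2) z(3)[of t] that by (cases "t = z") auto
    then have "sol z s U W V" using zR by (intro sol) (force simp: f_def)+
    from sol_bounds[OF this s zR(2)]
    have "max \<bar>U z\<bar> (max \<bar>W z\<bar> \<bar>V z\<bar>) < bd s z" by auto
    also have "bd s z \<le> B" unfolding B_def bd_def using s zR
      by (intro add_mono mult_mono power_mono) (auto simp: power_mono)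
    finally show False using z(2) unfolding f_def by linarith
  qed
  then have "sol R s U W V" using R by (intro sol) (force simp: f_def)+
  then show thesis using that by blast
qed

lemma sol_exists:
  assumes s: "s > 0"
  shows "\<exists>U W V. \<forall>R\<ge>0. sol R s U W V"
proof -
  have "\<forall>n. \<exists>Y. sol (real n) s (fst Y) (fst (snd Y)) (snd (snd Y))"
    using sol_exists_on[OF s] by (metis fst_conv snd_conv of_nat_0_le_iff)
  then obtain Y where Y: "\<And>n. sol (real n) s (fst (Y n)) (fst (snd (Y n))) (snd (snd (Y n)))"
    by metis
  \<comment> \<open>Solutions on the intervals [0, n] agree on overlaps by uniqueness; the value at
    \<open>r\<close> is read from the one whose end point is \<open>r\<close> rounded up.\<close>
  define U W V where "U r = fst (Y (nat \<lceil>r\<rceil>)) r" and "W r = fst (snd (Y (nat \<lceil>r\<rceil>))) r"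
    and "V r = snd (snd (Y (nat \<lceil>r\<rceil>))) r" for r
  have "sol R s U W V" if "R \<ge> 0" for R
  proof (rule sol_cong)
    show "sol R s (fst (Y (nat \<lceil>R\<rceil>))) (fst (snd (Y (nat \<lceil>R\<rceil>)))) (snd (snd (Y (nat \<lceil>R\<rceil>))))"
      using that by (intro sol_mono[OF Y]) (simp add: real_nat_ceiling_ge)
    fix t assume t: "t \<in> {0..R}"
    have le: "real (nat \<lceil>t\<rceil>) \<le> real (nat \<lceil>R\<rceil>)" using t by (simp add: ceiling_mono nat_mono)
    have tt: "t \<in> {0..real (nat \<lceil>t\<rceil>)}" using t by (simp add: real_nat_ceiling_ge)
    from sol_unique[OF sol_mono[OF Y[of "nat \<lceil>R\<rceil>"] le] Y[of "nat \<lceil>t\<rceil>"] s tt]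
    show "fst (Y (nat \<lceil>R\<rceil>)) t = U t \<and> fst (snd (Y (nat \<lceil>R\<rceil>))) t = W t \<and> snd (snd (Y (nat \<lceil>R\<rceil>))) t = V t"
      by (simp add: U_def W_def V_def)
  qed
  then show ?thesis by blast
qed

lemma positive_barrier_from:
  fixes f :: "real \<Rightarrow> real"
  assumes f: "continuous_on {a..b} f" "f a > 0" and r: "r \<in> {a..b}"
    and D: "\<And>z. \<lbrakk>z \<in> {a<..b}; f z = 0; \<And>t. t \<in> {a..<z} \<Longrightarrow> f t > 0\<rbrakk> \<Longrightarrow>
       \<exists>D>0. (f has_real_derivative D) (at z)"
  shows "f r > 0"
proof -
  have "f ((r - a) + a) > 0"
  proof (rule positive_barrier[where f = "\<lambda>t. f (t + a)" and R = "b - a"])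
    show "continuous_on {0..b - a} (\<lambda>t. f (t + a))"
      by (intro continuous_on_compose2[OF f(1)] continuous_intros) auto
    fix z assume z: "z \<in> {0<..b - a}" "f (z + a) = 0" "\<And>t. t \<in> {0..<z} \<Longrightarrow> f (t + a) > 0"
    have "\<exists>D>0. (f has_real_derivative D) (at (z + a))"
    proof (rule D)
      show "f t > 0" if "t \<in> {a..<z + a}" for t using z(3)[of "t - a"] that by auto
    qed (use z in auto)
    then obtain D where "D > 0" "(f has_real_derivative D) (at (z + a))" by blast
    then show "\<exists>D>0. ((\<lambda>t. f (t + a)) has_real_derivative D) (at z within {0..b - a})"
      using DERIV_shift[of f D z a] has_field_derivative_at_within by blast
  qed (use f r in auto)
  then show ?thesis by simp
qed

text \<open>Multiplied by the integrating factor, \<open>y\<close> is strictly increasing from a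
  nonnegative value.\<close>

lemma linear_ode_sign:
  fixes y c g :: "real \<Rightarrow> real"
  assumes y: "continuous_on {0..R} y" "y 0 \<ge> 0" and c: "continuous_on {0..R} c"
    and D: "\<And>t. \<lbrakk>0 < t; t < R\<rbrakk> \<Longrightarrow> (y has_real_derivative c t * y t + g t) (at t)"
    and g: "\<And>t. \<lbrakk>0 < t; t < R\<rbrakk> \<Longrightarrow> g t > 0" and R: "R > 0"
  shows "y R > 0"
proof -
  define I where "I t = integral {0..t} c" for t
  define E where "E t = exp (- I t) * y t" for t
  have I: "(I has_real_derivative c t) (at t within {0..R})" if "t \<in> {0..R}" for t
    unfolding I_def by (rule integral_has_real_derivative[OF c that])
  have "continuous_on {0..R} I"
    by (rule DERIV_continuous_on[OF I])
  then have cE: "continuous_on {0..R} E" unfolding E_def by (intro continuous_intros y(1))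
  have "E 0 < E R"
  proof (rule DERIV_pos_imp_increasing_open[OF R _ cE])
    fix t assume t: "0 < t" "t < R"
    have "(I has_real_derivative c t) (at t)" using I[of t] t at_within_Icc_at[of 0 t R] by simp
    then have "(E has_real_derivative exp (- I t) * g t) (at t)"
      unfolding E_def
      by (auto intro!: derivative_eq_intros D[OF t] simp: algebra_simps)
    moreover have "exp (- I t) * g t > 0" using g[OF t] by simp
    ultimately show "\<exists>y. (E has_real_derivative y) (at t) \<and> 0 < y" by blast
  qed
  moreover have "E 0 \<ge> 0" using y(2) by (simp add: E_def)
  ultimately have "exp (- I R) * y R > 0" by (simp add: E_def)
  then show ?thesis by (simp add: zero_less_mult_iff)
qed

text \<open>In terms of a soliton, \<open>h = - f\<close>, \<open>gW = ln (a / a0)\<close>, \<open>gV = ln (b / r)\<close>, \<open>u = - f'\<close>, \<open>w = a' / a\<close>,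
  \<open>v = b' / b\<close>, \<open>K = 1 / b\<^sup>2\<close> and \<open>p = b'\<close>.\<close>
locale flow =
  fixes s :: real and U W V :: "real \<Rightarrow> real"
  assumes s_pos: "s > 0" and sol: "\<And>R. R \<ge> 0 \<Longrightarrow> sol R s U W V"
begin

definition h where "h r = r\<^sup>2 * J 1 U r"
definition gW where "gW r = r\<^sup>2 * J 1 W r"
definition gV where "gV r = r\<^sup>2 * J 1 V r"
definition u where "u r = r * U r"
definition w where "w r = r * W r"
definition v where "v r = 1 / r + r * V r"
text \<open>a' / a + 2 b' / b - f', the logarithmic derivative of the weighted volume density; it is
  the damping coefficient in the equations of u, w and v. Its regular part is r times
  \<open>ch\<close>: x = 2 / r + r ch.\<close>

definition x where "x r = u r + w r + 2 * v r"
definition K where "K r = exp (- 2 * gV r) / r\<^sup>2"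
definition b where "b r = r * exp (gV r)"
definition p where "p r = (1 + r\<^sup>2 * V r) * exp (gV r)"
definition ch where "ch r = U r + W r + 2 * V r"

lemma cont_regular:
  "continuous_on {0..R} U" "continuous_on {0..R} W" "continuous_on {0..R} V"
  "continuous_on {0..R} h" "continuous_on {0..R} gW" "continuous_on {0..R} gV" "continuous_on {0..R} ch"
proof -
  have "continuous_on {0..\<bar>R\<bar>} U" "continuous_on {0..\<bar>R\<bar>} W" "continuous_on {0..\<bar>R\<bar>} V"
    using sol_continuous[OF sol[of "\<bar>R\<bar>"]] by auto
  then show c: "continuous_on {0..R} U" "continuous_on {0..R} W" "continuous_on {0..R} V"
    by (auto elim: continuous_on_subset)
  show "continuous_on {0..R} h" "continuous_on {0..R} gW" "continuous_on {0..R} gV" "continuous_on {0..R} ch"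
    unfolding h_def gW_def gV_def ch_def by (intro continuous_intros continuous_on_J c; simp)+
qed

lemma at_0: "U 0 = s" "W 0 = 1 / 3" "V 0 = (1 / 3 - s / 2) / 3" "h 0 = 0" "gV 0 = 0" "gW 0 = 0"
  using sol_at_0[OF sol[of 0]] by (auto simp: h_def gV_def gW_def)

lemma positive:
  assumes "r > 0"
  shows "U r > 0" "W r > 0" "u r > 0" "w r > 0" "v r > 0" "x r > 0" "K r > 0" "b r > 0" "h r \<ge> 0" "p r > 0"
proof -
  have r: "r \<in> {0..r}" and rr: "r \<ge> 0" using assms by auto
  show UW: "U r > 0" "W r > 0" using sol_pos[OF sol[OF rr] s_pos r] by auto
  then show uw: "u r > 0" "w r > 0" using assms by (simp_all add: u_def w_def)
  have y: "1 + r\<^sup>2 * V r > 0" using sol_v_pos[OF sol[OF rr] s_pos r] .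
  have "v r = (1 + r\<^sup>2 * V r) / r" using assms by (simp add: v_def field_simps power2_eq_square)
  then show vp: "v r > 0" using y assms by simp
  show "x r > 0" using uw vp by (simp add: x_def)
  show "K r > 0" "b r > 0" using assms by (simp_all add: K_def b_def)
  show "h r \<ge> 0" using sol_h_nonneg[OF sol[OF rr] s_pos r] by (simp add: h_def)
  show "p r > 0" using y by (simp add: p_def)
qed

lemma k2_K: "r > 0 \<Longrightarrow> k2 s U W V r = r\<^sup>2 * K r"
  using k2_eq[OF sol[of r], of r] by (simp add: K_def gV_def)

lemma b_K: "r > 0 \<Longrightarrow> K r * (b r)\<^sup>2 = 1"
  by (simp add: K_def b_def power_mult_distrib exp_minus field_simps exp_double[symmetric] flip: exp_of_nat_mult)

lemma x_chi: "r > 0 \<Longrightarrow> x r - 2 / r = r * ch r"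
  by (simp add: x_def u_def w_def v_def ch_def algebra_simps)

text \<open>The definition of \<open>k2\<close> solved for x^2, with 1 / b^2 put back by
  \<open>k2_eq\<close>: the conservation law of gradient solitons in these variables.\<close>

lemma x_square: "r > 0 \<Longrightarrow> (x r)\<^sup>2 = (w r)\<^sup>2 + 2 * (v r)\<^sup>2 + 2 * K r + 2 + 2 * h r + 3 * s"
proof -
  assume r: "r > 0"
  have a: "2 + r\<^sup>2 * (U r + W r + 2 * V r) = r * x r"
    using r by (simp add: x_def u_def w_def v_def power2_eq_square field_simps)
  have bb: "1 + r\<^sup>2 * V r = r * v r"
    using r by (simp add: v_def power2_eq_square field_simps)
  have c: "r ^ 4 * (W r)\<^sup>2 = r\<^sup>2 * (w r)\<^sup>2"
    by (simp add: w_def power2_eq_square power4_eq_xxxx)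
  have "r\<^sup>2 * K r = ((r * x r)\<^sup>2 - r\<^sup>2 * (w r)\<^sup>2 - 2 * (r * v r)\<^sup>2 - r\<^sup>2 * (2 + 2 * h r + 3 * s)) / 2"
    using k2_K[OF r] unfolding k2_def a bb c h_def by simp
  then have "r\<^sup>2 * (2 * K r) = r\<^sup>2 * ((x r)\<^sup>2 - (w r)\<^sup>2 - 2 * (v r)\<^sup>2 - (2 + 2 * h r + 3 * s))"
    by (simp add: power_mult_distrib algebra_simps)
  then have "2 * K r = (x r)\<^sup>2 - (w r)\<^sup>2 - 2 * (v r)\<^sup>2 - (2 + 2 * h r + 3 * s)"
    using r by simp
  then show ?thesis by simp
qed

lemma derivs:
  assumes r: "r > 0"
  shows "(h has_real_derivative u r) (at r)"
    "(gV has_real_derivative r * V r) (at r)"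
    "(gW has_real_derivative w r) (at r)"
    "(u has_real_derivative 2 * h r + 3 * s - x r * u r) (at r)"
    "(w has_real_derivative 1 - x r * w r) (at r)"
    "(v has_real_derivative 1 + K r - x r * v r) (at r)"
    "(K has_real_derivative - 2 * v r * K r) (at r)"
    "(b has_real_derivative p r) (at r)"
    "p r = v r * b r"
    "(x has_real_derivative 1 - (w r)\<^sup>2 - 2 * (v r)\<^sup>2) (at r)"
proof -
  have rR: "r \<in> {0<..r + 1}" and at: "at r within {0..r + 1} = at r"
    using r by (auto intro: at_within_Icc_at)
  note D = sol_derivs[OF sol rR, unfolded at]
  have r1: "r + 1 \<ge> 0" using r by simp
  let ?gu = "GU s U (\<lambda>t. N1 (U t) (W t) (V t)) r" and ?gw = "GW (\<lambda>t. N2 (U t) (W t) (V t)) r"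
    and ?gv = "GV s U W (\<lambda>t. N3 (U t) (W t) (V t)) r"
  show dh: "(h has_real_derivative u r) (at r)" using D(4)[OF r1] by (simp add: h_def[abs_def] u_def)
  show dg: "(gV has_real_derivative r * V r) (at r)" using D(5)[OF r1] by (simp add: gV_def[abs_def])
  show "(gW has_real_derivative w r) (at r)" using D(6)[OF r1] by (simp add: gW_def[abs_def] w_def)
  have c: "y / r * r = y" for y using r by simp
  have x': "x r * r = 2 + r\<^sup>2 * (U r + W r + 2 * V r)"
    using r by (simp add: x_def u_def w_def v_def power2_eq_square field_simps)
  have du: "(u has_real_derivative 1 * U r + (?gu - 3 * U r) / r * r) (at r)"
    unfolding u_def[abs_def] by (rule DERIV_mult[OF DERIV_ident D(1)[OF r1]])
  have "x r * u r = (x r * r) * U r" by (simp add: u_def)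
  then have "1 * U r + (?gu - 3 * U r) / r * r = 2 * h r + 3 * s - x r * u r"
    unfolding x' c by (simp add: GU_def N1_def h_def algebra_simps)
  with du show du: "(u has_real_derivative 2 * h r + 3 * s - x r * u r) (at r)" by (simp only:)
  have dw: "(w has_real_derivative 1 * W r + (?gw - 3 * W r) / r * r) (at r)"
    unfolding w_def[abs_def] by (rule DERIV_mult[OF DERIV_ident D(2)[OF r1]])
  have "x r * w r = (x r * r) * W r" by (simp add: w_def)
  then have "1 * W r + (?gw - 3 * W r) / r * r = 1 - x r * w r"
    unfolding x' c by (simp add: GW_def N2_def algebra_simps)
  with dw show dw: "(w has_real_derivative 1 - x r * w r) (at r)" by (simp only:)
  have "((\<lambda>r. 1 / r) has_real_derivative - (1 / r\<^sup>2)) (at r)"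
    using r by (auto intro!: derivative_eq_intros simp: power2_eq_square)
  from DERIV_add[OF this DERIV_mult[OF DERIV_ident D(3)[OF r1]]]
  have dv: "(v has_real_derivative - (1 / r\<^sup>2) + (1 * V r + (?gv - 3 * V r) / r * r)) (at r)"
    unfolding v_def[abs_def] .
  have rv: "r * v r = 1 + r\<^sup>2 * V r" using r by (simp add: v_def power2_eq_square field_simps)
  have "r\<^sup>2 * (?gv - V r) = r\<^sup>2 + r\<^sup>2 * K r - (1 + r\<^sup>2 * (U r + W r + 2 * V r)) * (1 + r\<^sup>2 * V r)"
    using k2_V_identity[OF k2_def[of s U W V r]] k2_K[OF r] by (simp add: GV_def N3_def)
  then have "r\<^sup>2 * (- (1 / r\<^sup>2) + (1 * V r + (?gv - 3 * V r) / r * r))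
     = r\<^sup>2 + r\<^sup>2 * K r - (x r * r) * (r * v r)"
    using r unfolding x' rv c by (simp add: algebra_simps)
  also have "\<dots> = r\<^sup>2 * (1 + K r - x r * v r)" by (simp add: power2_eq_square algebra_simps)
  finally have "- (1 / r\<^sup>2) + (1 * V r + (?gv - 3 * V r) / r * r) = 1 + K r - x r * v r"
    using r by simp
  with dv show dv: "(v has_real_derivative 1 + K r - x r * v r) (at r)" by (simp only:)
  have "((\<lambda>r. exp (- 2 * gV r) / r\<^sup>2) has_real_derivative
      (exp (- 2 * gV r) * (- 2 * (r * V r)) * r\<^sup>2 - exp (- 2 * gV r) * (2 * r)) / (r\<^sup>2 * r\<^sup>2)) (at r)"
    using r by (auto intro!: derivative_eq_intros dg)
  moreover have "(exp (- 2 * gV r) * (- 2 * (r * V r)) * r\<^sup>2 - exp (- 2 * gV r) * (2 * r)) / (r\<^sup>2 * r\<^sup>2)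
     = - 2 * v r * K r"
    using r by (simp add: v_def K_def field_simps power2_eq_square)
  ultimately show "(K has_real_derivative - 2 * v r * K r) (at r)" by (simp add: K_def[abs_def])
  show "(b has_real_derivative p r) (at r)"
    unfolding b_def[abs_def] p_def
    by (auto intro!: derivative_eq_intros dg simp: algebra_simps power2_eq_square)
  show "p r = v r * b r" using rv by (simp add: p_def b_def mult_ac)
  have "(x has_real_derivative (2 * h r + 3 * s - x r * u r) + (1 - x r * w r) + 2 * (1 + K r - x r * v r)) (at r)"
    unfolding x_def[abs_def] using du dw dv unfolding x_def
    by (intro DERIV_add DERIV_cmult)
  moreover have "(2 * h r + 3 * s - x r * u r) + (1 - x r * w r) + 2 * (1 + K r - x r * v r)
     = 1 - (w r)\<^sup>2 - 2 * (v r)\<^sup>2"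
  proof -
    \<comment> \<open>The damping terms add up to x^2, and the conservation law then removes h, K
      and s from the sum.\<close>
    have "x r * u r + x r * w r + 2 * (x r * v r) = (x r)\<^sup>2"
      by (simp add: x_def power2_eq_square algebra_simps)
    then show ?thesis using x_square[OF r] by (simp add: algebra_simps)
  qed
  ultimately show "(x has_real_derivative 1 - (w r)\<^sup>2 - 2 * (v r)\<^sup>2) (at r)" by (simp only:)
qed

text \<open>The integrating factor of all three quantities below is \<open>\<integral> x\<close>, singular like \<open>2 ln r\<close> at \<open>0\<close>;
  multiplication by \<open>r\<^sup>2\<close> removes the singularity.\<close>
lemma x_ode_sign:
  fixes y g :: "real \<Rightarrow> real"
  assumes y: "continuous_on {0..R} (\<lambda>r. r\<^sup>2 * y r)"
    and D: "\<And>t. 0 < t \<Longrightarrow> (y has_real_derivative g t - x t * y t) (at t)"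
    and g: "\<And>t. 0 < t \<Longrightarrow> g t > 0" and R: "R > 0"
  shows "y R > 0"
proof -
  have "R\<^sup>2 * y R > 0"
  proof (rule linear_ode_sign[where c = "\<lambda>r. - (r * ch r)" and g = "\<lambda>t. t\<^sup>2 * g t", OF y])
    show "continuous_on {0..R} (\<lambda>r. - (r * ch r))" by (intro continuous_intros cont_regular)
    fix t :: real assume t: "0 < t"
    have "((\<lambda>r. r\<^sup>2 * y r) has_real_derivative (2 * t) * y t + (g t - x t * y t) * t\<^sup>2) (at t)"
      by (rule DERIV_mult[OF _ D[OF t]]) (auto intro!: derivative_eq_intros)
    moreover have "(2 * t) * y t + (g t - x t * y t) * t\<^sup>2 = (2 / t - x t) * (t\<^sup>2 * y t) + t\<^sup>2 * g t"
      using t by (simp add: field_simps power2_eq_square)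
    moreover have "2 / t - x t = - (t * ch t)" using x_chi[OF t] by simp
    ultimately show "((\<lambda>r. r\<^sup>2 * y r) has_real_derivative - (t * ch t) * (t\<^sup>2 * y t) + t\<^sup>2 * g t) (at t)"
      by (simp only:)
    show "t\<^sup>2 * g t > 0" using g[OF t] t by simp
  qed (use R in auto)
  then show ?thesis using R by (simp add: zero_less_mult_iff)
qed

section \<open>Monotone quantities along the flow and the lower bound for b\<close>

lemma continuous_on_transfer:
  assumes "continuous_on {0..R} f" "\<And>r. r \<in> {0..R} \<Longrightarrow> f r = g r"
  shows "continuous_on {0..R} (g :: real \<Rightarrow> real)"
  using assms by (auto intro: continuous_on_eq)

text \<open>The quantity is u' = - f''. It solves y' = g - x y with g > 0, so the potential is
  strictly concave.\<close>

lemma u_increasing: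
  assumes "r > 0"
  shows "2 * h r + 3 * s - x r * u r > 0"
proof (rule x_ode_sign[where R = r and g = "\<lambda>t. (1 + (w t)\<^sup>2 + 2 * (v t)\<^sup>2) * u t", OF _ _ _ assms])
  show "continuous_on {0..r} (\<lambda>r. r\<^sup>2 * (2 * h r + 3 * s - x r * u r))"
  proof (rule continuous_on_transfer)
    show "continuous_on {0..r} (\<lambda>r. r\<^sup>2 * (2 * h r + 3 * s - (2 + r\<^sup>2 * ch r) * U r))"
      by (intro continuous_intros cont_regular)
    show "t\<^sup>2 * (2 * h t + 3 * s - (2 + t\<^sup>2 * ch t) * U t) = t\<^sup>2 * (2 * h t + 3 * s - x t * u t)"
      if "t \<in> {0..r}" for t
      using that by (cases "t = 0")
        (simp_all add: x_def u_def w_def v_def ch_def power2_eq_square field_simps)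
  qed
  fix t :: real assume t: "0 < t"
  note d = derivs[OF t]
  have "((\<lambda>a. 2 * h a + 3 * s - x a * u a) has_real_derivative
     2 * u t - ((1 - (w t)\<^sup>2 - 2 * (v t)\<^sup>2) * u t + (2 * h t + 3 * s - x t * u t) * x t)) (at t)"
    by (rule DERIV_diff DERIV_mult d | rule derivative_eq_intros d refl | simp)+
  then show "((\<lambda>a. 2 * h a + 3 * s - x a * u a) has_real_derivative
     (1 + (w t)\<^sup>2 + 2 * (v t)\<^sup>2) * u t - x t * (2 * h t + 3 * s - x t * u t)) (at t)"
    by (simp add: algebra_simps)
  show "(1 + (w t)\<^sup>2 + 2 * (v t)\<^sup>2) * u t > 0"
    using positive[OF t] by (simp add: add_pos_nonneg)
qed

text \<open>As K = 1 / b^2, the quotient v / (1 + K) = b b' / (b^2 + 1) is half the logarithmic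
  derivative of b^2 + 1, while w is half that of a^2. So b^2 + 1 grows faster than a^2 in relative
  terms.\<close>

lemma v_ge_w:
  assumes "r > 0"
  shows "v r > w r * (1 + K r)"
proof -
  have "v r - w r * (1 + K r) > 0"
  proof (rule x_ode_sign[where R = r and g = "\<lambda>t. 2 * v t * w t * K t", OF _ _ _ assms])
    show "continuous_on {0..r} (\<lambda>r. r\<^sup>2 * (v r - w r * (1 + K r)))"
    proof (rule continuous_on_transfer)
      show "continuous_on {0..r} (\<lambda>r. r + r ^ 3 * V r - r * W r * (r\<^sup>2 + exp (- 2 * gV r)))"
        by (intro continuous_intros cont_regular)
      show "t + t ^ 3 * V t - t * W t * (t\<^sup>2 + exp (- 2 * gV t)) = t\<^sup>2 * (v t - w t * (1 + K t))"
        if "t \<in> {0..r}" for t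
        using that by (cases "t = 0")
          (simp_all add: w_def v_def K_def power2_eq_square power3_eq_cube field_simps)
    qed
    fix t :: real assume t: "0 < t"
    note d = derivs[OF t]
    have "((\<lambda>a. v a - w a * (1 + K a)) has_real_derivative
      (1 + K t - x t * v t) - ((1 - x t * w t) * (1 + K t) + (- 2 * v t * K t) * w t)) (at t)"
      by (rule derivative_eq_intros d refl | simp)+
    then show "((\<lambda>a. v a - w a * (1 + K a)) has_real_derivative
       2 * v t * w t * K t - x t * (v t - w t * (1 + K t))) (at t)"
      by (simp add: algebra_simps)
    show "2 * v t * w t * K t > 0" using positive[OF t] by simp
  qed
  then show ?thesis by simp
qed

text \<open>u / (2 h + 3 s) is half the logarithmic derivative of 2 h + 3 s, so a^2 in turn outgrows
  2 h + 3 s.\<close>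

lemma u_le_w:
  assumes "r > 0"
  shows "u r < (2 * h r + 3 * s) * w r"
proof -
  have "(2 * h r + 3 * s) * w r - u r > 0"
  proof (rule x_ode_sign[where R = r and g = "\<lambda>t. 2 * u t * w t", OF _ _ _ assms])
    show "continuous_on {0..r} (\<lambda>r. r\<^sup>2 * ((2 * h r + 3 * s) * w r - u r))"
      unfolding w_def u_def by (intro continuous_intros cont_regular)
    fix t :: real assume t: "0 < t"
    note d = derivs[OF t]
    have "((\<lambda>a. (2 * h a + 3 * s) * w a - u a) has_real_derivative
      ((2 * u t) * w t + (1 - x t * w t) * (2 * h t + 3 * s)) - (2 * h t + 3 * s - x t * u t)) (at t)"
      by (rule derivative_eq_intros d refl | simp)+
    then show "((\<lambda>a. (2 * h a + 3 * s) * w a - u a) has_real_derivative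
       2 * u t * w t - x t * ((2 * h t + 3 * s) * w t - u t)) (at t)"
      by (simp add: algebra_simps)
    show "2 * u t * w t > 0" using positive[OF t] by simp
  qed
  then show ?thesis by simp
qed

text \<open>Chaining the two comparisons, (b^2 + 1) / (2 h + 3 s) is nondecreasing, and it starts
  from 1 / (3 s).\<close>

lemma b_lower_bound:
  assumes r: "r > 0"
  shows "2 * h r / (3 * s) \<le> (b r)\<^sup>2"
proof -
  define L where "L t = ln ((b t)\<^sup>2 + 1) - ln (2 * h t + 3 * s)" for t
  have nz: "(b t)\<^sup>2 + 1 > 0" "2 * h t + 3 * s > 0" if "t \<ge> 0" for t
    using positive(9)[of t] at_0(4) s_pos that by (cases "t = 0"; simp add: add_nonneg_pos)+
  have cb: "continuous_on {0..r} b" unfolding b_def by (intro continuous_intros cont_regular)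
  have "L 0 \<le> L r"
  proof (rule DERIV_nonneg_imp_increasing_open[where f = L])
    have "(b t)\<^sup>2 + 1 \<noteq> 0" "2 * h t + 3 * s \<noteq> 0" if "t \<in> {0..r}" for t
      using nz[of t] that by auto
    then show "continuous_on {0..r} L" unfolding L_def
      by (intro continuous_intros cb cont_regular) auto
    fix t assume t: "0 < t" "t < r"
    note d = derivs[OF t(1)] and ps = positive[OF t(1)]
    have n: "(b t)\<^sup>2 + 1 > 0" "2 * h t + 3 * s > 0" using nz[of t] t by auto
    define B where "B = (b t)\<^sup>2"
    have "((\<lambda>t. ln ((b t)\<^sup>2 + 1)) has_real_derivative 2 * b t * p t / ((b t)\<^sup>2 + 1)) (at t)"
      using n by (auto intro!: derivative_eq_intros d simp: field_simps)
    moreover have "((\<lambda>t. ln (2 * h t + 3 * s)) has_real_derivative 2 * u t / (2 * h t + 3 * s)) (at t)"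
      using n by (auto intro!: derivative_eq_intros d)
    ultimately have D: "(L has_real_derivative 2 * b t * p t / ((b t)\<^sup>2 + 1) - 2 * u t / (2 * h t + 3 * s)) (at t)"
      unfolding L_def by (rule DERIV_diff)
    have "2 * b t * p t / ((b t)\<^sup>2 + 1) = 2 * v t * B / (B + 1)"
      unfolding d(9) B_def by (simp add: power2_eq_square)
    also have "\<dots> \<ge> 2 * w t"
    proof -
      have "B * w t * (1 + K t) \<le> B * v t"
        using v_ge_w[OF t(1)] by (simp add: B_def mult.assoc mult_left_mono)
      moreover have "B * w t * (1 + K t) = w t * (B + 1)"
      proof -
        have "B * w t * (1 + K t) = w t * (B + K t * B)" by (simp add: algebra_simps)
        then show ?thesis using b_K[OF t(1)] by (simp add: B_def)
      qed
      ultimately have "w t * (B + 1) \<le> B * v t" by (simp only:)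
      from mult_left_mono[OF this, of 2] have "2 * w t * (B + 1) \<le> 2 * v t * B"
        by (simp add: mult_ac)
      moreover have "B + 1 > 0" using n(1) by (simp add: B_def)
      ultimately show ?thesis by (simp add: pos_le_divide_eq)
    qed
    moreover have "2 * u t / (2 * h t + 3 * s) \<le> 2 * w t"
      using u_le_w[OF t(1)] n(2) by (simp add: pos_divide_le_eq algebra_simps)
    ultimately have "0 \<le> 2 * b t * p t / ((b t)\<^sup>2 + 1) - 2 * u t / (2 * h t + 3 * s)" by linarith
    with D show "\<exists>y. (L has_real_derivative y) (at t) \<and> 0 \<le> y" by blast
  qed (use r in auto)
  then have "ln (2 * h r + 3 * s) \<le> ln (((b r)\<^sup>2 + 1) * (3 * s))"
    using nz[of r] r s_pos at_0 by (simp add: L_def b_def ln_mult)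
  then have "2 * h r + 3 * s \<le> ((b r)\<^sup>2 + 1) * (3 * s)"
    using nz[of r] r s_pos by simp
  then show ?thesis using s_pos by (simp add: divide_le_eq algebra_simps)
qed

section \<open>Upper bound for b b' when s is at least 2\<close>

lemma p_deriv:
  assumes r: "r > 0"
  shows "(p has_real_derivative (1 - (p r)\<^sup>2) / b r - (w r + u r) * p r + b r) (at r)"
proof -
  note d = derivs[OF r] and ps = positive[OF r]
  have "((\<lambda>t. v t * b t) has_real_derivative (1 + K r - x r * v r) * b r + p r * v r) (at r)"
    by (rule DERIV_mult[OF d(6) d(8)])
  then have "(p has_real_derivative (1 + K r - x r * v r) * b r + p r * v r) (at r)"
    by (rule has_field_derivative_transform_within_open[of _ _ _ "{0<..}"]) (use r derivs(9) in auto)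
  moreover have "(1 + K r - x r * v r) * b r + p r * v r = (1 - (p r)\<^sup>2) / b r - (w r + u r) * p r + b r"
  proof -
    have "K r * b r = 1 / b r" using b_K[OF r] ps by (simp add: field_simps power2_eq_square)
    moreover have "(p r)\<^sup>2 / b r = p r * v r" using d(9) ps by (simp add: power2_eq_square)
    moreover have "x r * v r * b r = (u r + w r) * p r + 2 * (p r * v r)"
      unfolding d(9) x_def by (simp add: algebra_simps)
    ultimately show ?thesis by (simp add: algebra_simps diff_divide_distrib)
  qed
  ultimately show ?thesis by simp
qed

text \<open>Compares b b', half the derivative of b^2, with a multiple of u = h'. Both vanish at 0,
  so the difference is divided by r; the quotient \<open>d\<close> starts at 1 - \<eta> s = - 1 for
  \<eta> = 2 / s. Before a first contact b^2 - 2 \<eta> h does not increase, and its sign controls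
  the derivative at the contact.\<close>

lemma b_upper_bound_if:
  assumes s2: "s \<ge> 2" and R: "R > 0" and p: "\<And>t. t \<in> {0..R} \<Longrightarrow> p t \<le> 1"
  shows "b R * p R < 2 / s * u R"
proof -
  define \<eta> where "\<eta> = 2 / s"
  define d where "d t = p t * exp (gV t) - \<eta> * U t" for t
  have cd: "continuous_on {0..R} d" unfolding d_def p_def by (intro continuous_intros cont_regular)
  have D: "b t * p t - \<eta> * u t = t * d t" for t by (simp add: d_def b_def u_def algebra_simps)
  have "- d R > 0"
  proof (rule positive_barrier[where f = "\<lambda>t. - d t"])
    show "continuous_on {0..R} (\<lambda>t. - d t)" by (intro continuous_intros cd)
    show "- d 0 > 0" using s_pos by (simp add: d_def p_def at_0 \<eta>_def)
    fix z assume z: "z \<in> {0<..R}" "- d z = 0" "\<And>t. t \<in> {0..<z} \<Longrightarrow> - d t > 0"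
    then have z0: "z > 0" by auto
    note dz = derivs[OF z0] and ps = positive[OF z0]
    define E where "E t = (b t)\<^sup>2 - 2 * \<eta> * h t" for t
    have "E z \<le> E 0"
    proof (rule DERIV_nonpos_imp_decreasing_open[where f = E])
      show "continuous_on {0..z} E" unfolding E_def b_def by (intro continuous_intros cont_regular)
      fix t assume t: "0 < t" "t < z"
      have "(E has_real_derivative 2 * b t * p t - 2 * \<eta> * u t) (at t)"
        unfolding E_def by (auto intro!: derivative_eq_intros derivs[OF t(1)])
      moreover have "2 * b t * p t - 2 * \<eta> * u t = 2 * (t * d t)" by (simp flip: D)
      moreover have "t * d t \<le> 0" using z(3)[of t] t by (simp add: mult_nonneg_nonpos)
      ultimately show "\<exists>y. (E has_real_derivative y) (at t) \<and> y \<le> 0" by force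
    qed (use z in auto)
    then have E: "E z \<le> 0" by (simp add: E_def b_def at_0)
    have dp: "(p has_real_derivative (1 - (p z)\<^sup>2) / b z - (w z + u z) * p z + b z) (at z)"
      by (rule p_deriv[OF z0])
    define D' where "D' = p z * p z + ((1 - (p z)\<^sup>2) / b z - (w z + u z) * p z + b z) * b z
        - \<eta> * (2 * h z + 3 * s - x z * u z)"
    have "((\<lambda>t. b t * p t - \<eta> * u t) has_real_derivative D') (at z)"
      unfolding D'_def by (intro DERIV_diff DERIV_mult DERIV_cmult dz dp)
    from DERIV_divide[OF this DERIV_ident]
    have "((\<lambda>t. (b t * p t - \<eta> * u t) / t) has_real_derivative (D' * z - (b z * p z - \<eta> * u z) * 1) / (z * z)) (at z)"
      using z0 by simp
    then have "((\<lambda>t. (b t * p t - \<eta> * u t) / t) has_real_derivative D' / z) (at z)"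
      using z(2) z0 by (simp add: D)
    then have dd: "(d has_real_derivative D' / z) (at z)"
      by (rule has_field_derivative_transform_within_open[of _ _ _ "{0<..}"]) (use z0 D in auto)
    \<comment> \<open>At the contact the first term vanishes and E z \<le> 0, so D' is at most 1 + 2
      p^2 - 6, and p \<le> 1 makes this at most - 3.\<close>
    have "D' = - x z * (b z * p z - \<eta> * u z) + E z + 1 + 2 * (p z)\<^sup>2 - 3 * s * \<eta>"
    proof -
      have "x z * (b z * p z) = (w z + u z) * p z * b z + 2 * (p z)\<^sup>2"
        unfolding x_def dz(9) by (simp add: power2_eq_square algebra_simps)
      then show ?thesis using ps unfolding D'_def E_def by (simp add: power2_eq_square field_simps)
    qed
    moreover have "b z * p z - \<eta> * u z = 0" using z(2) by (simp add: D)
    moreover have "3 * s * \<eta> = 6" using s_pos by (simp add: \<eta>_def)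
    moreover have "(p z)\<^sup>2 \<le> 1" using p[of z] ps z by (simp add: power_le_one)
    ultimately have "D' < 0" using E by simp
    then have "- (D' / z) > 0" using z0 by (simp add: divide_less_0_iff)
    moreover have "((\<lambda>t. - d t) has_real_derivative - (D' / z)) (at z within {0..R})"
      using DERIV_minus[OF dd] has_field_derivative_at_within by blast
    ultimately show "\<exists>D>0. ((\<lambda>t. - d t) has_real_derivative D) (at z within {0..R})" by blast
  qed (use R in auto)
  then have "R * d R < 0" using R by (simp add: mult_pos_neg)
  then show ?thesis unfolding D[symmetric] by (simp add: \<eta>_def)
qed

text \<open>Bootstrap from the conditional bound. Near 0 one has p < 1 because V 0 < 0 for s \<ge>
  2. At a first time with p = 1 the bound of \<open>b_upper_bound_if\<close> is available and reads
  b < (2 / s) u \<le> u, so p' = b - u - w < 0.\<close>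

lemma p_less_1:
  assumes s2: "s \<ge> 2" and R: "R > 0"
  shows "p R < 1"
proof -
  have "\<forall>\<^sub>F t in at 0 within {0..1}. V t < 0"
  proof (rule order_tendstoD(2))
    show "(V \<longlongrightarrow> V 0) (at 0 within {0..1})" using cont_regular(3)[of 1] by (simp add: continuous_on_def)
    show "V 0 < 0" using s2 by (simp add: at_0)
  qed
  then obtain d where d: "d > 0" "\<And>t. \<lbrakk>t \<in> {0..1}; t \<noteq> 0; dist t 0 < d\<rbrakk> \<Longrightarrow> V t < 0"
    unfolding eventually_at by blast
  define e where "e = min (min (d / 2) 1) R"
  have e: "0 < e" "e \<le> 1" "e < d" "e \<le> R" using d(1) R by (auto simp: e_def)
  have Vneg: "V t < 0" if "t \<in> {0..e}" for t
    using d(2)[of t] that e s2 at_0(3) by (cases "t = 0") auto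
  have small: "p t < 1" if t: "t \<in> {0<..e}" for t
  proof -
    have "0 \<le> J 1 (\<lambda>r. - V r) t"
      using t by (intro J_nonneg continuous_intros cont_regular) (use Vneg in \<open>force simp: less_imp_le\<close>)+
    also have "J 1 (\<lambda>r. - V r) t = - J 1 V t" by (simp add: J_def)
    finally have "gV t \<le> 0" by (simp add: gV_def mult_nonneg_nonpos)
    then have "exp (gV t) \<le> 1" by simp
    moreover have "1 + t\<^sup>2 * V t < 1" using Vneg[of t] t by (simp add: mult_pos_neg)
    moreover have "0 \<le> 1 + t\<^sup>2 * V t"
      using sol_v_pos[OF sol[of t] s_pos, of t] t by simp
    ultimately show ?thesis unfolding p_def
      using mult_left_mono[of "exp (gV t)" 1 "1 + t\<^sup>2 * V t"] by simp
  qed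
  have "1 - p R > 0"
  proof (rule positive_barrier_from[where f = "\<lambda>t. 1 - p t" and a = e and b = R])
    have "continuous_on {0..R} (\<lambda>t. 1 - p t)"
      unfolding p_def by (intro continuous_intros cont_regular)
    then show "continuous_on {e..R} (\<lambda>t. 1 - p t)"
      by (rule continuous_on_subset) (use e in auto)
    show "1 - p e > 0" using small[of e] e by simp
    fix z assume z: "z \<in> {e<..R}" "1 - p z = 0" "\<And>t. t \<in> {e..<z} \<Longrightarrow> 1 - p t > 0"
    have z0: "z > 0" using z e by auto
    have "p t \<le> 1" if tz: "t \<in> {0..z}" for t
    proof -
      have "t = 0 \<or> t \<in> {0<..e} \<or> t \<in> {e..<z} \<or> t = z" using tz by auto
      then consider "t = 0" | "t \<in> {0<..e}" | "t \<in> {e..<z}" | "t = z" by blast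
      then show ?thesis using small[of t] z(2) z(3)[of t] by cases (auto simp: p_def at_0)
    qed
    from b_upper_bound_if[OF s2 z0 this]
    have "b z < 2 / s * u z" using z(2) by simp
    also have "\<dots> \<le> u z" using s2 positive[OF z0] by (simp add: divide_le_eq)
    finally have "w z + u z - b z > 0" using positive(4)[OF z0] by simp
    moreover have "((\<lambda>t. 1 - p t) has_real_derivative - ((1 - (p z)\<^sup>2) / b z - (w z + u z) * p z + b z)) (at z)"
      by (auto intro!: derivative_eq_intros p_deriv[OF z0])
    ultimately show "\<exists>D>0. ((\<lambda>t. 1 - p t) has_real_derivative D) (at z)"
      using z(2) by (intro exI[of _ "w z + u z - b z"]) simp
  qed (use e in auto)
  then show ?thesis by simp
qed

lemma b_upper_bound:
  assumes s2: "s \<ge> 2" and R: "R > 0"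
  shows "b R * p R < 2 / s * u R"
proof (rule b_upper_bound_if[OF s2 R])
  show "p t \<le> 1" if "t \<in> {0..R}" for t
    using p_less_1[OF s2, of t] that by (cases "t = 0") (auto simp: p_def at_0)
qed

end

text \<open>The rate survives in the limit with the same \<open>E\<close> and \<open>d\<close>, so
  constants uniform in a parameter yield uniform convergence.\<close>

lemma tendsto_of_powr_tail:
  fixes D :: "real \<Rightarrow> real"
  assumes D: "\<And>r r'. \<lbrakk>R \<le> r; r \<le> r'\<rbrakk> \<Longrightarrow> \<bar>D r' - D r\<bar> \<le> E * r powr (- d)" and d: "d > 0" and R: "R > 0"
  obtains L where "(D \<longlongrightarrow> L) at_top" "\<And>r. r \<ge> R \<Longrightarrow> \<bar>D r - L\<bar> \<le> E * r powr (- d)"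
proof -
  have E0: "((\<lambda>r. E * r powr (- d)) \<longlongrightarrow> 0) at_top"
    using tendsto_mult_right_zero[OF tendsto_neg_powr[OF _ filterlim_ident, of "- d"], of E] d by simp
  have "Cauchy (\<lambda>n. D (R + real n))"
  proof (rule metric_CauchyI)
    fix e :: real assume e: "e > 0"
    have "\<forall>\<^sub>F r in at_top. \<bar>E * r powr (- d)\<bar> < e"
      using E0 e by (simp add: tendsto_iff dist_real_def)
    then obtain r0 where r0: "\<And>r. r \<ge> r0 \<Longrightarrow> \<bar>E * r powr (- d)\<bar> < e"
      by (auto simp: eventually_at_top_linorder)
    obtain N :: nat where N: "real N \<ge> r0" using real_arch_simple by blast
    have *: "dist (D (R + real m)) (D (R + real n)) < e" if "m \<ge> N" "n \<ge> m" for m n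
    proof -
      have "\<bar>D (R + real n) - D (R + real m)\<bar> \<le> E * (R + real m) powr (- d)"
        using that by (intro D) auto
      also have "\<dots> \<le> \<bar>E * (R + real m) powr (- d)\<bar>" by simp
      also have "\<dots> < e" using that N R by (intro r0) linarith
      finally show ?thesis by (simp add: dist_real_def abs_minus_commute)
    qed
    show "\<exists>M. \<forall>m\<ge>M. \<forall>n\<ge>M. dist (D (R + real m)) (D (R + real n)) < e"
    proof (intro exI allI impI)
      fix m n assume "m \<ge> N" "n \<ge> N"
      then show "dist (D (R + real m)) (D (R + real n)) < e"
        using *[of m n] *[of n m] by (cases "m \<le> n") (auto simp: dist_commute)
    qed
  qed
  then obtain L where L: "(\<lambda>n. D (R + real n)) \<longlonglongrightarrow> L"
    using real_Cauchy_convergent convergent_def by blast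
  have bound: "\<bar>D r - L\<bar> \<le> E * r powr (- d)" if r: "r \<ge> R" for r
  proof (rule tendsto_upperbound)
    show "((\<lambda>n. \<bar>D r - D (R + real n)\<bar>) \<longlongrightarrow> \<bar>D r - L\<bar>) sequentially"
      by (intro tendsto_intros L)
    obtain N :: nat where N: "real N \<ge> r" using real_arch_simple by blast
    have "\<bar>D r - D (R + real n)\<bar> \<le> E * r powr (- d)" if "n \<ge> N" for n
    proof -
      have "r \<le> R + real n" using that N R of_nat_mono[OF that, where 'a=real] by linarith
      then show ?thesis using D[OF r, of "R + real n"] by (simp add: abs_minus_commute)
    qed
    then show "\<forall>\<^sub>F n in sequentially. \<bar>D r - D (R + real n)\<bar> \<le> E * r powr (- d)"
      unfolding eventually_sequentially by blast
  qed simp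
  have "((\<lambda>r. D r - L) \<longlongrightarrow> 0) at_top"
  proof (rule Lim_null_comparison[OF _ E0])
    show "\<forall>\<^sub>F r in at_top. norm (D r - L) \<le> E * r powr (- d)"
      using eventually_ge_at_top[of R] by eventually_elim (use bound in auto)
  qed
  then have "(D \<longlongrightarrow> L) at_top" by (simp add: LIM_zero_iff)
  then show thesis using that bound by blast
qed

section \<open>Asymptotics\<close>

text \<open>All estimates are in terms of bounds at \<open>r = 1\<close>, so that they hold uniformly for \<open>s\<close> in a compact
  set; this makes the limits continuous in \<open>s\<close>.\<close>
locale flow_bounds = flow +
  fixes c M :: real
  assumes c: "0 < c" "c \<le> 1" and M: "1 \<le> M"
    and lower1: "c \<le> u 1" "c \<le> w 1" "c \<le> v 1"
    and upper1: "w 1 \<le> M" "v 1 \<le> M" "x 1 \<le> M" "K 1 \<le> M"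
begin

text \<open>Origin of the constants, all built from \<open>c\<close> and \<open>M\<close>: x v and x
  w stay below \<open>C1\<close>; x' \<ge> 1/2 from \<open>R1\<close> on, hence x \<ge> c2 r; v and
  w lie between c3 / r and C2 / r; K decays like r^(-\<delta>); beyond \<open>R2\<close> the damping
  beats the lower order terms; \<open>A\<close> and \<open>B0\<close> bound the forcing and the
  initial value in \<open>linear_tail\<close>, \<open>C3\<close> its result, and \<open>E\<close>
  the tails of ln a' and ln b'.\<close>

definition "C1 = 3 * M\<^sup>2"
definition "R1 = 6 * C1\<^sup>2 / c"
definition "c2 = 1 / (4 * R1)"
definition "C2 = C1 / c2"
definition "c3 = c / (2 * M)"
definition "\<delta> = 2 * c3"
definition "R2 = 1 + 2 * (C2 + 3) / c2"
definition "A = 2 * C2 ^ 3 + C2 * M"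
definition "B0 = C1\<^sup>2 + C1 + 1 + M"
definition "C3 = R2 ^ 3 * B0 + 2 * A / c2 + 1"
definition "E = C3 / (c3 * \<delta>)"

lemma constants:
  "C1 \<ge> 3" "R1 \<ge> 1" "c2 > 0" "c2 \<le> 1" "C2 > 0" "c3 > 0" "c3 \<le> 1 / 2" "\<delta> > 0" "\<delta> \<le> 1" "R2 \<ge> 1" "A > 0" "B0 > 0"
  "C3 > 0" "C1 \<ge> M + 2"
proof -
  have MM: "M\<^sup>2 \<ge> M" using M by (simp add: power2_eq_square)
  show C1: "C1 \<ge> 3" "C1 \<ge> M + 2" using MM M by (simp_all add: C1_def)
  have "C1\<^sup>2 \<ge> 1" using C1(1) by (simp add: one_le_power)
  then show R1: "R1 \<ge> 1" using c by (simp add: R1_def pos_le_divide_eq)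
  show c2: "c2 > 0" "c2 \<le> 1" using R1 by (simp_all add: c2_def divide_le_eq)
  show C2: "C2 > 0" using C1 c2 by (simp add: C2_def)
  show c3: "c3 > 0" using c M by (simp add: c3_def)
  show "c3 \<le> 1 / 2" using c M by (simp add: c3_def divide_le_eq)
  then show "\<delta> > 0" "\<delta> \<le> 1" using c3 by (simp_all add: \<delta>_def)
  show R2: "R2 \<ge> 1" using C2 c2 by (simp add: R2_def)
  show A: "A > 0" using C2 M by (simp add: A_def add_pos_pos)
  show B0: "B0 > 0" using C1 M by (simp add: B0_def add_nonneg_pos)
  have "R2 ^ 3 * B0 \<ge> 0" "2 * A / c2 \<ge> 0" using R2 A B0 c2 by simp_all
  then show "C3 > 0" by (simp add: C3_def)
qed

section \<open>Growth of x and decay of v, w and K\<close>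

lemma mono_from_1:
  fixes f :: "real \<Rightarrow> real"
  assumes "0 < a" "a \<le> r" and "\<And>t. t \<ge> a \<Longrightarrow> \<exists>y. (f has_real_derivative y) (at t) \<and> y \<ge> 0"
  shows "f a \<le> f r"
proof (rule DERIV_nonneg_imp_nondecreasing[where f = f])
  show "\<exists>y. (f has_real_derivative y) (at t) \<and> y \<ge> 0" if "a \<le> t" "t \<le> r" for t
    using assms(3) that by simp
qed (use assms in auto)

lemma barrier_from:
  fixes f :: "real \<Rightarrow> real"
  assumes "0 < a" "a \<le> r" "f a > 0" and f': "\<And>t. t \<ge> a \<Longrightarrow> (f has_real_derivative f' t) (at t)"
    and "\<And>t. \<lbrakk>t \<ge> a; f t = 0\<rbrakk> \<Longrightarrow> f' t > 0"
  shows "f r > 0"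
proof (rule positive_barrier_from[where f = f and a = a and b = r])
  have "isCont f t" if "t \<ge> a" for t using DERIV_isCont[OF f'[OF that]] .
  then show "continuous_on {a..r} f" by (simp add: continuous_at_imp_continuous_on)
  show "\<exists>D>0. (f has_real_derivative D) (at z)" if "z \<in> {a<..r}" "f z = 0" for z
    using f'[of z] assms(5)[of z] that by auto
qed (use assms in auto)

lemma x_gt_1: "r > 0 \<Longrightarrow> x r > 1"
proof -
  assume r: "r > 0"
  have "(x r)\<^sup>2 > 1\<^sup>2" using x_square[OF r] positive(7,9)[OF r] s_pos by (simp add: add_pos_nonneg add_nonneg_pos)
  then show ?thesis using positive(6)[OF r] power2_less_imp_less by (metis less_eq_real_def)
qed

lemma K_le_M: "r \<ge> 1 \<Longrightarrow> K r \<le> M"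
proof -
  assume r: "r \<ge> 1"
  have "- K 1 \<le> - K r"
  proof (rule mono_from_1[where f = "\<lambda>t. - K t", OF _ r])
    fix t :: real assume "t \<ge> 1"
    then have t: "t > 0" by simp
    have "((\<lambda>t. - K t) has_real_derivative 2 * v t * K t) (at t)"
      using DERIV_minus[OF derivs(7)[OF t]] by simp
    moreover have "2 * v t * K t \<ge> 0" using positive[OF t] by simp
    ultimately show "\<exists>y. ((\<lambda>t. - K t) has_real_derivative y) (at t) \<and> y \<ge> 0" by blast
  qed simp
  then show ?thesis using upper1 by simp
qed

lemma x_le: "r \<ge> 1 \<Longrightarrow> x r \<le> M * r"
proof -
  assume r: "r \<ge> 1"
  have "1 - x 1 \<le> r - x r"
  proof (rule mono_from_1[where f = "\<lambda>t. t - x t", OF _ r])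
    fix t :: real assume "t \<ge> 1"
    then have t: "t > 0" by simp
    have "((\<lambda>t. t - x t) has_real_derivative 1 - (1 - (w t)\<^sup>2 - 2 * (v t)\<^sup>2)) (at t)"
      by (intro DERIV_diff DERIV_ident derivs t)
    then show "\<exists>y. ((\<lambda>t. t - x t) has_real_derivative y) (at t) \<and> y \<ge> 0"
      by (intro exI[of _ "1 - (1 - (w t)\<^sup>2 - 2 * (v t)\<^sup>2)"]) simp
  qed simp
  moreover have "(M - 1) * (r - 1) \<ge> 0" using M r by simp
  ultimately show ?thesis using upper1 by (simp add: algebra_simps)
qed

text \<open>At x v = C1 the product decreases: x' \<le> 1 gives x' v \<le> v < x, while 1 + K - C1
  \<le> - 1 gives x v' \<le> - x. The argument for w is the same with K absent.\<close>

lemma xv_le: "r \<ge> 1 \<Longrightarrow> x r * v r \<le> C1" and xw_le: "r \<ge> 1 \<Longrightarrow> x r * w r \<le> C1"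
proof -
  assume r: "r \<ge> 1"
  have 1: "(1::real) > 0" by simp
  note p1 = positive[OF 1]
  have M2: "M * M < C1" using M by (simp add: C1_def power2_eq_square)
  have dx_le: "1 - (w t)\<^sup>2 - 2 * (v t)\<^sup>2 \<le> 1" for t
    using zero_le_power2[of "w t"] zero_le_power2[of "v t"] by linarith
  have "C1 - x r * v r > 0"
  proof (rule barrier_from[where f = "\<lambda>t. C1 - x t * v t", OF 1 r])
    have "x 1 * v 1 \<le> M * M" using upper1 p1 M by (intro mult_mono) auto
    then show "C1 - x 1 * v 1 > 0" using M2 by simp
    fix t :: real assume t1: "t \<ge> 1"
    then have t: "t > 0" by simp
    note ps = positive[OF t]
    let ?D = "- ((1 - (w t)\<^sup>2 - 2 * (v t)\<^sup>2) * v t + (1 + K t - x t * v t) * x t)"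
    show "((\<lambda>t. C1 - x t * v t) has_real_derivative ?D) (at t)"
      using DERIV_diff[OF DERIV_const DERIV_mult[OF derivs(10)[OF t] derivs(6)[OF t]]] by simp
    assume z: "C1 - x t * v t = 0"
    have "(1 - (w t)\<^sup>2 - 2 * (v t)\<^sup>2) * v t \<le> 1 * v t" using ps by (intro mult_right_mono dx_le) auto
    also have "\<dots> < x t" using ps by (simp add: x_def)
    finally have a: "(1 - (w t)\<^sup>2 - 2 * (v t)\<^sup>2) * v t < x t" .
    have "(1 + K t - x t * v t) * x t \<le> - 1 * x t"
      using ps K_le_M[OF t1] constants(14) z by (intro mult_right_mono) auto
    with a show "?D > 0" by simp
  qed
  then show "x r * v r \<le> C1" by simp
  have "C1 - x r * w r > 0"
  proof (rule barrier_from[where f = "\<lambda>t. C1 - x t * w t", OF 1 r])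
    have "x 1 * w 1 \<le> M * M" using upper1 p1 M by (intro mult_mono) auto
    then show "C1 - x 1 * w 1 > 0" using M2 by simp
    fix t :: real assume t1: "t \<ge> 1"
    then have t: "t > 0" by simp
    note ps = positive[OF t]
    let ?D = "- ((1 - (w t)\<^sup>2 - 2 * (v t)\<^sup>2) * w t + (1 - x t * w t) * x t)"
    show "((\<lambda>t. C1 - x t * w t) has_real_derivative ?D) (at t)"
      using DERIV_diff[OF DERIV_const DERIV_mult[OF derivs(10)[OF t] derivs(5)[OF t]]] by simp
    assume z: "C1 - x t * w t = 0"
    have "(1 - (w t)\<^sup>2 - 2 * (v t)\<^sup>2) * w t \<le> 1 * w t" using ps by (intro mult_right_mono dx_le) auto
    also have "\<dots> < x t" using ps by (simp add: x_def)
    finally have a: "(1 - (w t)\<^sup>2 - 2 * (v t)\<^sup>2) * w t < x t" .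
    have "(1 - x t * w t) * x t \<le> - 1 * x t"
      using ps constants(1) z by (intro mult_right_mono) auto
    with a show "?D > 0" by simp
  qed
  then show "x r * w r \<le> C1" by simp
qed

lemma u_ge: "r \<ge> 1 \<Longrightarrow> u r \<ge> c"
proof -
  assume r: "r \<ge> 1"
  have "u 1 \<le> u r"
  proof (rule mono_from_1[OF _ r])
    fix t :: real assume "t \<ge> 1"
    then have t: "t > 0" by simp
    show "\<exists>y. (u has_real_derivative y) (at t) \<and> y \<ge> 0"
      using derivs(4)[OF t] u_increasing[OF t] less_imp_le by blast
  qed simp
  then show ?thesis using lower1 by simp
qed

text \<open>Since u \<ge> c, h grows at least linearly, and the conservation law passes this on to
  x^2.\<close>

lemma x_square_ge: "r \<ge> 1 \<Longrightarrow> (x r)\<^sup>2 \<ge> c * r"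
proof -
  assume r: "r \<ge> 1"
  have "h 1 - c * 1 \<le> h r - c * r"
  proof (rule mono_from_1[where f = "\<lambda>t. h t - c * t", OF _ r])
    fix t :: real assume t1: "t \<ge> 1"
    then have t: "t > 0" by simp
    have "((\<lambda>t. h t - c * t) has_real_derivative u t - c) (at t)"
      by (auto intro!: derivative_eq_intros derivs t)
    then show "\<exists>y. ((\<lambda>t. h t - c * t) has_real_derivative y) (at t) \<and> y \<ge> 0"
      using u_ge[OF t1] by force
  qed simp
  moreover have "h 1 \<ge> 0" "K r > 0" "c * r \<ge> c" using positive(9)[of 1] positive(7)[of r] r c by auto
  moreover have "(x r)\<^sup>2 \<ge> 2 + 2 * h r"
    using x_square[of r] positive(7)[of r] r s_pos by simp
  ultimately show ?thesis using c r by argo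
qed

text \<open>The bounds on x v and x w together with x^2 \<ge> c r give w^2 + 2 v^2 \<le> 1/2, hence
  x' \<ge> 1/2, from \<open>R1\<close> on: square root growth improves to linear growth. Up to
  \<open>2 * R1\<close> the bound x > 1 is enough.\<close>

lemma x_ge: "r \<ge> 1 \<Longrightarrow> x r \<ge> c2 * r"
proof -
  assume r: "r \<ge> 1"
  show ?thesis
  proof (cases "r \<le> 2 * R1")
    case True
    then have "c2 * r \<le> 1" using constants(2) by (simp add: c2_def divide_le_eq)
    then show ?thesis using x_gt_1[of r] r by simp
  next
    case False
    have R1r: "R1 \<le> r" using False constants(2) by simp
    have "x R1 - R1 / 2 \<le> x r - r / 2"
    proof (rule mono_from_1[where f = "\<lambda>t. x t - t / 2", OF _ R1r])
      show "0 < R1" using constants(2) by simp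
      fix t assume tR: "t \<ge> R1"
      then have t1: "t \<ge> 1" and t: "t > 0" using constants(2) by auto
      note ps = positive[OF t]
      have "(x t)\<^sup>2 * ((w t)\<^sup>2 + 2 * (v t)\<^sup>2) = (x t * w t)\<^sup>2 + 2 * (x t * v t)\<^sup>2"
        by (simp add: power_mult_distrib algebra_simps)
      also have "\<dots> \<le> C1\<^sup>2 + 2 * C1\<^sup>2"
        using xv_le[OF t1] xw_le[OF t1] ps by (intro add_mono mult_left_mono power_mono) auto
      \<comment> \<open>The definition of \<open>R1\<close> is made for this equality.\<close>
      also have "\<dots> = c * R1 / 2" using c by (simp add: R1_def)
      also have "\<dots> \<le> c * t / 2" using tR c by simp
      also have "\<dots> \<le> (x t)\<^sup>2 * (1 / 2)" using x_square_ge[OF t1] by simp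
      finally have "(w t)\<^sup>2 + 2 * (v t)\<^sup>2 \<le> 1 / 2" using ps by (simp only: mult_le_cancel_left_pos zero_less_power)
      moreover have "((\<lambda>t. x t - t / 2) has_real_derivative (1 - (w t)\<^sup>2 - 2 * (v t)\<^sup>2) - 1 / 2) (at t)"
        by (rule DERIV_diff[OF derivs(10)[OF t]]) (auto intro!: derivative_eq_intros)
      ultimately show "\<exists>y. ((\<lambda>t. x t - t / 2) has_real_derivative y) (at t) \<and> y \<ge> 0" by force
    qed
    moreover have "x R1 > 0" using constants(2) by (intro positive) simp
    ultimately have "x r \<ge> r / 4" using False by simp
    moreover have "c2 * r \<le> r / 4" using constants(2) r by (simp add: c2_def field_simps)
    ultimately show ?thesis by simp
  qed
qed

lemma v_le: "r \<ge> 1 \<Longrightarrow> v r \<le> C2 / r" and w_le: "r \<ge> 1 \<Longrightarrow> w r \<le> C2 / r"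
proof -
  assume r: "r \<ge> 1"
  have r0: "r > 0" using r by simp
  note ps = positive[OF r0]
  have "c2 * r * v r \<le> C1" "c2 * r * w r \<le> C1"
    using order_trans[OF mult_right_mono[OF x_ge[OF r], of "v r"] xv_le[OF r]]
      order_trans[OF mult_right_mono[OF x_ge[OF r], of "w r"] xw_le[OF r]] ps by simp_all
  then show "v r \<le> C2 / r" "w r \<le> C2 / r"
    using r0 constants(3) by (simp_all add: C2_def field_simps)
qed

text \<open>At r v = c3 the damping contributes x c3 \<le> M r c3 = c r / 2 < r, so the constant
  source term 1, multiplied by r, wins.\<close>

lemma v_ge: "r \<ge> 1 \<Longrightarrow> c3 / r \<le> v r" and w_ge: "r \<ge> 1 \<Longrightarrow> c3 / r \<le> w r"
proof -
  assume r: "r \<ge> 1"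
  have 1: "(1::real) > 0" by simp
  have cc: "c3 < c" using c M by (simp add: c3_def divide_less_eq)
  have key: "t - x t * c3 > 0" if "t \<ge> 1" for t
  proof -
    have "x t * c3 \<le> (M * t) * c3" using x_le[OF that] constants(6) by (intro mult_right_mono) auto
    also have "\<dots> = c * t / 2" using M by (simp add: c3_def)
    also have "\<dots> < t" using c that mult_right_mono[of c 1 t] by simp
    finally show ?thesis by simp
  qed
  have "r * v r - c3 > 0"
  proof (rule barrier_from[where f = "\<lambda>t. t * v t - c3", OF 1 r])
    show "1 * v 1 - c3 > 0" using lower1 cc by simp
    fix t :: real assume t1: "t \<ge> 1"
    then have t: "t > 0" by simp
    note ps = positive[OF t]
    show "((\<lambda>t. t * v t - c3) has_real_derivative v t + (1 + K t - x t * v t) * t) (at t)"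
      using DERIV_diff[OF DERIV_mult[OF DERIV_ident derivs(6)[OF t]] DERIV_const] by simp
    assume "t * v t - c3 = 0"
    then have "x t * v t * t = x t * c3" by (simp add: mult.commute)
    moreover have "(1 + K t - x t * v t) * t = t + K t * t - x t * v t * t" by (simp add: algebra_simps)
    moreover have "K t * t > 0" using ps t by simp
    ultimately show "v t + (1 + K t - x t * v t) * t > 0"
      using key[OF t1] ps(5) by argo
  qed
  then show "c3 / r \<le> v r" using r by (simp add: divide_le_eq mult.commute)
  have "r * w r - c3 > 0"
  proof (rule barrier_from[where f = "\<lambda>t. t * w t - c3", OF 1 r])
    show "1 * w 1 - c3 > 0" using lower1 cc by simp
    fix t :: real assume t1: "t \<ge> 1"
    then have t: "t > 0" by simp
    note ps = positive[OF t]
    show "((\<lambda>t. t * w t - c3) has_real_derivative w t + (1 - x t * w t) * t) (at t)"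
      using DERIV_diff[OF DERIV_mult[OF DERIV_ident derivs(5)[OF t]] DERIV_const] by simp
    assume "t * w t - c3 = 0"
    then have "x t * w t * t = x t * c3" by (simp add: mult.commute)
    moreover have "(1 - x t * w t) * t = t - x t * w t * t" by (simp add: algebra_simps)
    ultimately show "w t + (1 - x t * w t) * t > 0"
      using key[OF t1] ps(4) by argo
  qed
  then show "c3 / r \<le> w r" using r by (simp add: divide_le_eq mult.commute)
qed

text \<open>K' / K = - 2 v \<le> - \<delta> / r.\<close>

lemma K_decay: "r \<ge> 1 \<Longrightarrow> K r \<le> M * r powr (- \<delta>)"
proof -
  assume r: "r \<ge> 1"
  have r0: "r > 0" using r by simp
  have "- ln (K 1) - \<delta> * ln 1 \<le> - ln (K r) - \<delta> * ln r"
  proof (rule mono_from_1[where f = "\<lambda>t. - ln (K t) - \<delta> * ln t", OF _ r])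
    fix t :: real assume t1: "t \<ge> 1"
    then have t: "t > 0" by simp
    note ps = positive[OF t]
    have "((\<lambda>t. - ln (K t) - \<delta> * ln t) has_real_derivative 2 * v t - \<delta> / t) (at t)"
      using ps t by (auto intro!: derivative_eq_intros derivs[OF t])
    moreover have "2 * v t - \<delta> / t \<ge> 0" using v_ge[OF t1] by (simp add: \<delta>_def)
    ultimately show "\<exists>y. ((\<lambda>t. - ln (K t) - \<delta> * ln t) has_real_derivative y) (at t) \<and> y \<ge> 0" by blast
  qed simp
  moreover have "ln (K 1) \<le> ln M" using upper1(4) positive(7)[of 1] M by simp
  ultimately have "ln (K r) \<le> ln M - \<delta> * ln r" by simp
  then have "K r \<le> exp (ln M - \<delta> * ln r)"
    using positive(7)[OF r0] by (metis exp_le_cancel_iff exp_ln)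
  also have "\<dots> = M * r powr (- \<delta>)"
    using M r0 by (simp add: exp_diff powr_def exp_minus divide_inverse)
  finally show ?thesis .
qed

section \<open>Decay of a'' / a and b'' / b, convergence of ln a' and ln b'\<close>

text \<open>Damping of order c2 r / 2 against forcing A r^(-1-\<delta>) balances at (2 A / c2)
  r^(-2-\<delta>), whence the summand \<open>2 * A / c2\<close> of \<open>C3\<close>. The other
  summand covers the value at \<open>R2\<close>. The upper bound is later applied to a function and
  to its negative.\<close>

lemma linear_tail:
  assumes Z: "\<And>t. t \<ge> 1 \<Longrightarrow> (Z has_real_derivative (\<theta> t - x t) * Z t + f t) (at t)"
    and \<theta>: "\<And>t. t \<ge> 1 \<Longrightarrow> \<theta> t \<le> C2 / t"
    and f: "\<And>t. t \<ge> 1 \<Longrightarrow> f t \<le> A * t powr (- 1 - \<delta>)"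
    and Z2: "Z R2 \<le> B0" and r: "r \<ge> R2"
  shows "Z r \<le> C3 * r powr (- 2 - \<delta>)"
proof -
  note cs = constants
  have R20: "R2 > 0" using cs by simp
  have "C3 - r powr (2 + \<delta>) * Z r > 0"
  proof (rule barrier_from[where f = "\<lambda>t. C3 - t powr (2 + \<delta>) * Z t", OF R20 r])
    have "R2 powr (2 + \<delta>) \<le> R2 powr 3" using cs by (intro powr_mono) auto
    also have "\<dots> = R2 ^ 3" using R20 by simp
    finally have "R2 powr (2 + \<delta>) * Z R2 \<le> R2 ^ 3 * B0"
      using Z2 cs(12) R20 by (intro order_trans[OF mult_left_mono[OF Z2] mult_right_mono]) auto
    moreover have "2 * A / c2 \<ge> 0" using cs by simp
    ultimately show "C3 - R2 powr (2 + \<delta>) * Z R2 > 0" by (simp add: C3_def)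
    fix t assume tR: "t \<ge> R2"
    then have t1: "t \<ge> 1" and t: "t > 0" using cs by auto
    let ?D = "- ((2 + \<delta>) * t powr (2 + \<delta> - 1) * Z t + ((\<theta> t - x t) * Z t + f t) * t powr (2 + \<delta>))"
    have "((\<lambda>t. t powr (2 + \<delta>)) has_real_derivative (2 + \<delta>) * t powr (2 + \<delta> - 1)) (at t)"
      using t by (rule has_real_derivative_powr)
    from DERIV_diff[OF DERIV_const DERIV_mult[OF this Z[OF t1]]]
    show "((\<lambda>t. C3 - t powr (2 + \<delta>) * Z t) has_real_derivative ?D) (at t)" by simp
    assume "C3 - t powr (2 + \<delta>) * Z t = 0"
    then have y: "t powr (2 + \<delta>) * Z t = C3" by simp
    have p1: "t powr (2 + \<delta> - 1) = t powr (2 + \<delta>) / t" using t using powr_diff[of t "2 + \<delta>" 1] by simp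
    have "t powr (- 1 - \<delta>) * t powr (2 + \<delta>) = t" using t by (simp flip: powr_add)
    then have ft: "f t * t powr (2 + \<delta>) \<le> A * t"
      using mult_right_mono[OF f[OF t1], of "t powr (2 + \<delta>)"] by (simp add: mult.assoc)
    have "(2 + \<delta>) / t \<le> 3 / t" using cs(9) t by (intro divide_right_mono) auto
    moreover have "(3 + C2) / t = 3 / t + C2 / t" by (rule add_divide_distrib)
    ultimately have "(2 + \<delta>) / t + \<theta> t - x t \<le> (3 + C2) / t - c2 * t"
      using \<theta>[OF t1] x_ge[OF t1] by linarith
    \<comment> \<open>\<open>R2\<close> is chosen so that (3 + C2) / t is at most half of c2
      t.\<close>
    also have "\<dots> \<le> - (c2 * t / 2)"
    proof -
      have "2 * (C2 + 3) / c2 \<le> t" using tR by (simp add: R2_def)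
      then have "2 * (C2 + 3) \<le> c2 * t" using cs(3) by (simp add: divide_le_eq mult.commute)
      moreover have "c2 * t * 1 \<le> c2 * t * t" using t1 cs(3) by (intro mult_left_mono) auto
      ultimately have "3 + C2 \<le> c2 * t / 2 * t" by simp
      then have "(3 + C2) / t \<le> c2 * t / 2" using t by (simp only: pos_divide_le_eq)
      then show ?thesis by linarith
    qed
    finally have "C3 * ((2 + \<delta>) / t + \<theta> t - x t) \<le> C3 * - (c2 * t / 2)"
      using cs(13) by (intro mult_left_mono) auto
    moreover have "A * t < C3 * (c2 * t / 2)"
    proof -
      have "R2 ^ 3 * B0 \<ge> 0" using cs by simp
      then have "2 * A / c2 < C3" by (simp add: C3_def)
      then show ?thesis using cs(3) t by (simp add: field_simps)
    qed
    moreover have "?D = - (C3 * ((2 + \<delta>) / t + \<theta> t - x t)) - f t * t powr (2 + \<delta>)"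
      unfolding p1 y[symmetric] by (simp add: algebra_simps)
    ultimately show "?D > 0" using ft by simp
  qed
  then have "Z r * r powr (2 + \<delta>) \<le> C3" by (simp add: mult.commute)
  then have "Z r \<le> C3 / r powr (2 + \<delta>)" using r R20 by (simp add: pos_le_divide_eq)
  also have "\<dots> = C3 * r powr (- 2 - \<delta>)" by (simp add: powr_minus_divide[symmetric] divide_inverse powr_minus[symmetric])
  finally show ?thesis .
qed

text \<open>\<open>X\<close> is a'' / a and \<open>Y\<close> is b'' / b, minus the sectional
  curvatures of the radial planes. Their decay makes ln a' and ln b' converge, because (ln a')' = X
  / w and (ln b')' = Y / v.\<close>

definition "X r = (w r)\<^sup>2 - x r * w r + 1"
definition "Y r = (v r)\<^sup>2 + 1 + K r - x r * v r"

lemma X_deriv: "t > 0 \<Longrightarrow> (X has_real_derivative (w t - x t) * X t + 2 * (v t)\<^sup>2 * w t) (at t)"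
proof -
  assume t: "t > 0"
  note d = derivs[OF t]
  have "(X has_real_derivative 2 * w t * (1 - x t * w t)
      - ((1 - (w t)\<^sup>2 - 2 * (v t)\<^sup>2) * w t + (1 - x t * w t) * x t)) (at t)"
    unfolding X_def by (rule derivative_eq_intros d refl | simp)+
  then show ?thesis by (simp add: X_def power2_eq_square algebra_simps)
qed

lemma Y_deriv: "t > 0 \<Longrightarrow> (Y has_real_derivative (v t - x t) * Y t + v t * ((w t)\<^sup>2 - K t + (v t)\<^sup>2)) (at t)"
proof -
  assume t: "t > 0"
  note d = derivs[OF t]
  have "(Y has_real_derivative 2 * v t * (1 + K t - x t * v t) + - 2 * v t * K t
      - ((1 - (w t)\<^sup>2 - 2 * (v t)\<^sup>2) * v t + (1 + K t - x t * v t) * x t)) (at t)"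
    unfolding Y_def by (rule derivative_eq_intros d refl | simp)+
  then show ?thesis by (simp add: Y_def power2_eq_square algebra_simps)
qed

text \<open>Each expression is a factor at most C2 / t times one bounded by a multiple of
  t^(-\<delta>); since \<delta> \<le> 1, the decay t^(-2) of v^2 and w^2 may be weakened to
  that.\<close>

lemma forcing:
  assumes t: "t \<ge> 1"
  shows "\<bar>2 * (v t)\<^sup>2 * w t\<bar> \<le> A * t powr (- 1 - \<delta>)"
    "\<bar>v t * ((w t)\<^sup>2 - K t + (v t)\<^sup>2)\<bar> \<le> A * t powr (- 1 - \<delta>)"
proof -
  have t0: "t > 0" using t by simp
  note ps = positive[OF t0] and cs = constants
  define q where "q = t powr (- \<delta>)"
  have q: "t powr (- 1 - \<delta>) = q / t" using t0 by (simp add: q_def powr_diff powr_minus field_simps)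
  have "t powr (- 2) \<le> q" unfolding q_def using t cs by (intro powr_mono) auto
  then have t2: "1 / t\<^sup>2 \<le> q" using t0 by (simp add: powr_minus divide_inverse powr_numeral)
  have v2: "(v t)\<^sup>2 \<le> C2\<^sup>2 * q" "(w t)\<^sup>2 \<le> C2\<^sup>2 * q"
  proof -
    have "(v t)\<^sup>2 \<le> (C2 / t)\<^sup>2" "(w t)\<^sup>2 \<le> (C2 / t)\<^sup>2"
      using v_le[OF t] w_le[OF t] ps by (intro power_mono; simp)+
    moreover have "(C2 / t)\<^sup>2 \<le> C2\<^sup>2 * q"
      using mult_left_mono[OF t2, of "C2\<^sup>2"] by (simp add: power_divide)
    ultimately show "(v t)\<^sup>2 \<le> C2\<^sup>2 * q" "(w t)\<^sup>2 \<le> C2\<^sup>2 * q" by linarith+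
  qed
  have q0: "q > 0" using t0 by (simp add: q_def)
  have "2 * (v t)\<^sup>2 * w t \<le> (2 * (C2\<^sup>2 * q)) * (C2 / t)"
    using v2 w_le[OF t] ps q0 by (intro mult_mono) auto
  also have "\<dots> = 2 * C2 ^ 3 * (q / t)" by (simp add: power2_eq_square power3_eq_cube)
  also have "\<dots> \<le> A * (q / t)" using q0 t0 cs(5) M by (intro mult_right_mono) (auto simp: A_def)
  finally show "\<bar>2 * (v t)\<^sup>2 * w t\<bar> \<le> A * t powr (- 1 - \<delta>)" unfolding q using ps by simp
  have "\<bar>(w t)\<^sup>2 - K t + (v t)\<^sup>2\<bar> \<le> (2 * C2\<^sup>2 + M) * q"
  proof -
    have "K t \<le> M * q" using K_decay[OF t] by (simp add: q_def)
    moreover have "(w t)\<^sup>2 \<ge> 0" "(v t)\<^sup>2 \<ge> 0" "M * q \<ge> 0" "C2\<^sup>2 * q \<ge> 0" using q0 M by simp_all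
    moreover have "(2 * C2\<^sup>2 + M) * q = 2 * (C2\<^sup>2 * q) + M * q" by (simp add: algebra_simps)
    ultimately show ?thesis using v2 ps(7) by linarith
  qed
  then have "\<bar>v t\<bar> * \<bar>(w t)\<^sup>2 - K t + (v t)\<^sup>2\<bar> \<le> (C2 / t) * ((2 * C2\<^sup>2 + M) * q)"
    using v_le[OF t] ps t0 cs(5) by (intro mult_mono) auto
  also have "\<dots> = A * (q / t)" by (simp add: A_def power2_eq_square power3_eq_cube algebra_simps)
  finally show "\<bar>v t * ((w t)\<^sup>2 - K t + (v t)\<^sup>2)\<bar> \<le> A * t powr (- 1 - \<delta>)"
    unfolding q by (simp add: abs_mult)
qed

lemma XY_bounds:
  assumes r: "r \<ge> 1"
  shows "\<bar>X r\<bar> \<le> B0" "\<bar>Y r\<bar> \<le> B0"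
proof -
  have r0: "r > 0" using r by simp
  note ps = positive[OF r0]
  have "1 * v r \<le> x r * v r" "1 * w r \<le> x r * w r"
    using x_gt_1[OF r0] ps by (intro mult_right_mono; simp)+
  then have vw: "v r \<le> C1" "w r \<le> C1" using xv_le[OF r] xw_le[OF r] by auto
  then have "(v r)\<^sup>2 \<le> C1\<^sup>2" "(w r)\<^sup>2 \<le> C1\<^sup>2" using ps by (intro power_mono; simp)+
  moreover have "x r * v r > 0" "x r * w r > 0" "(v r)\<^sup>2 \<ge> 0" "(w r)\<^sup>2 \<ge> 0" "C1\<^sup>2 \<ge> 0" using ps by simp_all
  ultimately show "\<bar>X r\<bar> \<le> B0" "\<bar>Y r\<bar> \<le> B0"
    using xv_le[OF r] xw_le[OF r] K_le_M[OF r] ps M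
    unfolding X_def Y_def B0_def abs_le_iff by (intro conjI; linarith)+
qed

lemma XY_tail:
  assumes r: "r \<ge> R2"
  shows "\<bar>X r\<bar> \<le> C3 * r powr (- 2 - \<delta>)" "\<bar>Y r\<bar> \<le> C3 * r powr (- 2 - \<delta>)"
proof -
  note cs = constants
  note xb = XY_bounds[OF cs(10)]
  have n: "((\<lambda>t. - Z t) has_real_derivative (\<theta> - x t) * (- Z t) + - f) (at t)"
    if "(Z has_real_derivative (\<theta> - x t) * Z t + f) (at t)" for Z \<theta> f t
    using DERIV_minus[OF that] by (simp add: algebra_simps)
  have "X r \<le> C3 * r powr (- 2 - \<delta>)"
    by (rule linear_tail[where Z = X and \<theta> = w, OF X_deriv _ _ _ r])
      (use w_le forcing(1) xb in \<open>auto simp: abs_le_iff\<close>)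
  moreover have "- X r \<le> C3 * r powr (- 2 - \<delta>)"
    by (rule linear_tail[where Z = "\<lambda>t. - X t" and \<theta> = w, OF n[OF X_deriv] _ _ _ r])
      (use w_le forcing(1) xb in \<open>auto simp: abs_le_iff\<close>)
  ultimately show "\<bar>X r\<bar> \<le> C3 * r powr (- 2 - \<delta>)" by (simp add: abs_le_iff)
  have "Y r \<le> C3 * r powr (- 2 - \<delta>)"
    by (rule linear_tail[where Z = Y and \<theta> = v, OF Y_deriv _ _ _ r])
      (use v_le forcing(2) xb in \<open>auto simp: abs_le_iff\<close>)
  moreover have "- Y r \<le> C3 * r powr (- 2 - \<delta>)"
    by (rule linear_tail[where Z = "\<lambda>t. - Y t" and \<theta> = v, OF n[OF Y_deriv] _ _ _ r])
      (use v_le forcing(2) xb in \<open>auto simp: abs_le_iff\<close>)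
  ultimately show "\<bar>Y r\<bar> \<le> C3 * r powr (- 2 - \<delta>)" by (simp add: abs_le_iff)
qed

text \<open>The derivative is at most C3 t^(-2-\<delta>) divided by c3 / t, which integrates to the
  tail E r^(-\<delta>). Adding or subtracting this tail makes \<open>D\<close> monotone.\<close>

lemma tail_estimate:
  assumes D: "\<And>t. t \<ge> 1 \<Longrightarrow> (D has_real_derivative Z t / y t) (at t)"
    and Z: "\<And>t. t \<ge> R2 \<Longrightarrow> \<bar>Z t\<bar> \<le> C3 * t powr (- 2 - \<delta>)"
    and y: "\<And>t. t \<ge> 1 \<Longrightarrow> c3 / t \<le> y t"
    and r: "R2 \<le> r" "r \<le> r'"
  shows "\<bar>D r' - D r\<bar> \<le> E * r powr (- \<delta>)"
proof -
  note cs = constants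
  have r0: "r > 0" using r cs by simp
  have dE: "((\<lambda>t. E * t powr (- \<delta>)) has_real_derivative - (C3 / c3 * t powr (- 1 - \<delta>))) (at t)" if "t \<ge> R2" for t
  proof -
    have "t > 0" using that cs by simp
    from DERIV_cmult[OF has_real_derivative_powr[OF this, of "- \<delta>"], of E]
    have "((\<lambda>t. E * t powr (- \<delta>)) has_real_derivative E * (- \<delta> * t powr (- \<delta> - 1))) (at t)" .
    moreover have "E * (- \<delta> * t powr (- \<delta> - 1)) = - (C3 / c3 * t powr (- 1 - \<delta>))"
    proof -
      have e: "- \<delta> - 1 = - 1 - \<delta>" by simp
      show ?thesis unfolding e using cs(6,8) by (simp add: E_def)
    qed
    ultimately show ?thesis by simp
  qed
  have q: "\<bar>Z t / y t\<bar> \<le> C3 / c3 * t powr (- 1 - \<delta>)" if tR: "t \<ge> R2" for t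
  proof -
    have t: "t \<ge> 1" "t > 0" using tR cs by auto
    have c3t: "0 < c3 / t" using t cs by simp
    have "\<bar>Z t / y t\<bar> = \<bar>Z t\<bar> / y t" using y[OF t(1)] c3t by simp
    also have "\<dots> \<le> C3 * t powr (- 2 - \<delta>) / (c3 / t)"
      using Z[OF tR] y[OF t(1)] c3t by (intro frac_le) auto
    also have "\<dots> = C3 / c3 * (t powr (- 2 - \<delta>) * t powr 1)" using t by simp
    also have "t powr (- 2 - \<delta>) * t powr 1 = t powr (- 1 - \<delta>)" by (subst powr_add[symmetric]) simp
    finally show ?thesis .
  qed
  have "D r - E * r powr (- \<delta>) \<le> D r' - E * r' powr (- \<delta>)"
  proof (rule mono_from_1[where f = "\<lambda>t. D t - E * t powr (- \<delta>)", OF r0 r(2)])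
    fix t assume "t \<ge> r"
    then have t: "t \<ge> R2" "t \<ge> 1" using r cs by auto
    show "\<exists>z. ((\<lambda>t. D t - E * t powr (- \<delta>)) has_real_derivative z) (at t) \<and> z \<ge> 0"
      by (intro exI[of _ "Z t / y t - - (C3 / c3 * t powr (- 1 - \<delta>))"] conjI DERIV_diff[OF D[OF t(2)] dE[OF t(1)]])
        (use q[OF t(1)] in linarith)
  qed
  moreover have "- D r - E * r powr (- \<delta>) \<le> - D r' - E * r' powr (- \<delta>)"
  proof (rule mono_from_1[where f = "\<lambda>t. - D t - E * t powr (- \<delta>)", OF r0 r(2)])
    fix t assume "t \<ge> r"
    then have t: "t \<ge> R2" "t \<ge> 1" using r cs by auto
    show "\<exists>z. ((\<lambda>t. - D t - E * t powr (- \<delta>)) has_real_derivative z) (at t) \<and> z \<ge> 0"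
      by (intro exI[of _ "- (Z t / y t) - - (C3 / c3 * t powr (- 1 - \<delta>))"] conjI
          DERIV_diff[OF DERIV_minus[OF D[OF t(2)]] dE[OF t(1)]]) (use q[OF t(1)] in linarith)
  qed
  moreover have "E * r' powr (- \<delta>) \<ge> 0" using cs by (simp add: E_def)
  ultimately show ?thesis by (simp add: abs_le_iff)
qed

text \<open>ln w + gW is ln (a' / a0).\<close>

lemma ap_tail:
  assumes "R2 \<le> r" "r \<le> r'"
  shows "\<bar>(ln (w r') + gW r') - (ln (w r) + gW r)\<bar> \<le> E * r powr (- \<delta>)"
proof (rule tail_estimate[where D = "\<lambda>r. ln (w r) + gW r" and Z = X and y = w, OF _ XY_tail(1) w_ge assms])
  fix t :: real assume "t \<ge> 1"
  then have t: "t > 0" by simp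
  have "((\<lambda>r. ln (w r) + gW r) has_real_derivative (1 - x t * w t) / w t + w t) (at t)"
    using positive[OF t] by (auto intro!: derivative_eq_intros derivs[OF t])
  moreover have "(1 - x t * w t) / w t + w t = X t / w t"
    using positive[OF t] by (simp add: X_def field_simps power2_eq_square)
  ultimately show "((\<lambda>r. ln (w r) + gW r) has_real_derivative X t / w t) (at t)" by simp
qed

lemma p_tail:
  assumes "R2 \<le> r" "r \<le> r'"
  shows "\<bar>ln (p r') - ln (p r)\<bar> \<le> E * r powr (- \<delta>)"
proof (rule tail_estimate[where D = "\<lambda>r. ln (p r)" and Z = Y and y = v, OF _ XY_tail(2) v_ge assms])
  fix t :: real assume "t \<ge> 1"
  then have t: "t > 0" by simp
  note ps = positive[OF t] and d = derivs[OF t]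
  have "((\<lambda>r. ln (p r)) has_real_derivative ((1 - (p t)\<^sup>2) / b t - (w t + u t) * p t + b t) / p t) (at t)"
    using ps by (auto intro!: derivative_eq_intros p_deriv[OF t] simp: field_simps)
  moreover have "((1 - (p t)\<^sup>2) / b t - (w t + u t) * p t + b t) / p t = Y t / v t"
  proof -
    have "(1 - (p t)\<^sup>2) / b t - (w t + u t) * p t + b t = Y t * b t"
    proof -
      have "1 / b t = K t * b t" using b_K[OF t] ps by (simp add: field_simps power2_eq_square)
      moreover have "(p t)\<^sup>2 / b t = (v t)\<^sup>2 * b t" using d(9) ps by (simp add: power2_eq_square)
      ultimately show ?thesis unfolding d(9) Y_def x_def
        by (simp add: diff_divide_distrib power2_eq_square algebra_simps)
    qed
    then show ?thesis using ps d(9) by simp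
  qed
  ultimately show "((\<lambda>r. ln (p r)) has_real_derivative Y t / v t) (at t)" by simp
qed

section \<open>Limits at infinity and bounds for the limit of b'\<close>

lemma tendsto_v_w: "(v \<longlongrightarrow> 0) at_top" "(w \<longlongrightarrow> 0) at_top"
proof -
  have C: "((\<lambda>r. C2 / r) \<longlongrightarrow> 0) at_top"
    by (intro tendsto_divide_0[OF tendsto_const] filterlim_at_top_imp_at_infinity filterlim_ident)
  have "\<forall>\<^sub>F r in at_top. norm (v r) \<le> C2 / r"
    using eventually_ge_at_top[of 1]
  proof eventually_elim
    case (elim r)
    then show ?case using v_le[OF elim] positive(5)[of r] by simp
  qed
  moreover have "\<forall>\<^sub>F r in at_top. norm (w r) \<le> C2 / r"
    using eventually_ge_at_top[of 1]
  proof eventually_elim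
    case (elim r)
    then show ?case using w_le[OF elim] positive(4)[of r] by simp
  qed
  ultimately show "(v \<longlongrightarrow> 0) at_top" "(w \<longlongrightarrow> 0) at_top"
    using Lim_null_comparison[OF _ C] by blast+
qed

text \<open>x' tends to 1 because v and w tend to 0; so x, and with it u, is asymptotic to
  r.\<close>

lemma tendsto_u_h: "((\<lambda>r. u r / r) \<longlongrightarrow> 1) at_top" "((\<lambda>r. h r / r\<^sup>2) \<longlongrightarrow> 1 / 2) at_top"
proof -
  have pos: "\<forall>\<^sub>F r::real in at_top. r > 0" by (rule eventually_gt_at_top)
  have vw0: "((\<lambda>r. v r / r) \<longlongrightarrow> 0) at_top" "((\<lambda>r. w r / r) \<longlongrightarrow> 0) at_top"
    by (intro tendsto_divide_0[OF tendsto_v_w(1)] tendsto_divide_0[OF tendsto_v_w(2)]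
        filterlim_at_top_imp_at_infinity filterlim_ident)+
  have "((\<lambda>r. x r / r) \<longlongrightarrow> 1) at_top"
  proof (rule lhospital_at_top_at_top)
    show "filterlim (\<lambda>r::real. r) at_top at_top" by (rule filterlim_ident)
    show "\<forall>\<^sub>F r in at_top. (x has_real_derivative 1 - (w r)\<^sup>2 - 2 * (v r)\<^sup>2) (at r)"
      using pos by eventually_elim (rule derivs)
    have "((\<lambda>r. (1 - (w r)\<^sup>2 - 2 * (v r)\<^sup>2) / 1) \<longlongrightarrow> (1 - 0\<^sup>2 - 2 * 0\<^sup>2) / 1) at_top"
      by (intro tendsto_intros tendsto_v_w) auto
    then show "((\<lambda>r. (1 - (w r)\<^sup>2 - 2 * (v r)\<^sup>2) / 1) \<longlongrightarrow> 1) at_top" by simp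
  qed (auto intro!: derivative_eq_intros)
  then have "((\<lambda>r. x r / r - w r / r - 2 * (v r / r)) \<longlongrightarrow> 1 - 0 - 2 * 0) at_top"
    by (intro tendsto_intros vw0)
  then show U: "((\<lambda>r. u r / r) \<longlongrightarrow> 1) at_top"
    by (simp add: x_def add_divide_distrib)
  show "((\<lambda>r. h r / r\<^sup>2) \<longlongrightarrow> 1 / 2) at_top"
  proof (rule lhospital_at_top_at_top)
    show "filterlim (\<lambda>r::real. r\<^sup>2) at_top at_top" by (intro filterlim_pow_at_top filterlim_ident) simp
    show "\<forall>\<^sub>F r in at_top. (h has_real_derivative u r) (at r)"
      using pos by eventually_elim (rule derivs)
    show "\<forall>\<^sub>F r in at_top. ((\<lambda>r::real. r\<^sup>2) has_real_derivative 2 * r) (at r)"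
      by (intro always_eventually allI) (auto intro!: derivative_eq_intros)
    show "\<forall>\<^sub>F r::real in at_top. 2 * r \<noteq> 0" using pos by eventually_elim simp
    have "((\<lambda>r. u r / r / 2) \<longlongrightarrow> 1 / 2) at_top" by (intro tendsto_intros U) simp
    then show "((\<lambda>r. u r / (2 * r)) \<longlongrightarrow> 1 / 2) at_top" by (simp add: mult.commute)
  qed
qed

text \<open>Divide \<open>b_lower_bound\<close> by r^2 and \<open>b_upper_bound\<close> by r; b / r
  has the same limit as b' by l'Hospital's rule.\<close>

lemma limit_bounds:
  assumes \<beta>: "(p \<longlongrightarrow> \<beta>) at_top"
  shows "1 / (3 * s) \<le> \<beta>\<^sup>2" "s \<ge> 2 \<Longrightarrow> \<beta>\<^sup>2 \<le> 2 / s"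
proof -
  have pos: "\<forall>\<^sub>F r::real in at_top. r > 0" by (rule eventually_gt_at_top)
  have b: "((\<lambda>r. b r / r) \<longlongrightarrow> \<beta>) at_top"
  proof (rule lhospital_at_top_at_top)
    show "filterlim (\<lambda>r::real. r) at_top at_top" by (rule filterlim_ident)
    show "\<forall>\<^sub>F r in at_top. (b has_real_derivative p r) (at r)"
      using pos by eventually_elim (rule derivs)
    show "((\<lambda>r. p r / 1) \<longlongrightarrow> \<beta>) at_top" using \<beta> by simp
  qed (auto intro!: derivative_eq_intros)
  show "1 / (3 * s) \<le> \<beta>\<^sup>2"
  proof (rule tendsto_le[of at_top "\<lambda>r. (b r / r)\<^sup>2" "\<beta>\<^sup>2" "\<lambda>r. 2 / (3 * s) * (h r / r\<^sup>2)"])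
    show "((\<lambda>r. (b r / r)\<^sup>2) \<longlongrightarrow> \<beta>\<^sup>2) at_top" by (intro tendsto_intros b)
    have "((\<lambda>r. 2 / (3 * s) * (h r / r\<^sup>2)) \<longlongrightarrow> 2 / (3 * s) * (1 / 2)) at_top"
      by (intro tendsto_mult_left tendsto_u_h)
    then show "((\<lambda>r. 2 / (3 * s) * (h r / r\<^sup>2)) \<longlongrightarrow> 1 / (3 * s)) at_top" by simp
    show "\<forall>\<^sub>F r in at_top. 2 / (3 * s) * (h r / r\<^sup>2) \<le> (b r / r)\<^sup>2"
      using pos
    proof eventually_elim
      case (elim r)
      have "2 * h r / (3 * s) / r\<^sup>2 \<le> (b r)\<^sup>2 / r\<^sup>2"
        by (intro divide_right_mono b_lower_bound elim) simp
      then show ?case by (simp add: power_divide)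
    qed
  qed simp
  assume s2: "s \<ge> 2"
  show "\<beta>\<^sup>2 \<le> 2 / s"
  proof (rule tendsto_le[of at_top "\<lambda>r. 2 / s * (u r / r)" "2 / s" "\<lambda>r. b r / r * p r"])
    have "((\<lambda>r. 2 / s * (u r / r)) \<longlongrightarrow> 2 / s * 1) at_top"
      by (intro tendsto_mult_left tendsto_u_h)
    then show "((\<lambda>r. 2 / s * (u r / r)) \<longlongrightarrow> 2 / s) at_top" by simp
    show "((\<lambda>r. b r / r * p r) \<longlongrightarrow> \<beta>\<^sup>2) at_top"
      unfolding power2_eq_square by (intro tendsto_intros b \<beta>)
    show "\<forall>\<^sub>F r in at_top. b r / r * p r \<le> 2 / s * (u r / r)"
      using pos
    proof eventually_elim
      case (elim r)
      have "b r * p r / r \<le> 2 / s * u r / r"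
        using b_upper_bound[OF s2 elim] elim by (intro divide_right_mono) auto
      then show ?case by simp
    qed
  qed simp
qed

end

section \<open>Dependence on the parameter\<close>

text \<open>By \<open>sol_unique\<close> all candidates agree for r \<ge> 0 when s > 0, so the
  choice does not affect any value used below.\<close>

definition family :: "real \<Rightarrow> (real \<Rightarrow> real) \<times> (real \<Rightarrow> real) \<times> (real \<Rightarrow> real)" where
  "family s = (SOME Y. \<forall>R\<ge>0. sol R s (fst Y) (fst (snd Y)) (snd (snd Y)))"
definition FU where "FU s = fst (family s)"
definition FW where "FW s = fst (snd (family s))"
definition FV where "FV s = snd (snd (family s))"

lemma flow_family: "s > 0 \<Longrightarrow> flow s (FU s) (FW s) (FV s)"
proof
  assume s: "s > 0"
  obtain U W V where "\<forall>R\<ge>0. sol R s U W V" using sol_exists[OF s] by blast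
  then have "\<exists>Y. \<forall>R\<ge>0. sol R s (fst Y) (fst (snd Y)) (snd (snd Y))"
    by (intro exI[of _ "(U, W, V)"]) simp
  then have *: "\<forall>R\<ge>0. sol R s (fst (family s)) (fst (snd (family s))) (snd (snd (family s)))"
    unfolding family_def by (rule someI_ex)
  show "sol R s (FU s) (FW s) (FV s)" if "R \<ge> 0" for R
    using * that unfolding FU_def FW_def FV_def by blast
  show "0 < s" by fact
qed

text \<open>\<open>LA s\<close> is ln (a' / a0) and \<open>LB s\<close> is ln b'. With limits taken
  of the logarithms, \<phi> and \<psi> are positive by construction.\<close>

definition LA where "LA s r = ln (flow.w (FW s) r) + flow.gW (FW s) r"
definition LB where "LB s r = ln (flow.p (FV s) r)"
definition \<phi> where "\<phi> s = exp (Lim at_top (LA s))"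
definition \<psi> where "\<psi> s = exp (Lim at_top (LB s))"

lemma family_bounded:
  assumes "0 < s" "s \<le> S" "t \<in> {0..R}"
  shows "\<bar>FU s t\<bar> \<le> bd S R \<and> \<bar>FW s t\<bar> \<le> bd S R \<and> \<bar>FV s t\<bar> \<le> bd S R"
proof -
  interpret flow s "FU s" "FW s" "FV s" by (rule flow_family) fact
  have "R \<ge> 0" using assms(3) by simp
  from sol_bounds[OF sol[OF this] s_pos assms(3)] bd_mono[OF assms(1,2), of R]
  show ?thesis by linarith
qed

lemma family_lipschitz:
  assumes S: "0 < s0"
  obtains L where "L \<ge> 0" "\<And>s s' t. \<lbrakk>s \<in> {s0..S}; s' \<in> {s0..S}; t \<in> {0..R}\<rbrakk> \<Longrightarrow>
    \<bar>FU s t - FU s' t\<bar> \<le> L * \<bar>s - s'\<bar> \<and> \<bar>FW s t - FW s' t\<bar> \<le> L * \<bar>s - s'\<bar> \<and> \<bar>FV s t - FV s' t\<bar> \<le> L * \<bar>s - s'\<bar>"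
proof -
  define L where "L = 4 * exp ((12 * (R + 9 * bd S R * R) + 1) * R)"
  show thesis
  proof (rule that[of L])
    show "L \<ge> 0" by (simp add: L_def)
    fix s s' t assume s: "s \<in> {s0..S}" "s' \<in> {s0..S}" and t: "t \<in> {0..R}"
    have s': "0 < s" "s \<le> S" "0 < s'" "s' \<le> S" and R: "R \<ge> 0" using S s t by auto
    note dep = sol_dependence[OF flow.sol[OF flow_family[OF s'(1)] R] flow.sol[OF flow_family[OF s'(3)] R]
        family_bounded[OF s'(1,2)] family_bounded[OF s'(3,4)] t]
    show "\<bar>FU s t - FU s' t\<bar> \<le> L * \<bar>s - s'\<bar> \<and> \<bar>FW s t - FW s' t\<bar> \<le> L * \<bar>s - s'\<bar> \<and> \<bar>FV s t - FV s' t\<bar> \<le> L * \<bar>s - s'\<bar>"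
      using dep unfolding L_def by (simp add: mult_ac)
  qed
qed

lemma continuous_on_lipschitz_bound:
  fixes f :: "real \<Rightarrow> real"
  assumes "\<And>s s'. \<lbrakk>s \<in> S; s' \<in> S\<rbrakk> \<Longrightarrow> \<bar>f s - f s'\<bar> \<le> L * \<bar>s - s'\<bar>" "L \<ge> 0"
  shows "continuous_on S f"
proof -
  have "L-lipschitz_on S f" using assms by (intro lipschitz_onI) (auto simp: dist_real_def)
  then show ?thesis by (rule lipschitz_on_continuous_on)
qed

lemma family_continuous:
  assumes s0: "0 < s0" and r: "r \<ge> 0"
  shows "continuous_on {s0..S} (\<lambda>s. FU s r)" "continuous_on {s0..S} (\<lambda>s. FW s r)" "continuous_on {s0..S} (\<lambda>s. FV s r)"
    "continuous_on {s0..S} (\<lambda>s. flow.gW (FW s) r)" "continuous_on {s0..S} (\<lambda>s. flow.gV (FV s) r)"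
proof -
  obtain L where L: "L \<ge> 0" and l: "\<And>s s' t. \<lbrakk>s \<in> {s0..S}; s' \<in> {s0..S}; t \<in> {0..r}\<rbrakk> \<Longrightarrow>
    \<bar>FU s t - FU s' t\<bar> \<le> L * \<bar>s - s'\<bar> \<and> \<bar>FW s t - FW s' t\<bar> \<le> L * \<bar>s - s'\<bar> \<and> \<bar>FV s t - FV s' t\<bar> \<le> L * \<bar>s - s'\<bar>"
    using family_lipschitz[OF s0, of S r] by blast
  have rr: "r \<in> {0..r}" using r by simp
  show "continuous_on {s0..S} (\<lambda>s. FU s r)" "continuous_on {s0..S} (\<lambda>s. FW s r)" "continuous_on {s0..S} (\<lambda>s. FV s r)"
    by (rule continuous_on_lipschitz_bound[OF _ L]; use l[OF _ _ rr] in blast)+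
  have g: "\<bar>r\<^sup>2 * J 1 f r - r\<^sup>2 * J 1 f' r\<bar> \<le> r\<^sup>2 * L * \<bar>s - s'\<bar>"
    if "continuous_on {0..r} f" "continuous_on {0..r} f'" "\<And>t. t \<in> {0..r} \<Longrightarrow> \<bar>f t - f' t\<bar> \<le> L * \<bar>s - s'\<bar>" for f f' s s'
  proof -
    have "J 1 f r - J 1 f' r = J 1 (\<lambda>t. f t - f' t) r" by (rule J_diff[OF that(1,2) rr])
    moreover have "\<bar>J 1 (\<lambda>t. f t - f' t) r\<bar> \<le> L * \<bar>s - s'\<bar> * exp (0 * r) / (1 + 1)"
      using abs_J_le_exp[of r "\<lambda>t. f t - f' t" "L * \<bar>s - s'\<bar>" 0 1] that r L
      by (auto intro: continuous_on_diff)
    ultimately have "\<bar>J 1 f r - J 1 f' r\<bar> \<le> L * \<bar>s - s'\<bar>" using L by (simp add: field_simps)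
    then have "r\<^sup>2 * \<bar>J 1 f r - J 1 f' r\<bar> \<le> r\<^sup>2 * (L * \<bar>s - s'\<bar>)" by (intro mult_left_mono) auto
    then show ?thesis by (simp add: abs_mult mult.assoc flip: right_diff_distrib)
  qed
  have c: "continuous_on {0..r} (FW s)" "continuous_on {0..r} (FV s)" if "s \<in> {s0..S}" for s
    using flow.cont_regular(2,3)[OF flow_family[of s]] that s0 by auto
  have L2: "0 \<le> r\<^sup>2 * L" using L by simp
  have gW: "flow.gW (FW s) r = r\<^sup>2 * J 1 (FW s) r" and gV: "flow.gV (FV s) r = r\<^sup>2 * J 1 (FV s) r" if "s \<in> {s0..S}" for s
    using flow.gW_def[OF flow_family[of s]] flow.gV_def[OF flow_family[of s]] that s0 by auto
  show "continuous_on {s0..S} (\<lambda>s. flow.gW (FW s) r)"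
  proof (rule continuous_on_lipschitz_bound[OF _ L2])
    fix s s' assume s: "s \<in> {s0..S}" "s' \<in> {s0..S}"
    show "\<bar>flow.gW (FW s) r - flow.gW (FW s') r\<bar> \<le> r\<^sup>2 * L * \<bar>s - s'\<bar>"
      unfolding gW[OF s(1)] gW[OF s(2)] using l[OF s] by (intro g c s) blast
  qed
  show "continuous_on {s0..S} (\<lambda>s. flow.gV (FV s) r)"
  proof (rule continuous_on_lipschitz_bound[OF _ L2])
    fix s s' assume s: "s \<in> {s0..S}" "s' \<in> {s0..S}"
    show "\<bar>flow.gV (FV s) r - flow.gV (FV s') r\<bar> \<le> r\<^sup>2 * L * \<bar>s - s'\<bar>"
      unfolding gV[OF s(1)] gV[OF s(2)] using l[OF s] by (intro g c s) blast
  qed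
qed

lemma LAB_continuous:
  assumes s0: "0 < s0" and r: "r > 0"
  shows "continuous_on {s0..S} (\<lambda>s. LA s r)" "continuous_on {s0..S} (\<lambda>s. LB s r)"
proof -
  note c = family_continuous[OF s0, of r S]
  have fl: "flow s (FU s) (FW s) (FV s)" if "s \<in> {s0..S}" for s using that s0 by (intro flow_family) auto
  have W: "FW s r > 0" and p: "(1 + r\<^sup>2 * FV s r) * exp (flow.gV (FV s) r) > 0" if "s \<in> {s0..S}" for s
    using flow.positive(2,10)[OF fl[OF that] r] by (auto simp: flow.p_def[OF fl[OF that]])
  have "continuous_on {s0..S} (\<lambda>s. ln (r * FW s r) + flow.gW (FW s) r)"
  proof (intro continuous_intros c)
    show "\<forall>s\<in>{s0..S}. r * FW s r \<noteq> 0" using W r by force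
  qed (use r in auto)
  then show "continuous_on {s0..S} (\<lambda>s. LA s r)"
    by (rule continuous_on_eq) (simp add: LA_def flow.w_def[OF fl])
  have "continuous_on {s0..S} (\<lambda>s. ln ((1 + r\<^sup>2 * FV s r) * exp (flow.gV (FV s) r)))"
  proof (intro continuous_intros c)
    show "\<forall>s\<in>{s0..S}. (1 + r\<^sup>2 * FV s r) * exp (flow.gV (FV s) r) \<noteq> 0" using p by force
  qed (use r in auto)
  then show "continuous_on {s0..S} (\<lambda>s. LB s r)"
    by (rule continuous_on_eq) (simp add: LB_def flow.p_def[OF fl])
qed

text \<open>\<open>c\<close> is a minimum over the compact parameter interval, positive by
  \<open>flow.positive\<close> and capped at 1; \<open>M\<close> comes from the uniform bound
  \<open>bd S 1\<close>.\<close>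

lemma family_flow_bounds:
  assumes s0: "0 < s0"
  obtains c M where "\<And>s. s \<in> {s0..S} \<Longrightarrow> flow_bounds s (FU s) (FW s) (FV s) c M"
proof (cases "s0 \<le> S")
  case False
  then show ?thesis using that by force
next
  case True
  have one: "(0::real) \<le> 1" "(0::real) < 1" by auto
  note cont = family_continuous[OF s0 one(1), of S]
  have fl: "flow s (FU s) (FW s) (FV s)" if "s \<in> {s0..S}" for s using that s0 by (intro flow_family) auto
  define m where "m s = min (FU s 1) (min (FW s 1) (1 + FV s 1))" for s
  have vals: "flow.u (FU s) 1 = FU s 1" "flow.w (FW s) 1 = FW s 1" "flow.v (FV s) 1 = 1 + FV s 1"
    "flow.x (FU s) (FW s) (FV s) 1 = FU s 1 + FW s 1 + 2 * (1 + FV s 1)"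
    "flow.K (FV s) 1 = exp (- 2 * J 1 (FV s) 1)" if "s \<in> {s0..S}" for s
  proof -
    interpret flow s "FU s" "FW s" "FV s" by (rule fl[OF that])
    show "u 1 = FU s 1" "w 1 = FW s 1" "v 1 = 1 + FV s 1"
      "x 1 = FU s 1 + FW s 1 + 2 * (1 + FV s 1)" "K 1 = exp (- 2 * J 1 (FV s) 1)"
      by (simp_all add: u_def w_def v_def x_def K_def gV_def)
  qed
  have "continuous_on {s0..S} m" unfolding m_def by (intro continuous_intros cont)
  then obtain z where z: "z \<in> {s0..S}" "\<And>s. s \<in> {s0..S} \<Longrightarrow> m z \<le> m s"
    using continuous_attains_inf[of "{s0..S}" m] True by auto
  have mz: "m z > 0"
    using flow.positive(3-5)[OF fl[OF z(1)] one(2)] by (simp add: m_def vals[OF z(1)])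
  define c where "c = min 1 (m z)"
  define N where "N = bd S 1"
  define M where "M = exp N + 2 + 4 * N"
  have N: "\<bar>FU s 1\<bar> \<le> N" "\<bar>FW s 1\<bar> \<le> N" "\<bar>FV s 1\<bar> \<le> N" "\<And>t. t \<in> {0..1} \<Longrightarrow> \<bar>FV s t\<bar> \<le> N" if "s \<in> {s0..S}" for s
    using family_bounded[of s S _ 1] that s0 by (auto simp: N_def)
  have N0: "N \<ge> 0" using N(1)[OF z(1)] by linarith
  have eN: "exp N \<ge> 1" using N0 by simp
  show thesis
  proof (rule that[of c M])
    fix s assume s: "s \<in> {s0..S}"
    interpret flow s "FU s" "FW s" "FV s" by (rule fl[OF s])
    note vs = vals[OF s]
    show "flow_bounds s (FU s) (FW s) (FV s) c M"
    proof unfold_locales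
      show "0 < c" "c \<le> 1" using mz by (auto simp: c_def)
      show "1 \<le> M" using eN N0 by (simp add: M_def)
      have "c \<le> m s" using z(2)[OF s] by (simp add: c_def)
      then show "c \<le> u 1" "c \<le> w 1" "c \<le> v 1" unfolding vs by (auto simp: m_def)
      have "FU s 1 \<le> N" "FW s 1 \<le> N" "FV s 1 \<le> N" using N(1-3)[OF s] by auto
      moreover have "2 * (1 + FV s 1) = 2 + 2 * FV s 1" by simp
      ultimately show "w 1 \<le> M" "v 1 \<le> M" "x 1 \<le> M"
        unfolding vs M_def using eN N0 by linarith+
      have "\<bar>J 1 (FV s) 1\<bar> \<le> N * exp (0 * 1) / (1 + 1)"
        using abs_J_le_exp[of 1 "FV s" N 0 1] N(4)[OF s] N0 cont_regular(3)[of 1] by auto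
      then have "- 2 * J 1 (FV s) 1 \<le> N" by simp
      then have "K 1 \<le> exp N" unfolding vs by simp
      then show "K 1 \<le> M" using N0 by (simp add: M_def)
    qed
  qed
qed

text \<open>The constants of the asymptotics depend on \<open>c\<close> and \<open>M\<close> alone,
  and one pair serves the whole parameter interval.\<close>

lemma uniform_tails:
  assumes s0: "0 < s0"
  obtains E d R where "d > 0" "R > 0"
    "\<And>s. s \<in> {s0..S} \<Longrightarrow> (LA s \<longlongrightarrow> Lim at_top (LA s)) at_top"
    "\<And>s. s \<in> {s0..S} \<Longrightarrow> (LB s \<longlongrightarrow> Lim at_top (LB s)) at_top"
    "\<And>s r. s \<in> {s0..S} \<Longrightarrow> r \<ge> R \<Longrightarrow> \<bar>LA s r - Lim at_top (LA s)\<bar> \<le> E * r powr (- d)"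
    "\<And>s r. s \<in> {s0..S} \<Longrightarrow> r \<ge> R \<Longrightarrow> \<bar>LB s r - Lim at_top (LB s)\<bar> \<le> E * r powr (- d)"
proof (cases "s0 \<le> S")
  case False
  then show ?thesis by (intro that[of 1 1]) auto
next
  case True
  obtain c M where fb: "\<And>s. s \<in> {s0..S} \<Longrightarrow> flow_bounds s (FU s) (FW s) (FV s) c M"
    using family_flow_bounds[OF s0] by blast
  have s0S: "s0 \<in> {s0..S}" using True by simp
  note k = flow_bounds.constants[OF fb[OF s0S]]
  have nb: "(at_top :: real filter) \<noteq> bot" by simp
  have A: "(LA s \<longlongrightarrow> Lim at_top (LA s)) at_top \<and>
      (\<forall>r\<ge>flow_bounds.R2 c M. \<bar>LA s r - Lim at_top (LA s)\<bar> \<le> flow_bounds.E c M * r powr (- flow_bounds.\<delta> c M))"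
    if s: "s \<in> {s0..S}" for s
  proof -
    interpret flow_bounds s "FU s" "FW s" "FV s" c M by (rule fb[OF s])
    obtain L where L: "(LA s \<longlongrightarrow> L) at_top" "\<And>r. r \<ge> R2 \<Longrightarrow> \<bar>LA s r - L\<bar> \<le> E * r powr (- \<delta>)"
    proof (rule tendsto_of_powr_tail[of R2 "LA s" E \<delta>])
      show "\<bar>LA s r' - LA s r\<bar> \<le> E * r powr (- \<delta>)" if "R2 \<le> r" "r \<le> r'" for r r'
        using ap_tail[OF that] by (simp add: LA_def)
    qed (use constants in auto)
    then show ?thesis using tendsto_Lim[OF nb L(1)] by auto
  qed
  have B: "(LB s \<longlongrightarrow> Lim at_top (LB s)) at_top \<and>
      (\<forall>r\<ge>flow_bounds.R2 c M. \<bar>LB s r - Lim at_top (LB s)\<bar> \<le> flow_bounds.E c M * r powr (- flow_bounds.\<delta> c M))"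
    if s: "s \<in> {s0..S}" for s
  proof -
    interpret flow_bounds s "FU s" "FW s" "FV s" c M by (rule fb[OF s])
    obtain L where L: "(LB s \<longlongrightarrow> L) at_top" "\<And>r. r \<ge> R2 \<Longrightarrow> \<bar>LB s r - L\<bar> \<le> E * r powr (- \<delta>)"
    proof (rule tendsto_of_powr_tail[of R2 "LB s" E \<delta>])
      show "\<bar>LB s r' - LB s r\<bar> \<le> E * r powr (- \<delta>)" if "R2 \<le> r" "r \<le> r'" for r r'
        using p_tail[OF that] by (simp add: LB_def)
    qed (use constants in auto)
    then show ?thesis using tendsto_Lim[OF nb L(1)] by auto
  qed
  show thesis
    by (rule that[of "flow_bounds.\<delta> c M" "flow_bounds.R2 c M" "flow_bounds.E c M"])
      (use A B k(8,10) in auto)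
qed

text \<open>Uniform limits of continuous functions on compact parameter intervals; the intervals
  from s / 2 to 2 s then give continuity at each s.\<close>

lemma limit_continuous:
  fixes D :: "real \<Rightarrow> real \<Rightarrow> real"
  assumes c: "\<And>s0 S r. \<lbrakk>0 < s0; r > 0\<rbrakk> \<Longrightarrow> continuous_on {s0..S} (\<lambda>s. D s r)"
    and t: "\<And>s0 S. 0 < s0 \<Longrightarrow> \<exists>E d R. d > 0 \<and> (\<forall>s\<in>{s0..S}. \<forall>r\<ge>R. \<bar>D s r - L s\<bar> \<le> E * r powr (- d))"
  shows "continuous_on {0<..} L"
proof -
  have *: "continuous_on {s0..S} L" if s0: "0 < s0" for s0 S
  proof (rule uniform_limit_theorem)
    show "\<forall>\<^sub>F r in at_top. continuous_on {s0..S} (\<lambda>s. D s r)"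
      using eventually_gt_at_top[of 0] by eventually_elim (rule c[OF s0])
    obtain E d R where d: "d > 0" and E: "\<forall>s\<in>{s0..S}. \<forall>r\<ge>R. \<bar>D s r - L s\<bar> \<le> E * r powr (- d)"
      using t[OF s0] by metis
    have E0: "((\<lambda>r. E * r powr (- d)) \<longlongrightarrow> 0) at_top"
      using tendsto_mult_right_zero[OF tendsto_neg_powr[OF _ filterlim_ident, of "- d"], of E] d by simp
    show "uniform_limit {s0..S} (\<lambda>r s. D s r) L at_top"
    proof (rule uniform_limitI)
      fix e :: real assume "e > 0"
      then have "\<forall>\<^sub>F r in at_top. E * r powr (- d) < e" using E0 by (rule order_tendstoD(2)[rotated])
      then show "\<forall>\<^sub>F r in at_top. \<forall>s\<in>{s0..S}. dist (D s r) (L s) < e"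
        using eventually_ge_at_top[of R]
      proof eventually_elim
        case (elim r)
        show ?case
        proof
          fix s assume "s \<in> {s0..S}"
          then have "\<bar>D s r - L s\<bar> \<le> E * r powr (- d)" using E elim(2) by blast
          then show "dist (D s r) (L s) < e" using elim(1) by (simp add: dist_real_def)
        qed
      qed
    qed
  qed simp
  show ?thesis
  proof (rule continuous_at_imp_continuous_on, intro ballI)
    fix s :: real assume "s \<in> {0<..}"
    then have "s > 0" by simp
    have "continuous_on {s / 2..2 * s} L" using \<open>s > 0\<close> by (intro *) simp
    then show "isCont L s"
      by (rule continuous_on_interior) (use \<open>s > 0\<close> in \<open>simp add: interior_atLeastAtMost_real\<close>)
  qed
qed

lemma continuous_\<phi>: "continuous_on {0<..} \<phi>" and continuous_\<psi>: "continuous_on {0<..} \<psi>"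
proof -
  have "continuous_on {0<..} (\<lambda>s. Lim at_top (LA s))"
  proof (rule limit_continuous[OF LAB_continuous(1)])
    show "\<exists>E d R. d > 0 \<and> (\<forall>s\<in>{s0..S}. \<forall>r\<ge>R. \<bar>LA s r - Lim at_top (LA s)\<bar> \<le> E * r powr (- d))"
      if "0 < s0" for s0 S
      by (rule uniform_tails[OF that, of S]) blast
  qed
  then show "continuous_on {0<..} \<phi>" unfolding \<phi>_def by (intro continuous_intros)
  have "continuous_on {0<..} (\<lambda>s. Lim at_top (LB s))"
  proof (rule limit_continuous[OF LAB_continuous(2)])
    show "\<exists>E d R. d > 0 \<and> (\<forall>s\<in>{s0..S}. \<forall>r\<ge>R. \<bar>LB s r - Lim at_top (LB s)\<bar> \<le> E * r powr (- d))"
      if "0 < s0" for s0 S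
      by (rule uniform_tails[OF that, of S]) blast
  qed
  then show "continuous_on {0<..} \<psi>" unfolding \<psi>_def by (intro continuous_intros)
qed

lemma tendsto_\<phi>_\<psi>:
  assumes s: "s > 0"
  shows "((\<lambda>r. flow.w (FW s) r * exp (flow.gW (FW s) r)) \<longlongrightarrow> \<phi> s) at_top"
    and "(flow.p (FV s) \<longlongrightarrow> \<psi> s) at_top"
proof -
  interpret flow s "FU s" "FW s" "FV s" by (rule flow_family[OF s])
  have L: "(LA s \<longlongrightarrow> Lim at_top (LA s)) at_top" "(LB s \<longlongrightarrow> Lim at_top (LB s)) at_top"
    by (rule uniform_tails[OF s, of s], simp)+
  have pos: "\<forall>\<^sub>F r::real in at_top. r > 0" by (rule eventually_gt_at_top)
  have "((\<lambda>r. exp (LA s r)) \<longlongrightarrow> \<phi> s) at_top" "((\<lambda>r. exp (LB s r)) \<longlongrightarrow> \<psi> s) at_top"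
    unfolding \<phi>_def \<psi>_def by (intro tendsto_intros L)+
  moreover have "\<forall>\<^sub>F r in at_top. exp (LA s r) = w r * exp (gW r)"
    using pos by eventually_elim (simp add: LA_def exp_add positive)
  moreover have "\<forall>\<^sub>F r in at_top. exp (LB s r) = p r"
    using pos by eventually_elim (simp add: LB_def positive)
  ultimately show "((\<lambda>r. w r * exp (gW r)) \<longlongrightarrow> \<phi> s) at_top" "(p \<longlongrightarrow> \<psi> s) at_top"
    by (auto elim: Lim_transform_eventually)
qed

lemma \<psi>_bounds:
  assumes s: "s > 0"
  shows "1 / (3 * s) \<le> (\<psi> s)\<^sup>2" "s \<ge> 2 \<Longrightarrow> (\<psi> s)\<^sup>2 \<le> 2 / s"
proof -
  \<comment> \<open>The asymptotics for a single parameter, seen as the degenerate interval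
    \<open>{s..s}\<close>.\<close>
  obtain c M where "\<And>t. t \<in> {s..s} \<Longrightarrow> flow_bounds t (FU t) (FW t) (FV t) c M"
    using family_flow_bounds[OF s] by blast
  then interpret flow_bounds s "FU s" "FW s" "FV s" c M by simp
  show "1 / (3 * s) \<le> (\<psi> s)\<^sup>2" "s \<ge> 2 \<Longrightarrow> (\<psi> s)\<^sup>2 \<le> 2 / s"
    using limit_bounds[OF tendsto_\<phi>_\<psi>(2)[OF s]] by auto
qed

lemma \<phi>_pos: "\<phi> s > 0" and \<psi>_pos: "\<psi> s > 0"
  by (simp_all add: \<phi>_def \<psi>_def)

lemma \<psi>_at_0: "filterlim \<psi> at_top (at_right 0)"
proof (rule filterlim_at_top_mono)
  show "filterlim (\<lambda>s::real. sqrt (inverse (3 * s))) at_top (at_right 0)"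
  proof (rule filterlim_compose[OF sqrt_at_top], rule filterlim_compose[OF filterlim_inverse_at_top_right])
    have "((\<lambda>s::real. 3 * s) \<longlongrightarrow> 3 * 0) (at_right 0)" by (intro tendsto_intros)
    moreover have "\<forall>\<^sub>F s::real in at_right 0. 3 * s \<in> {0<..}"
      using eventually_at_right_less[of "0::real"] by eventually_elim simp
    ultimately show "filterlim (\<lambda>s::real. 3 * s) (at_right 0) (at_right 0)"
      by (simp add: filterlim_at eventually_mono)
  qed
  show "\<forall>\<^sub>F s in at_right 0. sqrt (inverse (3 * s)) \<le> \<psi> s"
    using eventually_at_right_less[of "0::real"]
  proof eventually_elim
    case (elim s)
    show ?case
      using \<psi>_bounds(1)[OF elim] \<psi>_pos[of s] by (intro real_le_lsqrt) (auto simp: inverse_eq_divide)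
  qed
qed

lemma \<psi>_at_top: "(\<psi> \<longlongrightarrow> 0) at_top"
proof (rule Lim_null_comparison)
  show "\<forall>\<^sub>F s in at_top. norm (\<psi> s) \<le> sqrt (2 / s)"
    using eventually_ge_at_top[of 2]
  proof eventually_elim
    case (elim s)
    then show ?case using \<psi>_bounds(2)[of s] \<psi>_pos[of s] by (simp add: real_le_rsqrt)
  qed
  have "((\<lambda>s::real. sqrt (2 / s)) \<longlongrightarrow> sqrt 0) at_top"
    by (intro tendsto_real_sqrt tendsto_divide_0[OF tendsto_const] filterlim_at_top_imp_at_infinity filterlim_ident)
  then show "((\<lambda>s::real. sqrt (2 / s)) \<longlongrightarrow> 0) at_top" by simp
qed

section \<open>Smooth solutions on the half-line\<close>

lemma at_within_halfline:
  fixes r R :: real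
  assumes "r < R"
  shows "at r within {0..R} = at r within {0..}"
  by (rule at_within_nhd[of r "{..<R}"]) (use assms in auto)

lemma at_within_halfline_pos: "r > 0 \<Longrightarrow> at r within {0..} = at (r::real)"
  by (rule at_within_interior) (simp add: interior_real_atLeast)

lemma hderiv_eq:
  assumes "(f has_real_derivative D) (at r within {0..})" "r \<ge> 0"
  shows "hderiv f r = D"
proof -
  have "at r within {0..} \<noteq> bot"
  proof (cases "r = 0")
    case True then show ?thesis by (simp add: at_within_Ici_at_right)
  next
    case False then show ?thesis using assms at_within_halfline_pos[of r] by simp
  qed
  then show ?thesis
    using assms unfolding hderiv_def has_real_derivative_iff_has_vector_derivative
    by (intro vector_derivative_within)
qed

lemma hderiv_eq_at: "(f has_real_derivative D) (at r) \<Longrightarrow> r \<ge> 0 \<Longrightarrow> hderiv f r = D"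
  by (rule hderiv_eq[OF has_field_derivative_at_within])

lemma hderiv_differentiable:
  assumes "f differentiable_on {0..}" "r \<ge> 0"
  shows "(f has_real_derivative hderiv f r) (at r within {0..})"
proof -
  obtain D where "(f has_real_derivative D) (at r within {0..})"
    using assms unfolding differentiable_on_def real_differentiable_def by auto
  then show ?thesis using hderiv_eq[OF _ assms(2)] by simp
qed

section \<open>Functions of class C^n on the half-line\<close>

text \<open>The derivative is an arbitrary witness rather than \<open>hderiv\<close>, so that
  closure under products, exponentials and averaging is a plain induction;
  \<open>smooth_halfline_if_Ck\<close> returns to \<open>hderiv\<close>.\<close>

primrec Ck :: "nat \<Rightarrow> (real \<Rightarrow> real) \<Rightarrow> bool" where
  "Ck 0 f \<longleftrightarrow> continuous_on {0..} f"
| "Ck (Suc n) f \<longleftrightarrow> (\<exists>f'. (\<forall>r\<ge>0. (f has_real_derivative f' r) (at r within {0..})) \<and> Ck n f')"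

lemma Ck_cong: "Ck n f \<Longrightarrow> (\<And>r. r \<ge> 0 \<Longrightarrow> f r = g r) \<Longrightarrow> Ck n g"
proof (cases n)
  case 0
  then show "Ck n f \<Longrightarrow> (\<And>r. r \<ge> 0 \<Longrightarrow> f r = g r) \<Longrightarrow> Ck n g"
    by (auto intro: continuous_on_eq)
next
  case (Suc m)
  assume "Ck n f" and eq: "\<And>r. r \<ge> 0 \<Longrightarrow> f r = g r"
  then obtain f' where f': "\<And>r. r \<ge> 0 \<Longrightarrow> (f has_real_derivative f' r) (at r within {0..})" "Ck m f'"
    using Suc by auto
  have "(g has_real_derivative f' r) (at r within {0..})" if "r \<ge> 0" for r
    by (rule has_field_derivative_transform_within[OF f'(1)[OF that] zero_less_one]) (use that eq in auto)
  then show "Ck n g" using f'(2) Suc by auto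
qed

lemma Ck_Suc_D: "Ck (Suc n) f \<Longrightarrow> Ck n f"
proof (induction n arbitrary: f)
  case 0
  then obtain f' where "\<And>r. r \<ge> 0 \<Longrightarrow> (f has_real_derivative f' r) (at r within {0..})" by auto
  then show ?case by (auto intro: DERIV_continuous_on)
next
  case (Suc n)
  then show ?case by (metis Ck.simps(2))
qed

lemma Ck_const: "Ck n (\<lambda>r. k)"
  by (induction n arbitrary: k) (auto intro!: exI[of _ "\<lambda>r. 0"])

lemma Ck_id: "Ck n (\<lambda>r. r)"
  by (cases n) (auto intro!: exI[of _ "\<lambda>r. 1"] Ck_const)

lemma Ck_add: "Ck n f \<Longrightarrow> Ck n g \<Longrightarrow> Ck n (\<lambda>r. f r + g r)"
proof (induction n arbitrary: f g)
  case (Suc n)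
  then obtain f' g' where "\<forall>r\<ge>0. (f has_real_derivative f' r) (at r within {0..})" "Ck n f'"
    "\<forall>r\<ge>0. (g has_real_derivative g' r) (at r within {0..})" "Ck n g'" by auto
  then show ?case using Suc.IH[of f' g'] by (auto intro!: exI[of _ "\<lambda>r. f' r + g' r"] DERIV_add)
qed (auto intro: continuous_on_add)

lemma Ck_mult: "Ck n f \<Longrightarrow> Ck n g \<Longrightarrow> Ck n (\<lambda>r. f r * g r)"
proof (induction n arbitrary: f g)
  case (Suc n)
  then obtain f' g' where *: "\<forall>r\<ge>0. (f has_real_derivative f' r) (at r within {0..})" "Ck n f'"
    "\<forall>r\<ge>0. (g has_real_derivative g' r) (at r within {0..})" "Ck n g'" by auto
  have "Ck n (\<lambda>r. f' r * g r + g' r * f r)"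
    using * Suc.prems[THEN Ck_Suc_D] by (intro Ck_add Suc.IH)
  then show ?case using * by (auto intro!: exI[of _ "\<lambda>r. f' r * g r + g' r * f r"] DERIV_mult)
qed (auto intro: continuous_on_mult)

lemma Ck_power: "Ck n f \<Longrightarrow> Ck n (\<lambda>r. f r ^ k)"
  by (induction k) (auto intro: Ck_const Ck_mult)

lemma Ck_diff: "Ck n f \<Longrightarrow> Ck n g \<Longrightarrow> Ck n (\<lambda>r. f r - g r)"
  using Ck_add[of n f "\<lambda>r. (-1) * g r"] Ck_mult[OF Ck_const[of n "-1"], of g] by simp

lemma DERIV_exp_within:
  fixes f :: "real \<Rightarrow> real"
  assumes "(f has_real_derivative D) (at r within S)"
  shows "((\<lambda>r. exp (f r)) has_real_derivative exp (f r) * D) (at r within S)"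
  using assms by (auto intro!: derivative_eq_intros)

lemma Ck_exp: "Ck n f \<Longrightarrow> Ck n (\<lambda>r. exp (f r))"
proof (induction n arbitrary: f)
  case (Suc n)
  then obtain f' where *: "\<forall>r\<ge>0. (f has_real_derivative f' r) (at r within {0..})" "Ck n f'" by auto
  have "Ck n (\<lambda>r. exp (f r) * f' r)"
    using * Suc.prems[THEN Ck_Suc_D] by (intro Ck_mult Suc.IH)
  then show ?case using * by (auto intro!: exI[of _ "\<lambda>r. exp (f r) * f' r"] DERIV_exp_within)
qed (auto intro: continuous_on_exp)

lemma continuous_on_halfline:
  fixes f :: "real \<Rightarrow> real"
  shows "continuous_on {0..} f \<longleftrightarrow> (\<forall>R. continuous_on {0..R} f)"
proof
  assume "\<forall>R. continuous_on {0..R} f"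
  then have "continuous (at r within {0..}) f" if "r \<ge> 0" for r
    using that at_within_halfline[of r "r + 1"]
    unfolding continuous_on_eq_continuous_within by (metis atLeastAtMost_iff less_add_one less_imp_le)
  then show "continuous_on {0..} f" by (simp add: continuous_on_eq_continuous_within)
qed (auto elim: continuous_on_subset)

text \<open>Differentiating g (r t) in r brings out a factor t, which raises the weight by
  one.\<close>

lemma DERIV_J:
  assumes g: "\<And>r. r \<ge> 0 \<Longrightarrow> (g has_real_derivative g' r) (at r within {0..})"
    and g': "continuous_on {0..} g'" and r: "r \<ge> 0"
  shows "(J m g has_real_derivative J (Suc m) g' r) (at r within {0..})"
proof -
  have cg: "continuous_on {0..} g" using g by (auto intro: DERIV_continuous_on)
  have "((\<lambda>r. integral (cbox 0 1) (\<lambda>t. t ^ m * g (r * t))) has_real_derivative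
      integral (cbox 0 1) (\<lambda>t. t ^ Suc m * g' (r * t))) (at r within {0..})"
  proof (rule leibniz_rule_field_derivative)
    fix x t :: real assume x: "x \<in> {0..}" and t: "t \<in> cbox 0 1"
    have "((\<lambda>x. x * t) has_real_derivative t) (at x within {0..})"
      by (auto intro!: derivative_eq_intros)
    moreover have "(g has_real_derivative g' (x * t)) (at (x * t) within (\<lambda>x. x * t) ` {0..})"
      by (rule has_field_derivative_subset[OF g]) (use x t in auto)
    ultimately have "((\<lambda>x. g (x * t)) has_real_derivative g' (x * t) * t) (at x within {0..})"
      using DERIV_image_chain[of g "g' (x * t)" "\<lambda>x. x * t" x "{0..}" t] by (simp add: o_def)
    from DERIV_cmult[OF this, of "t ^ m"]
    show "((\<lambda>x. t ^ m * g (x * t)) has_real_derivative t ^ Suc m * g' (x * t)) (at x within {0..})"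
      by (simp add: mult_ac)
  next
    fix x :: real assume "x \<in> {0..}"
    then show "(\<lambda>t. t ^ m * g (x * t)) integrable_on cbox 0 1"
      using J_integrable[of x g x m] continuous_on_subset[OF cg] by auto
  next
    show "continuous_on ({0..} \<times> cbox 0 1) (\<lambda>(x, t). t ^ Suc m * g' (x * t))"
      unfolding split_def
      by (intro continuous_intros continuous_on_compose2[OF g']) auto
  qed (use r in auto)
  then show ?thesis by (simp add: J_def[abs_def])
qed

lemma Ck_J: "Ck n g \<Longrightarrow> Ck n (J m g)"
proof (induction n arbitrary: m g)
  case 0
  then show ?case unfolding Ck.simps continuous_on_halfline by (auto intro: continuous_on_J)
next
  case (Suc n)
  then obtain g' where *: "\<And>r. r \<ge> 0 \<Longrightarrow> (g has_real_derivative g' r) (at r within {0..})" "Ck n g'" by auto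
  then have "continuous_on {0..} g'" by (cases n) (auto intro: DERIV_continuous_on)
  then show ?case using * DERIV_J[OF *(1)] Suc.IH[OF *(2)] by (auto intro!: exI[of _ "J (Suc m) g'"])
qed

lemma smooth_halfline_if_Ck:
  assumes "\<And>n. Ck n f"
  shows "smooth_halfline f"
proof -
  have "\<forall>k. Ck k ((hderiv ^^ n) f)" for n
  proof (induction n)
    case (Suc n)
    show ?case
    proof
      fix k
      obtain g where g: "\<forall>r\<ge>0. ((hderiv ^^ n) f has_real_derivative g r) (at r within {0..})" "Ck k g"
        using Suc.IH by (meson Ck.simps(2))
      then have "hderiv ((hderiv ^^ n) f) r = g r" if "r \<ge> 0" for r
        using hderiv_eq that by blast
      then show "Ck k ((hderiv ^^ Suc n) f)" using Ck_cong[OF g(2)] by simp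
    qed
  qed (use assms in auto)
  then have *: "Ck (Suc 0) ((hderiv ^^ n) f)" for n by blast
  show ?thesis
    unfolding smooth_halfline_def differentiable_on_def real_differentiable_def
  proof (intro allI ballI)
    fix n and r :: real assume "r \<in> {0..}"
    then show "\<exists>D. ((hderiv ^^ n) f has_real_derivative D) (at r within {0..})"
      using *[of n] unfolding Ck.simps by auto
  qed
qed

lemma DERIV_r_mult_at_0:
  assumes "continuous_on {0..} f"
  shows "((\<lambda>r. r * f r) has_real_derivative f 0) (at 0 within {0..})"
proof -
  have "(f \<longlongrightarrow> f 0) (at 0 within {0..})" using assms by (simp add: continuous_on_def)
  moreover have "\<forall>\<^sub>F y in at 0 within {0..}. f y = (y * f y - 0 * f 0) / (y - 0)"
    by (auto simp: eventually_at_filter)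
  ultimately show ?thesis
    unfolding has_field_derivative_iff by (rule Lim_transform_eventually)
qed

text \<open>The derivative e / r of \<open>f\<close> may be singular at 0. The factor r^2 cures
  this, and the new derivative involves only \<open>f\<close> and \<open>e\<close>, which is the
  source of the gain of regularity.\<close>

lemma DERIV_r2_mult:
  assumes f: "continuous_on {0..} f" and D: "\<And>r. r > 0 \<Longrightarrow> (f has_real_derivative e r / r) (at r)" and r: "r \<ge> 0"
  shows "((\<lambda>r. r\<^sup>2 * f r) has_real_derivative 2 * r * f r + r * e r) (at r within {0..})"
proof (cases "r = 0")
  case True
  have "continuous_on {0..} (\<lambda>r. r * f r)" by (intro continuous_intros f)
  from DERIV_r_mult_at_0[OF this] show ?thesis using True by (simp add: power2_eq_square mult.assoc)
next
  case False
  then have r0: "r > 0" using r by simp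
  have "((\<lambda>r. r\<^sup>2 * f r) has_real_derivative 2 * r * f r + e r / r * r\<^sup>2) (at r)"
    by (rule DERIV_mult[OF _ D[OF r0]]) (auto intro!: derivative_eq_intros)
  moreover have "e r / r * r\<^sup>2 = r * e r" using r0 by (simp add: power2_eq_square)
  ultimately show ?thesis using has_field_derivative_at_within by (simp only:)
qed

section \<open>Regularity of the flow and verification of the soliton equations\<close>

context flow
begin

lemma regular_derivs:
  assumes "r > 0"
  shows "(U has_real_derivative (GU s U (\<lambda>t. N1 (U t) (W t) (V t)) r - 3 * U r) / r) (at r)"
    and "(W has_real_derivative (GW (\<lambda>t. N2 (U t) (W t) (V t)) r - 3 * W r) / r) (at r)"
    and "(V has_real_derivative (GV s U W (\<lambda>t. N3 (U t) (W t) (V t)) r - 3 * V r) / r) (at r)"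
proof -
  have rR: "r \<in> {0<..r + 1}" and R: "r + 1 \<ge> 0" and at: "at r within {0..r + 1} = at r"
    using assms by (auto intro: at_within_Icc_at)
  from sol_derivs(1-3)[OF sol[OF R] rR, unfolded at] show
    "(U has_real_derivative (GU s U (\<lambda>t. N1 (U t) (W t) (V t)) r - 3 * U r) / r) (at r)"
    "(W has_real_derivative (GW (\<lambda>t. N2 (U t) (W t) (V t)) r - 3 * W r) / r) (at r)"
    "(V has_real_derivative (GV s U W (\<lambda>t. N3 (U t) (W t) (V t)) r - 3 * V r) / r) (at r)" .
qed

lemma regular_eqs:
  assumes "r \<ge> 0"
  shows "U r = J 2 (GU s U (\<lambda>t. N1 (U t) (W t) (V t))) r"
    "W r = J 2 (GW (\<lambda>t. N2 (U t) (W t) (V t))) r"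
    "V r = J 2 (GV s U W (\<lambda>t. N3 (U t) (W t) (V t))) r"
  using sol_eqs[OF sol[OF assms], of r] assms by auto

lemma cont_halfline: "continuous_on {0..} U" "continuous_on {0..} W" "continuous_on {0..} V"
  using cont_regular by (auto simp: continuous_on_halfline)

text \<open>Bootstrapping: \<open>r U'\<close>, \<open>r W'\<close>, \<open>r V'\<close> are as regular as \<open>U\<close>, \<open>W\<close>, \<open>V\<close> by the equations, and the
  nonlinear terms carry a factor \<open>r\<^sup>2\<close>; the averaging operator commutes with differentiation.\<close>
lemma Ck_regular: "Ck n U \<and> Ck n W \<and> Ck n V"
proof (induction n)
  case 0
  then show ?case using cont_halfline by simp
next
  case (Suc n)
  then have C: "Ck n U" "Ck n W" "Ck n V" by auto
  \<comment> \<open>\<open>eU\<close>, \<open>eW\<close>, \<open>eV\<close> are r U', r W', r V';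
    the equations make them as regular as U, W, V.\<close>
  define eU where "eU r = GU s U (\<lambda>t. N1 (U t) (W t) (V t)) r - 3 * U r" for r
  define eW where "eW r = GW (\<lambda>t. N2 (U t) (W t) (V t)) r - 3 * W r" for r
  define eV where "eV r = GV s U W (\<lambda>t. N3 (U t) (W t) (V t)) r - 3 * V r" for r
  note intro = Ck_add Ck_diff Ck_mult Ck_const Ck_id Ck_power Ck_J C
  have Ce: "Ck n eU" "Ck n eW" "Ck n eV"
    unfolding eU_def eW_def eV_def GU_def GW_def GV_def N1_def N2_def N3_def divide_inverse
    by (intro intro)+
  have D: "(U has_real_derivative eU r / r) (at r)" "(W has_real_derivative eW r / r) (at r)"
    "(V has_real_derivative eV r / r) (at r)" if "r > 0" for r
    using regular_derivs[OF that] by (simp_all add: eU_def eW_def eV_def)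
  define n1 where "n1 r = (eU r + eW r + 2 * eV r) * U r + eU r * (U r + W r + 2 * V r)" for r
  define n2 where "n2 r = (eU r + eW r + 2 * eV r) * W r + eW r * (U r + W r + 2 * V r)" for r
  define n3 where "n3 r = U r * eU r + (eU r * W r + eW r * U r)
      + (eV r * (U r + W r) + (eU r + eW r) * V r) - 2 * V r * eV r" for r
  have Cn: "Ck n n1" "Ck n n2" "Ck n n3"
    unfolding n1_def n2_def n3_def by (intro intro Ce)+
  have dn: "((\<lambda>r. N1 (U r) (W r) (V r)) has_real_derivative n1 r / r) (at r)"
    "((\<lambda>r. N2 (U r) (W r) (V r)) has_real_derivative n2 r / r) (at r)"
    "((\<lambda>r. N3 (U r) (W r) (V r)) has_real_derivative n3 r / r) (at r)" if r: "r > 0" for r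
  proof -
    note d = D[OF r]
    note S = DERIV_add[OF DERIV_add[OF d(1,2)] DERIV_cmult[OF d(3), of 2]]
    show "((\<lambda>r. N1 (U r) (W r) (V r)) has_real_derivative n1 r / r) (at r)"
      unfolding N1_def n1_def using DERIV_mult[OF S d(1)] by (simp add: add_divide_distrib algebra_simps)
    show "((\<lambda>r. N2 (U r) (W r) (V r)) has_real_derivative n2 r / r) (at r)"
      unfolding N2_def n2_def using DERIV_mult[OF S d(2)] by (simp add: add_divide_distrib algebra_simps)
    have "((\<lambda>r. (U r * U r) / 2 + U r * W r + V r * (U r + W r) - V r * V r) has_real_derivative
        (eU r / r * U r + eU r / r * U r) / 2 + (eU r / r * W r + eW r / r * U r)
        + (eV r / r * (U r + W r) + (eU r / r + eW r / r) * V r) - (eV r / r * V r + eV r / r * V r)) (at r)"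
      by (intro DERIV_add DERIV_diff DERIV_mult DERIV_cdivide d)
    then show "((\<lambda>r. N3 (U r) (W r) (V r)) has_real_derivative n3 r / r) (at r)"
      unfolding N3_def n3_def by (simp add: add_divide_distrib diff_divide_distrib power2_eq_square algebra_simps)
  qed
  have cN: "continuous_on {0..} (\<lambda>r. N1 (U r) (W r) (V r))" "continuous_on {0..} (\<lambda>r. N2 (U r) (W r) (V r))"
    "continuous_on {0..} (\<lambda>r. N3 (U r) (W r) (V r))"
    by (intro continuous_on_N cont_halfline)+
  have dN: "((\<lambda>r. r\<^sup>2 * N1 (U r) (W r) (V r)) has_real_derivative 2 * r * N1 (U r) (W r) (V r) + r * n1 r) (at r within {0..})"
    "((\<lambda>r. r\<^sup>2 * N2 (U r) (W r) (V r)) has_real_derivative 2 * r * N2 (U r) (W r) (V r) + r * n2 r) (at r within {0..})"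
    "((\<lambda>r. r\<^sup>2 * N3 (U r) (W r) (V r)) has_real_derivative 2 * r * N3 (U r) (W r) (V r) + r * n3 r) (at r within {0..})"
    if "r \<ge> 0" for r
    using that by (intro DERIV_r2_mult cN dn; simp)+
  have dh: "((\<lambda>r. r\<^sup>2 * J 1 U r) has_real_derivative r * U r) (at r within {0..})" if "r \<ge> 0" for r
    using has_real_derivative_power_mult_J[OF cont_regular(1)[of "r + 1"], of r 1] that
      at_within_halfline[of r "r + 1"] by (simp add: power2_eq_square)
  \<comment> \<open>\<open>gu\<close> and \<open>gw\<close> are the derivatives of \<open>GU\<close>
    and \<open>GW\<close>. The quadratic terms enter as r^2 N, so both are again of class C^n, and
    U' = J 3 gu shows that U has one derivative more.\<close>
  define gu where "gu r = 2 * (r * U r) - (2 * r * N1 (U r) (W r) (V r) + r * n1 r)" for r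
  define gw where "gw r = 0 - (2 * r * N2 (U r) (W r) (V r) + r * n2 r)" for r
  have Cg: "Ck n gu" "Ck n gw"
    unfolding gu_def gw_def N1_def N2_def by (intro intro Cn)+
  have c_of: "continuous_on {0..} f" if "Ck n f" for f
    using that by (cases n) (auto intro: DERIV_continuous_on)
  have dU: "(U has_real_derivative J 3 gu r) (at r within {0..})" if r: "r \<ge> 0" for r
  proof (rule has_field_derivative_transform_within[OF _ zero_less_one])
    have "(GU s U (\<lambda>t. N1 (U t) (W t) (V t)) has_real_derivative gu r) (at r within {0..})" if "r \<ge> 0" for r
      unfolding GU_def[abs_def] gu_def
      using DERIV_diff[OF DERIV_add[OF DERIV_const DERIV_cmult[OF dh[OF that]]] dN(1)[OF that]] by simp
    from DERIV_J[OF this c_of[OF Cg(1)] r, of 2]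
    show "(J 2 (GU s U (\<lambda>t. N1 (U t) (W t) (V t))) has_real_derivative J 3 gu r) (at r within {0..})"
      by (simp add: numeral_3_eq_3)
  qed (use r regular_eqs(1) in auto)
  have dW: "(W has_real_derivative J 3 gw r) (at r within {0..})" if r: "r \<ge> 0" for r
  proof (rule has_field_derivative_transform_within[OF _ zero_less_one])
    have "(GW (\<lambda>t. N2 (U t) (W t) (V t)) has_real_derivative gw r) (at r within {0..})" if "r \<ge> 0" for r
      unfolding GW_def[abs_def] gw_def
      by (rule DERIV_diff[OF DERIV_const dN(2)[OF that]])
    from DERIV_J[OF this c_of[OF Cg(2)] r, of 2]
    show "(J 2 (GW (\<lambda>t. N2 (U t) (W t) (V t))) has_real_derivative J 3 gw r) (at r within {0..})"
      by (simp add: numeral_3_eq_3)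
  qed (use r regular_eqs(2) in auto)
  \<comment> \<open>\<open>GV\<close> contains U + W without a factor r^2. Its derivative therefore
    uses the derivatives of U and W just obtained.\<close>
  define gv where "gv r = J 3 gu r + J 3 gw r - 0 - r * U r + (2 * r * N3 (U r) (W r) (V r) + r * n3 r)" for r
  have Cgv: "Ck n gv"
    unfolding gv_def N3_def divide_inverse by (intro intro Cn Cg)
  have dV: "(V has_real_derivative J 3 gv r) (at r within {0..})" if r: "r \<ge> 0" for r
  proof (rule has_field_derivative_transform_within[OF _ zero_less_one])
    have "(GV s U W (\<lambda>t. N3 (U t) (W t) (V t)) has_real_derivative gv r) (at r within {0..})" if "r \<ge> 0" for r
      unfolding GV_def[abs_def] gv_def
      by (rule DERIV_add[OF DERIV_diff[OF DERIV_diff[OF DERIV_add[OF dU[OF that] dW[OF that]] DERIV_const] dh[OF that]] dN(3)[OF that]])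
    from DERIV_J[OF this c_of[OF Cgv] r, of 2]
    show "(J 2 (GV s U W (\<lambda>t. N3 (U t) (W t) (V t))) has_real_derivative J 3 gv r) (at r within {0..})"
      by (simp add: numeral_3_eq_3)
  qed (use r regular_eqs(3) in auto)
  show ?case
    using dU dW dV Ck_J[OF Cg(1), of 3] Ck_J[OF Cg(2), of 3] Ck_J[OF Cgv, of 3] unfolding Ck.simps by blast
qed

definition a where "a a0 r = a0 * exp (gW r)"

lemma solution_derivs:
  assumes r: "r \<ge> 0"
  shows "hderiv (a a0) r = a0 * exp (gW r) * w r" "hderiv b r = p r" "hderiv (\<lambda>r. - h r) r = - u r"
    and "r > 0 \<Longrightarrow> hderiv (hderiv (a a0)) r = a0 * exp (gW r) * ((w r)\<^sup>2 + 1 - x r * w r)"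
    and "r > 0 \<Longrightarrow> hderiv (hderiv b) r = (1 - (p r)\<^sup>2) / b r - (w r + u r) * p r + b r"
    and "r > 0 \<Longrightarrow> hderiv (hderiv (\<lambda>r. - h r)) r = - (2 * h r + 3 * s - x r * u r)"
    and "hderiv (hderiv (\<lambda>r. - h r)) 0 = - s"
proof -
  have g: "(h has_real_derivative r * U r) (at r within {0..})" "(gW has_real_derivative r * W r) (at r within {0..})"
    "(gV has_real_derivative r * V r) (at r within {0..})" if "r \<ge> 0" for r
    using has_real_derivative_power_mult_J[OF cont_regular(1)[of "r + 1"], of r 1]
      has_real_derivative_power_mult_J[OF cont_regular(2)[of "r + 1"], of r 1]
      has_real_derivative_power_mult_J[OF cont_regular(3)[of "r + 1"], of r 1] that
      at_within_halfline[of r "r + 1"]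
    by (simp_all add: power2_eq_square h_def[abs_def] gW_def[abs_def] gV_def[abs_def])
  have 1: "hderiv (a a0) r = a0 * exp (gW r) * w r" if "r \<ge> 0" for r
  proof (rule hderiv_eq[OF _ that])
    show "(a a0 has_real_derivative a0 * exp (gW r) * w r) (at r within {0..})"
      unfolding a_def[abs_def] w_def
      using DERIV_cmult[OF DERIV_exp_within[OF g(2)[OF that]], of a0] by (simp add: mult.assoc)
  qed
  have 2: "hderiv b r = p r" if "r \<ge> 0" for r
  proof (rule hderiv_eq[OF _ that])
    have "(b has_real_derivative 1 * exp (gV r) + exp (gV r) * (r * V r) * r) (at r within {0..})"
      unfolding b_def[abs_def] by (rule DERIV_mult[OF DERIV_ident DERIV_exp_within[OF g(3)[OF that]]])
    then show "(b has_real_derivative p r) (at r within {0..})"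
      by (simp add: p_def power2_eq_square algebra_simps)
  qed
  have 3: "hderiv (\<lambda>r. - h r) r = - u r" if "r \<ge> 0" for r
    unfolding u_def by (rule hderiv_eq[OF DERIV_minus[OF g(1)[OF that]] that])
  show "hderiv (a a0) r = a0 * exp (gW r) * w r" "hderiv b r = p r" "hderiv (\<lambda>r. - h r) r = - u r"
    using 1 2 3 r by auto
  have tr: "hderiv f r = D" if "r > 0" "(g has_real_derivative D) (at r)" "\<And>t. t \<ge> 0 \<Longrightarrow> f t = g t" for f g D
  proof (rule hderiv_eq_at)
    show "(f has_real_derivative D) (at r)"
      by (rule has_field_derivative_transform_within_open[OF that(2), of "{0<..}"]) (use that in auto)
  qed fact
  show "hderiv (hderiv (a a0)) r = a0 * exp (gW r) * ((w r)\<^sup>2 + 1 - x r * w r)" if r0: "r > 0"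
  proof (rule tr[OF r0 _ 1])
    have "((\<lambda>t. a0 * exp (gW t) * w t) has_real_derivative
        a0 * (exp (gW r) * w r) * w r + (1 - x r * w r) * (a0 * exp (gW r))) (at r)"
      by (rule DERIV_mult[OF DERIV_cmult[OF DERIV_exp_within[OF derivs(3)[OF r0]]] derivs(5)[OF r0]])
    then show "((\<lambda>t. a0 * exp (gW t) * w t) has_real_derivative a0 * exp (gW r) * ((w r)\<^sup>2 + 1 - x r * w r)) (at r)"
      by (simp add: power2_eq_square algebra_simps)
  qed
  show "hderiv (hderiv b) r = (1 - (p r)\<^sup>2) / b r - (w r + u r) * p r + b r" if r0: "r > 0"
    by (rule tr[OF r0 p_deriv[OF r0] 2])
  show "hderiv (hderiv (\<lambda>r. - h r)) r = - (2 * h r + 3 * s - x r * u r)" if r0: "r > 0"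
    by (rule tr[OF r0 DERIV_minus[OF derivs(4)[OF r0]] 3])
  have "((\<lambda>r. - u r) has_real_derivative - s) (at 0 within {0..})"
    using DERIV_minus[OF DERIV_r_mult_at_0[OF cont_halfline(1)]] at_0(1) by (simp add: u_def[abs_def])
  then have "(hderiv (\<lambda>r. - h r) has_real_derivative - s) (at 0 within {0..})"
    by (rule has_field_derivative_transform_within[OF _ zero_less_one]) (use 3 in auto)
  then show "hderiv (hderiv (\<lambda>r. - h r)) 0 = - s" by (rule hderiv_eq) simp
qed

lemma is_expander:
  assumes a0: "a0 > 0"
  shows "expander_system (a a0) b (\<lambda>r. - h r)" "S1_R3_boundary_conditions a0 (- s) (a a0) b (\<lambda>r. - h r)"
proof -
  note intro = Ck_add Ck_diff Ck_mult Ck_const Ck_id Ck_power Ck_J Ck_exp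
  have C: "Ck n U" "Ck n W" "Ck n V" for n using Ck_regular by blast+
  have "Ck n (a a0)" for n unfolding a_def[abs_def] gW_def by (intro intro C)
  then have s1: "smooth_halfline (a a0)" by (rule smooth_halfline_if_Ck)
  have "Ck n b" for n unfolding b_def[abs_def] gV_def by (intro intro C)
  then have s2: "smooth_halfline b" by (rule smooth_halfline_if_Ck)
  have "Ck n (\<lambda>r. 0 - h r)" for n unfolding h_def by (intro intro C)
  then have s3: "smooth_halfline (\<lambda>r. - h r)" by (intro smooth_halfline_if_Ck) simp
  show "expander_system (a a0) b (\<lambda>r. - h r)"
    unfolding expander_system_def
  proof (intro conjI s1 s2 s3 allI impI)
    fix r :: real assume r: "r > 0"
    then have r': "r \<ge> 0" by simp
    note sd = solution_derivs[OF r'] and ps = positive[OF r] and d = derivs[OF r]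
    let ?A = "a0 * exp (gW r)"
    have A: "a a0 r = ?A" "?A > 0" using a0 by (simp_all add: a_def)
    show "a a0 r > 0" "b r > 0" using A ps by simp_all
    have aa: "?A * X / ?A = X" for X using A(2) by (intro nonzero_mult_div_cancel_left) linarith
    have bb: "((1 - (p r)\<^sup>2) / b r - (w r + u r) * p r + b r) / b r = K r - (v r)\<^sup>2 - (w r + u r) * v r + 1"
    proof -
      have "1 / (b r)\<^sup>2 = K r" using b_K[OF r] ps by (simp add: field_simps)
      then show ?thesis using ps unfolding d(9) by (simp add: power2_eq_square field_simps)
    qed
    show "hderiv (hderiv (\<lambda>r. - h r)) r = hderiv (hderiv (a a0)) r / a a0 r + 2 * (hderiv (hderiv b) r / b r) - 1"
    proof -
      \<comment> \<open>After substitution of the second derivatives, the soliton equation for f''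
        is the algebraic conservation law.\<close>
      have "x r * x r = (w r)\<^sup>2 + 2 * (v r)\<^sup>2 + 2 * K r + 2 + 2 * h r + 3 * s"
        using x_square[OF r] by (simp add: power2_eq_square)
      moreover have "x r * x r = x r * u r + x r * w r + 2 * (x r * v r)"
        by (simp add: x_def algebra_simps)
      moreover have "x r * v r = (w r + u r) * v r + 2 * (v r)\<^sup>2"
        by (simp add: x_def power2_eq_square algebra_simps)
      ultimately show ?thesis
        unfolding sd(4-6)[OF r] A(1) aa bb by simp
    qed
    show "hderiv (hderiv (a a0)) r = - 2 * (hderiv (a a0) r * hderiv b r / b r) + hderiv (a a0) r * hderiv (\<lambda>r. - h r) r + a a0 r"
    proof -
      have "p r / b r = v r" using d(9) ps by simp
      then have "hderiv (a a0) r * hderiv b r / b r = ?A * w r * v r"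
        unfolding sd(1,2) by (metis times_divide_eq_right)
      then show ?thesis unfolding sd(4)[OF r] sd(1,3) A(1)
        by (simp add: x_def power2_eq_square algebra_simps)
    qed
    show "hderiv (hderiv b) r = (1 - (hderiv b r)\<^sup>2) / b r - hderiv (a a0) r * hderiv b r / a a0 r
        + hderiv b r * hderiv (\<lambda>r. - h r) r + b r"
    proof -
      have "?A * w r * p r / ?A = w r * p r" using aa[of "w r * p r"] by (simp only: mult.assoc)
      then show ?thesis unfolding sd(5)[OF r] sd(1-3) A(1) by (simp add: algebra_simps)
    qed
  qed
  show "S1_R3_boundary_conditions a0 (- s) (a a0) b (\<lambda>r. - h r)"
    unfolding S1_R3_boundary_conditions_def
    using solution_derivs[of 0] by (simp add: a_def b_def p_def u_def w_def at_0)
qed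

end

section \<open>Every soliton solves the regularised equations\<close>

text \<open>The uniqueness half of the description in \<open>expander_map\<close>: an arbitrary
  smooth soliton with the given boundary data, to be identified with the constructed flow.\<close>

locale expander =
  fixes a b f :: "real \<Rightarrow> real" and a0 s :: real
  assumes sys: "expander_system a b f" and bc: "S1_R3_boundary_conditions a0 (- s) a b f"
    and a0: "a0 > 0" and s0: "s > 0"
begin

abbreviation "a1 \<equiv> hderiv a"
abbreviation "a2 \<equiv> hderiv a1"
abbreviation "b1 \<equiv> hderiv b"
abbreviation "b2 \<equiv> hderiv b1"
abbreviation "b3 \<equiv> hderiv b2"
abbreviation "f1 \<equiv> hderiv f"
abbreviation "f2 \<equiv> hderiv f1"

lemma smooth_derivs:
  assumes "r \<ge> 0"
  shows "(a has_real_derivative a1 r) (at r within {0..})" "(a1 has_real_derivative a2 r) (at r within {0..})"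
    "(b has_real_derivative b1 r) (at r within {0..})" "(b1 has_real_derivative b2 r) (at r within {0..})"
    "(b2 has_real_derivative b3 r) (at r within {0..})"
    "(f has_real_derivative f1 r) (at r within {0..})" "(f1 has_real_derivative f2 r) (at r within {0..})"
proof -
  have *: "((hderiv ^^ n) g has_real_derivative hderiv ((hderiv ^^ n) g) r) (at r within {0..})"
    if "smooth_halfline g" for g n
    using that assms by (intro hderiv_differentiable) (auto simp: smooth_halfline_def)
  have sm: "smooth_halfline a" "smooth_halfline b" "smooth_halfline f"
    using sys by (auto simp: expander_system_def)
  show "(a has_real_derivative a1 r) (at r within {0..})" "(a1 has_real_derivative a2 r) (at r within {0..})"
    "(b has_real_derivative b1 r) (at r within {0..})" "(b1 has_real_derivative b2 r) (at r within {0..})"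
    "(b2 has_real_derivative b3 r) (at r within {0..})"
    "(f has_real_derivative f1 r) (at r within {0..})" "(f1 has_real_derivative f2 r) (at r within {0..})"
    using *[OF sm(1), of 0] *[OF sm(1), of 1] *[OF sm(2), of 0] *[OF sm(2), of 1] *[OF sm(2), of 2]
      *[OF sm(3), of 0] *[OF sm(3), of 1] by (simp_all add: numeral_2_eq_2)
qed

lemma derivs_at:
  assumes "r > 0"
  shows "(a has_real_derivative a1 r) (at r)" "(a1 has_real_derivative a2 r) (at r)"
    "(b has_real_derivative b1 r) (at r)" "(b1 has_real_derivative b2 r) (at r)"
    "(f has_real_derivative f1 r) (at r)" "(f1 has_real_derivative f2 r) (at r)"
  using smooth_derivs[OF less_imp_le[OF assms]] unfolding at_within_halfline_pos[OF assms] by auto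

lemma smooth_continuous:
  "continuous_on {0..} a" "continuous_on {0..} a1" "continuous_on {0..} b" "continuous_on {0..} b1"
  "continuous_on {0..} b2" "continuous_on {0..} f" "continuous_on {0..} f1"
  by (rule DERIV_continuous_on, rule smooth_derivs, simp)+

lemma initial: "a 0 = a0" "a1 0 = 0" "b 0 = 0" "b1 0 = 1" "f 0 = 0" "f1 0 = 0" "f2 0 = - s"
  using bc by (auto simp: S1_R3_boundary_conditions_def)

lemma eqs:
  assumes "r > 0"
  shows "a r > 0" "b r > 0" "f2 r = a2 r / a r + 2 * (b2 r / b r) - 1"
    "a2 r = - 2 * (a1 r * b1 r / b r) + a1 r * f1 r + a r"
    "b2 r = (1 - (b1 r)\<^sup>2) / b r - a1 r * b1 r / a r + b1 r * f1 r + b r"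
  using sys assms by (auto simp: expander_system_def)

lemma at_right: "at 0 within {0..} = at_right (0::real)"
  by (rule at_within_Ici_at_right)

lemma tendsto_0:
  "(a \<longlongrightarrow> a0) (at_right 0)" "(a1 \<longlongrightarrow> 0) (at_right 0)" "(b \<longlongrightarrow> 0) (at_right 0)" "(b1 \<longlongrightarrow> 1) (at_right 0)"
  "(b2 \<longlongrightarrow> b2 0) (at_right 0)" "(f \<longlongrightarrow> 0) (at_right 0)" "(f1 \<longlongrightarrow> 0) (at_right 0)"
  using smooth_continuous initial by (simp_all add: continuous_on_def flip: at_right) (metis atLeast_iff order_refl)+

lemma quotients_0:
  "((\<lambda>r. a1 r / r) \<longlongrightarrow> a2 0) (at_right 0)" "((\<lambda>r. b r / r) \<longlongrightarrow> 1) (at_right 0)"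
  "((\<lambda>r. (b1 r - 1) / r) \<longlongrightarrow> b2 0) (at_right 0)" "((\<lambda>r. (b2 r - b2 0) / r) \<longlongrightarrow> b3 0) (at_right 0)"
  "((\<lambda>r. f1 r / r) \<longlongrightarrow> - s) (at_right 0)"
  using smooth_derivs[of 0] initial by (simp_all add: has_field_derivative_iff at_right)

lemma pos_at_right: "\<forall>\<^sub>F r::real in at_right 0. r > 0"
  by (rule eventually_at_right_less)

text \<open>In the equation for b'' the quotient (1 - b'^2) / b tends to - 2 b''(0) and the other
  terms vanish at 0, so b''(0) = - 2 b''(0). A nonzero value would give V a pole at 0.\<close>

lemma b2_0: "b2 0 = 0"
proof -
  have "((\<lambda>r. - ((b1 r - 1) / r) * (1 + b1 r) / (b r / r) - a1 r * b1 r / a r + b1 r * f1 r + b r)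
     \<longlongrightarrow> - b2 0 * (1 + 1) / 1 - 0 * 1 / a0 + 1 * 0 + 0) (at_right 0)"
    using a0 by (intro tendsto_intros tendsto_0 quotients_0) auto
  moreover have "\<forall>\<^sub>F r in at_right 0. - ((b1 r - 1) / r) * (1 + b1 r) / (b r / r) - a1 r * b1 r / a r + b1 r * f1 r + b r = b2 r"
    using pos_at_right
  proof eventually_elim
    case (elim r)
    have "- ((b1 r - 1) / r) * (1 + b1 r) / (b r / r) = (1 - (b1 r)\<^sup>2) / b r"
      using elim eqs(2)[OF elim] by (simp add: field_simps power2_eq_square)
    then show ?case using eqs(5)[OF elim] by simp
  qed
  ultimately have "(b2 \<longlongrightarrow> - b2 0 * (1 + 1) / 1 - 0 * 1 / a0 + 1 * 0 + 0) (at_right 0)"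
    by (rule Lim_transform_eventually)
  then have "- b2 0 * (1 + 1) / 1 - 0 * 1 / a0 + 1 * 0 + 0 = b2 0"
    using tendsto_0(5) tendsto_unique trivial_limit_at_right_real by blast
  then show ?thesis by simp
qed

text \<open>The values at 0 are the limits, read off from Taylor coefficients of f, a and b; they
  make U, W, V continuous on the closed half-line, as \<open>sol\<close> demands.\<close>

definition U where "U r = (if r = 0 then s else - f1 r / r)"
definition W where "W r = (if r = 0 then a2 0 / a0 else a1 r / a r / r)"
definition V where "V r = (if r = 0 then b3 0 / 3 else (r * b1 r - b r) / (r\<^sup>2 * b r))"

lemma continuous_on_if_0:
  assumes "continuous_on {0<..} g" "(g \<longlongrightarrow> l) (at_right 0)"
  shows "continuous_on {0..} (\<lambda>r::real. if r = 0 then l else (g r :: real))"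
  unfolding continuous_on_def
proof
  fix r :: real assume r: "r \<in> {0..}"
  show "((\<lambda>r. if r = 0 then l else g r) \<longlongrightarrow> (if r = 0 then l else g r)) (at r within {0..})"
  proof (cases "r = 0")
    case True
    have "\<forall>\<^sub>F t in at_right 0. g t = (if t = 0 then l else g t)"
      using pos_at_right by eventually_elim simp
    then show ?thesis using True assms(2) Lim_transform_eventually by (fastforce simp: at_right)
  next
    case False
    then have r0: "r > 0" using r by simp
    then have "(g \<longlongrightarrow> g r) (at r)"
      using assms(1) by (simp add: continuous_on_eq_continuous_at isCont_def)
    moreover have "\<forall>\<^sub>F t in at r. g t = (if t = 0 then l else g t)"
      by (rule eventually_mono[OF eventually_at_in_open'[of "{0<..}" r]]) (use r0 in auto)
    ultimately show ?thesis using False r0 Lim_transform_eventually by (fastforce simp: at_within_halfline_pos)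
  qed
qed

lemma continuous_UWV: "continuous_on {0..} U" "continuous_on {0..} W" "continuous_on {0..} V"
proof -
  have c: "continuous_on {0<..} g" if "continuous_on {0..} g" for g :: "real \<Rightarrow> real"
    by (rule continuous_on_subset[OF that]) auto
  note cs = smooth_continuous[THEN c]
  have nz: "a r \<noteq> 0" "b r \<noteq> 0" if "r > 0" for r using eqs(1,2)[OF that] by auto
  show "continuous_on {0..} U" unfolding U_def[abs_def]
  proof (rule continuous_on_if_0)
    show "continuous_on {0<..} (\<lambda>r. - f1 r / r)" by (intro continuous_intros cs) auto
    show "((\<lambda>r. - f1 r / r) \<longlongrightarrow> s) (at_right 0)" using tendsto_minus[OF quotients_0(5)] by simp
  qed
  show "continuous_on {0..} W" unfolding W_def[abs_def]
  proof (rule continuous_on_if_0)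
    show "continuous_on {0<..} (\<lambda>r. a1 r / a r / r)" using nz by (intro continuous_intros cs) auto
    have "((\<lambda>r. a1 r / r / a r) \<longlongrightarrow> a2 0 / a0) (at_right 0)"
      using a0 by (intro tendsto_intros quotients_0 tendsto_0) auto
    then show "((\<lambda>r. a1 r / a r / r) \<longlongrightarrow> a2 0 / a0) (at_right 0)" by (simp add: mult.commute)
  qed
  show "continuous_on {0..} V" unfolding V_def[abs_def]
  proof (rule continuous_on_if_0)
    show "continuous_on {0<..} (\<lambda>r. (r * b1 r - b r) / (r\<^sup>2 * b r))" using nz by (intro continuous_intros cs) auto
    \<comment> \<open>One use of l'Hospital's rule leaves b'' / (3 r), which is a difference
      quotient because b''(0) = 0.\<close>
    have "((\<lambda>r. (r * b1 r - b r) / r ^ 3) \<longlongrightarrow> b3 0 / 3) (at_right 0)"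
    proof (rule lhopital_right_0)
      have "((\<lambda>r. r * b1 r - b r) \<longlongrightarrow> 0 * 1 - 0) (at_right 0)"
        by (intro tendsto_intros tendsto_0)
      then show "((\<lambda>r. r * b1 r - b r) \<longlongrightarrow> 0) (at_right 0)" by simp
      have "((\<lambda>r::real. r ^ 3) \<longlongrightarrow> 0 ^ 3) (at_right 0)" by (intro tendsto_intros)
      then show "((\<lambda>r::real. r ^ 3) \<longlongrightarrow> 0) (at_right 0)" by simp
      show "\<forall>\<^sub>F r::real in at_right 0. r ^ 3 \<noteq> 0" "\<forall>\<^sub>F r::real in at_right 0. 3 * r\<^sup>2 \<noteq> 0"
        using pos_at_right by (eventually_elim, simp)+
      show "\<forall>\<^sub>F r in at_right 0. ((\<lambda>r. r * b1 r - b r) has_real_derivative r * b2 r) (at r)"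
        using pos_at_right
      proof eventually_elim
        case (elim r)
        have "((\<lambda>r. r * b1 r - b r) has_real_derivative (1 * b1 r + b2 r * r) - b1 r) (at r)"
          by (intro DERIV_diff DERIV_mult DERIV_ident derivs_at elim)
        then show ?case by (simp add: mult.commute)
      qed
      show "\<forall>\<^sub>F r in at_right 0. ((\<lambda>r::real. r ^ 3) has_real_derivative 3 * r\<^sup>2) (at r)"
        by (intro always_eventually allI) (auto intro!: derivative_eq_intros)
      have "((\<lambda>r. (b2 r - b2 0) / r / 3) \<longlongrightarrow> b3 0 / 3) (at_right 0)"
        by (intro tendsto_intros quotients_0) auto
      moreover have "\<forall>\<^sub>F r in at_right 0. (b2 r - b2 0) / r / 3 = r * b2 r / (3 * r\<^sup>2)"
        using pos_at_right by eventually_elim (simp add: b2_0 power2_eq_square)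
      ultimately show "((\<lambda>r. r * b2 r / (3 * r\<^sup>2)) \<longlongrightarrow> b3 0 / 3) (at_right 0)"
        by (rule Lim_transform_eventually)
    qed
    then have "((\<lambda>r. (r * b1 r - b r) / r ^ 3 / (b r / r)) \<longlongrightarrow> b3 0 / 3 / 1) (at_right 0)"
      by (rule tendsto_divide[OF _ quotients_0(2)]) simp
    moreover have "\<forall>\<^sub>F r in at_right 0. (r * b1 r - b r) / r ^ 3 / (b r / r) = (r * b1 r - b r) / (r\<^sup>2 * b r)"
      using pos_at_right by eventually_elim (simp add: power2_eq_square power3_eq_cube)
    ultimately have "((\<lambda>r. (r * b1 r - b r) / (r\<^sup>2 * b r)) \<longlongrightarrow> b3 0 / 3 / 1) (at_right 0)"
      by (rule Lim_transform_eventually)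
    then show "((\<lambda>r. (r * b1 r - b r) / (r\<^sup>2 * b r)) \<longlongrightarrow> b3 0 / 3) (at_right 0)" by (simp only: div_by_1)
  qed
qed

definition u where "u r = - f1 r"
definition w where "w r = a1 r / a r"
definition v where "v r = b1 r / b r"
definition x where "x r = u r + w r + 2 * v r"
definition k where "k r = 1 / (b r)\<^sup>2"

text \<open>The soliton equations in logarithmic derivatives. The equation for f'' is what cancels 1
  / b^2 and the damping terms from x'.\<close>

lemma classical:
  assumes r: "r > 0"
  shows "(u has_real_derivative - f2 r) (at r)" "(w has_real_derivative 1 - x r * w r) (at r)"
    "(v has_real_derivative 1 + k r - x r * v r) (at r)" "(k has_real_derivative - 2 * v r * k r) (at r)"
    "(x has_real_derivative 1 - (w r)\<^sup>2 - 2 * (v r)\<^sup>2) (at r)"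
    "- f2 r = 1 - (w r)\<^sup>2 - 2 * (v r)\<^sup>2 - (1 - x r * w r) - 2 * (1 + k r - x r * v r)"
proof -
  note d = derivs_at[OF r] and e = eqs[OF r]
  show du: "(u has_real_derivative - f2 r) (at r)" unfolding u_def[abs_def] by (rule DERIV_minus[OF d(6)])
  have "(w has_real_derivative (a2 r * a r - a1 r * a1 r) / (a r * a r)) (at r)"
    unfolding w_def[abs_def] using e by (intro DERIV_divide d) auto
  moreover have aw: "a2 r / a r = 1 - x r * w r + (w r)\<^sup>2"
    unfolding e(4) using e(1,2) by (simp add: x_def w_def v_def u_def field_simps power2_eq_square)
  then have "(a2 r * a r - a1 r * a1 r) / (a r * a r) = 1 - x r * w r"
    using e(1) by (simp add: diff_divide_distrib w_def power2_eq_square)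
  ultimately show dw: "(w has_real_derivative 1 - x r * w r) (at r)" by simp
  have "(v has_real_derivative (b2 r * b r - b1 r * b1 r) / (b r * b r)) (at r)"
    unfolding v_def[abs_def] using e by (intro DERIV_divide d) auto
  moreover have bv: "b2 r / b r = 1 + k r - x r * v r + (v r)\<^sup>2"
    unfolding e(5) using e(1,2) by (simp add: x_def w_def v_def u_def k_def field_simps power2_eq_square)
  then have "(b2 r * b r - b1 r * b1 r) / (b r * b r) = 1 + k r - x r * v r"
    using e(2) by (simp add: diff_divide_distrib v_def power2_eq_square)
  ultimately show dv: "(v has_real_derivative 1 + k r - x r * v r) (at r)" by simp
  have "(k has_real_derivative (0 * (b r)\<^sup>2 - 1 * (2 * b r * b1 r)) / ((b r)\<^sup>2 * (b r)\<^sup>2)) (at r)"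
    unfolding k_def[abs_def]
    by (rule DERIV_divide) (use e(2) in \<open>auto intro!: derivative_eq_intros d(3)\<close>)
  moreover have "(0 * (b r)\<^sup>2 - 1 * (2 * b r * b1 r)) / ((b r)\<^sup>2 * (b r)\<^sup>2) = - 2 * v r * k r"
    using e(2) by (simp add: v_def k_def field_simps power2_eq_square)
  ultimately show "(k has_real_derivative - 2 * v r * k r) (at r)" by simp
  show f2: "- f2 r = 1 - (w r)\<^sup>2 - 2 * (v r)\<^sup>2 - (1 - x r * w r) - 2 * (1 + k r - x r * v r)"
    unfolding e(3) aw bv by simp
  have "(x has_real_derivative - f2 r + (1 - x r * w r) + 2 * (1 + k r - x r * v r)) (at r)"
    unfolding x_def[abs_def] using du dw dv unfolding x_def by (intro DERIV_add DERIV_cmult)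
  moreover have "- f2 r + (1 - x r * w r) + 2 * (1 + k r - x r * v r) = 1 - (w r)\<^sup>2 - 2 * (v r)\<^sup>2"
    unfolding f2 by simp
  ultimately show "(x has_real_derivative 1 - (w r)\<^sup>2 - 2 * (v r)\<^sup>2) (at r)" by (simp only:)
qed

text \<open>The conserved quantity \<open>R + f'\<^sup>2 + 2 f\<close> of a gradient soliton, evaluated at the singular orbit.\<close>
lemma conserved:
  assumes r: "r > 0"
  shows "(x r)\<^sup>2 - (w r)\<^sup>2 - 2 * (v r)\<^sup>2 - 2 * k r - 2 + 2 * f r = 3 * s"
proof -
  define G where "G r = (x r)\<^sup>2 - (w r)\<^sup>2 - 2 * (v r)\<^sup>2 - 2 * k r - 2 + 2 * f r" for r
  have G': "(G has_real_derivative 0) (at t)" if t: "t > 0" for t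
  proof -
    note c = classical[OF t]
    have sq: "((\<lambda>t. (y t)\<^sup>2) has_real_derivative 2 * y t * D) (at t)"
      if "(y has_real_derivative D) (at t)" for y :: "real \<Rightarrow> real" and D
      using that by (auto intro!: derivative_eq_intros)
    have "(G has_real_derivative 2 * x t * (1 - (w t)\<^sup>2 - 2 * (v t)\<^sup>2) - 2 * w t * (1 - x t * w t)
        - 2 * (2 * v t * (1 + k t - x t * v t)) - 2 * (- 2 * v t * k t) - 0 + 2 * f1 t) (at t)"
      unfolding G_def[abs_def]
      by (intro DERIV_add DERIV_diff DERIV_cmult DERIV_const sq c derivs_at[OF t])
    moreover have "f1 t = - (x t - w t - 2 * v t)" by (simp add: x_def u_def)
    then have "2 * x t * (1 - (w t)\<^sup>2 - 2 * (v t)\<^sup>2) - 2 * w t * (1 - x t * w t)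
        - 2 * (2 * v t * (1 + k t - x t * v t)) - 2 * (- 2 * v t * k t) - 0 + 2 * f1 t = 0"
      by (simp add: power2_eq_square algebra_simps)
    ultimately show ?thesis by simp
  qed
  have const: "G t = G r" if t: "t > 0" for t
  proof -
    have "G constant_on {0<..}"
      by (rule has_field_derivative_0_imp_constant_on[OF G']) auto
    then show ?thesis using r t unfolding constant_on_def by auto
  qed
  \<comment> \<open>The constant is found as the limit at 0 of - f'' + x u + 2 f, another form of
    \<open>G\<close>: x behaves like 2 / t and u like s t, which gives s + 2 s.\<close>
  have "((\<lambda>t. - f2 t + - (f1 t / t) * (t * - f1 t + t * w t + 2 * (b1 t / (b t / t))) + 2 * f t)
      \<longlongrightarrow> s + - (- s) * (0 * - 0 + 0 * (0 / a0) + 2 * (1 / 1)) + 2 * 0) (at_right 0)"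
  proof -
    have "continuous_on {0..} f2"
    proof -
      have sm: "smooth_halfline f" using sys by (auto simp: expander_system_def)
      then have "(hderiv ^^ 2) f differentiable_on {0..}" unfolding smooth_halfline_def by blast
      then show ?thesis using differentiable_imp_continuous_on by (simp add: numeral_2_eq_2)
    qed
    then have "(f2 \<longlongrightarrow> f2 0) (at_right 0)" unfolding at_right[symmetric] continuous_on_def by auto
    then have f2: "((\<lambda>t. - f2 t) \<longlongrightarrow> s) (at_right 0)" using initial(7) tendsto_minus by fastforce
    have w: "(w \<longlongrightarrow> 0 / a0) (at_right 0)" unfolding w_def[abs_def] using a0 by (intro tendsto_intros tendsto_0) auto
    show ?thesis by (intro tendsto_intros f2 w tendsto_0 quotients_0) auto
  qed
  moreover have "\<forall>\<^sub>F t in at_right 0. - f2 t + - (f1 t / t) * (t * - f1 t + t * w t + 2 * (b1 t / (b t / t))) + 2 * f t = G r"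
    using pos_at_right
  proof eventually_elim
    case (elim t)
    have "- (f1 t / t) * (t * - f1 t + t * w t + 2 * (b1 t / (b t / t))) = x t * u t"
      using elim eqs(2)[OF elim] by (simp add: x_def u_def v_def field_simps)
    moreover have "- f2 t + x t * u t = (x t)\<^sup>2 - (w t)\<^sup>2 - 2 * (v t)\<^sup>2 - 2 * k t - 2"
    proof -
      have "x t * u t = (x t)\<^sup>2 - x t * w t - 2 * (x t * v t)"
        by (simp add: x_def power2_eq_square algebra_simps)
      then show ?thesis unfolding classical(6)[OF elim] by simp
    qed
    ultimately show ?case using const[OF elim] by (simp add: G_def)
  qed
  ultimately have "((\<lambda>t. G r) \<longlongrightarrow> 3 * s) (at_right (0::real))"
    using Lim_transform_eventually by fastforce
  then have "G r = 3 * s" using tendsto_const tendsto_unique trivial_limit_at_right_real by blast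
  then show ?thesis by (simp add: G_def)
qed

lemma regular:
  assumes r: "r > 0"
  shows "u r = r * U r" "w r = r * W r" "v r = 1 / r + r * V r"
proof -
  note e = eqs[OF r]
  show "u r = r * U r" "w r = r * W r" using r by (simp_all add: u_def U_def w_def W_def)
  have "r * ((r * b1 r - b r) / (r\<^sup>2 * b r)) = (r * b1 r - b r) / (r * b r)"
    using r by (simp add: power2_eq_square)
  also have "\<dots> = b1 r / b r - 1 / r" using r e(2) by (simp add: field_simps)
  finally show "v r = 1 / r + r * V r" using r by (simp add: v_def V_def)
qed

lemma h_eq: "r \<ge> 0 \<Longrightarrow> r\<^sup>2 * J 1 U r = - f r"
proof -
  assume r: "r \<ge> 0"
  have c: "continuous_on {0..r} U" using continuous_UWV(1) by (rule continuous_on_subset) auto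
  have "r\<^sup>2 * J 1 U r = integral {0..r} (\<lambda>t. t * U t)"
    using power_mult_J[OF c, of r 1] r by (simp add: power2_eq_square)
  also have "\<dots> = integral {0..r} (\<lambda>t. - f1 t)"
    by (intro integral_cong) (auto simp: U_def initial)
  also have "\<dots> = - f r - - f 0"
  proof (rule integral_unique, rule fundamental_theorem_of_calculus[OF r])
    fix t assume t: "t \<in> {0..r}"
    have "((\<lambda>t. - f t) has_real_derivative - f1 t) (at t within {0..r})"
      by (rule DERIV_minus, rule has_field_derivative_subset[OF smooth_derivs(6)]) (use t in auto)
    then show "((\<lambda>t. - f t) has_vector_derivative - f1 t) (at t within {0..r})"
      by (simp add: has_real_derivative_iff_has_vector_derivative)
  qed
  finally show ?thesis by (simp add: initial)
qed

lemma is_sol: "R \<ge> 0 \<Longrightarrow> sol R s U W V"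
proof (rule sol_mono[of "R + 1"])
  assume R: "R \<ge> 0"
  \<comment> \<open>\<open>J_unique\<close> asks for an interval of positive length, also when
    \<open>R = 0\<close>; hence the larger interval.\<close>
  define Q where "Q = R + 1"
  have Q: "Q > 0" using R by (simp add: Q_def)
  have c: "continuous_on {0..Q} U" "continuous_on {0..Q} W" "continuous_on {0..Q} V"
    using continuous_UWV by (auto elim: continuous_on_subset)
  have quot: "((\<lambda>r. y r / r) has_real_derivative (D - y r / r) / r) (at r)"
    if "(y has_real_derivative D) (at r)" "r > 0" for y D and r :: real
  proof -
    have "((\<lambda>r. y r / r) has_real_derivative (D * r - y r * 1) / (r * r)) (at r)"
      using that by (intro DERIV_divide DERIV_ident) auto
    moreover have "(D * r - y r * 1) / (r * r) = (D - y r / r) / r" using that by (simp add: field_simps)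
    ultimately show ?thesis by simp
  qed
  have tr: "(g has_real_derivative D) (at r)"
    if "r > 0" "(f has_real_derivative D) (at r)" "\<And>t. t > 0 \<Longrightarrow> f t = g t" for f g D and r :: real
    by (rule has_field_derivative_transform_within_open[OF that(2), of "{0<..}"]) (use that in auto)
  have rx: "x r * r = 2 + r\<^sup>2 * (U r + W r + 2 * V r)" if "r > 0" for r
    using that regular[OF that] by (simp add: x_def power2_eq_square field_simps)
  have 3: "real 2 + 1 = 3" by simp
  have dU: "(U has_real_derivative (GU s U (\<lambda>t. N1 (U t) (W t) (V t)) r - (real 2 + 1) * U r) / r) (at r)"
    if r: "r \<in> {0<..<Q}" for r
  proof -
    have r0: "r > 0" using r by simp
    have "(U has_real_derivative (- f2 r - u r / r) / r) (at r)"
      by (rule tr[OF r0 quot[OF classical(1)[OF r0] r0]]) (use regular in auto)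
    moreover have "- f2 r - u r / r = GU s U (\<lambda>t. N1 (U t) (W t) (V t)) r - (real 2 + 1) * U r"
    proof -
      have "- f2 r = 3 * s - 2 * f r - x r * u r"
      proof -
        have "x r * u r = (x r)\<^sup>2 - x r * w r - 2 * (x r * v r)"
          by (simp add: x_def power2_eq_square algebra_simps)
        then show ?thesis using classical(6)[OF r0] conserved[OF r0] by argo
      qed
      moreover have "x r * u r = (x r * r) * U r" using regular(1)[OF r0] by simp
      moreover have "u r / r = U r" using regular(1)[OF r0] r0 by simp
      moreover have "r\<^sup>2 * J 1 U r = - f r" using h_eq[of r] r0 by simp
      ultimately show ?thesis unfolding rx[OF r0] by (simp add: GU_def N1_def algebra_simps)
    qed
    ultimately show ?thesis by simp
  qed
  have dW: "(W has_real_derivative (GW (\<lambda>t. N2 (U t) (W t) (V t)) r - (real 2 + 1) * W r) / r) (at r)"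
    if r: "r \<in> {0<..<Q}" for r
  proof -
    have r0: "r > 0" using r by simp
    have "(W has_real_derivative ((1 - x r * w r) - w r / r) / r) (at r)"
      by (rule tr[OF r0 quot[OF classical(2)[OF r0] r0]]) (use regular in auto)
    moreover have "(1 - x r * w r) - w r / r = GW (\<lambda>t. N2 (U t) (W t) (V t)) r - (real 2 + 1) * W r"
    proof -
      have "x r * w r = (x r * r) * W r" using regular(2)[OF r0] by simp
      moreover have "w r / r = W r" using regular(2)[OF r0] r0 by simp
      ultimately show ?thesis unfolding rx[OF r0] by (simp add: GW_def N2_def algebra_simps)
    qed
    ultimately show ?thesis by simp
  qed
  have dV: "(V has_real_derivative (GV s U W (\<lambda>t. N3 (U t) (W t) (V t)) r - (real 2 + 1) * V r) / r) (at r)"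
    if r: "r \<in> {0<..<Q}" for r
  proof -
    have r0: "r > 0" using r by simp
    have "((\<lambda>r. v r - 1 / r) has_real_derivative (1 + k r - x r * v r) - - (1 / r\<^sup>2)) (at r)"
      using r0 by (intro DERIV_diff classical(3)) (auto intro!: derivative_eq_intros simp: power2_eq_square)
    then have "(V has_real_derivative ((1 + k r - x r * v r) - - (1 / r\<^sup>2) - (v r - 1 / r) / r) / r) (at r)"
      by (intro tr[OF r0 quot[OF _ r0]]) (use regular in auto)
    moreover have "(1 + k r - x r * v r) - - (1 / r\<^sup>2) - (v r - 1 / r) / r
       = GV s U W (\<lambda>t. N3 (U t) (W t) (V t)) r - (real 2 + 1) * V r"
    proof -
      \<comment> \<open>Here 1 / b^2 is traded for the conserved quantity; the poles left over in v
        (u + w) and v^2 are explicit and cancel.\<close>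
      have "2 * (1 + k r) = (x r)\<^sup>2 - (w r)\<^sup>2 - 2 * (v r)\<^sup>2 + 2 * f r - 3 * s"
        using conserved[OF r0] by simp
      then have "1 + k r - x r * v r = ((u r + w r)\<^sup>2 - (w r)\<^sup>2) / 2 + v r * (u r + w r) - (v r)\<^sup>2 + f r - 3 * s / 2"
        by (simp add: x_def power2_eq_square field_simps)
      moreover have "f r = - (r\<^sup>2 * J 1 U r)" using h_eq[of r] r0 by simp
      moreover have "v r * (u r + w r) = U r + W r + r\<^sup>2 * (V r * (U r + W r))"
        unfolding regular[OF r0] using r0 by (simp add: power2_eq_square field_simps)
      moreover have "(v r)\<^sup>2 = 1 / r\<^sup>2 + 2 * V r + r\<^sup>2 * (V r)\<^sup>2"
        unfolding regular(3)[OF r0] using r0 by (simp add: power2_eq_square field_simps)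
      moreover have "((u r + w r)\<^sup>2 - (w r)\<^sup>2) / 2 = r\<^sup>2 * ((U r)\<^sup>2 / 2 + U r * W r)"
        unfolding regular[OF r0] by (simp add: power2_eq_square field_simps)
      moreover have "(v r - 1 / r) / r = V r" using regular(3)[OF r0] r0 by simp
      ultimately show ?thesis by (simp add: GV_def N3_def algebra_simps)
    qed
    ultimately show ?thesis by simp
  qed
  note cG = continuous_on_G[OF c(1,2)] continuous_on_N[OF c]
  have "sol Q s U W V"
    unfolding sol_def
  proof (intro conjI ballI c)
    fix r assume r: "r \<in> {0..Q}"
    show "U r = J 2 (GU s U (\<lambda>t. N1 (U t) (W t) (V t))) r"
      by (rule J_unique[OF _ c(1) dU r Q]) (intro cG)
    show "W r = J 2 (GW (\<lambda>t. N2 (U t) (W t) (V t))) r"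
      by (rule J_unique[OF _ c(2) dW r Q]) (intro cG)
    show "V r = J 2 (GV s U W (\<lambda>t. N3 (U t) (W t) (V t))) r"
      by (rule J_unique[OF _ c(3) dV r Q]) (intro cG)
  qed
  then show "sol (R + 1) s U W V" by (simp add: Q_def)
qed simp

lemma flow_UWV: "flow s U W V"
  using s0 is_sol by unfold_locales

lemma limits:
  assumes "(a1 \<longlongrightarrow> \<alpha>) at_top" "(b1 \<longlongrightarrow> \<beta>) at_top"
  shows "\<alpha> = a0 * \<phi> s" "\<beta> = \<psi> s"
proof -
  interpret F: flow s U W V by (rule flow_UWV)
  interpret G: flow s "FU s" "FW s" "FV s" by (rule flow_family[OF s0])
  have eq: "W r = FW s r" "V r = FV s r" if "r \<ge> 0" for r
    using sol_unique(2,3)[OF F.sol[OF that] G.sol[OF that] s0, of r] that by auto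
  have ww: "w r = G.w r" if "r > 0" for r
    using regular(2)[OF that] eq that by (simp add: G.w_def)
  have ww': "v r = 1 / r + r * FV s r" if "r > 0" for r
    using regular(3)[OF that] eq that by simp
  have A: "a1 r = a0 * (G.w r * exp (G.gW r))" if r: "r > 0" for r
  proof -
    \<comment> \<open>\<open>a\<close> and a0 exp gW have the same logarithmic derivative and the
      same value at 0.\<close>
    define L where "L t = a t * exp (- G.gW t)" for t
    have L': "(L has_real_derivative 0) (at t)" if t: "t > 0" for t
    proof -
      have "(L has_real_derivative a1 t * exp (- G.gW t) + exp (- G.gW t) * - G.w t * a t) (at t)"
        unfolding L_def[abs_def]
        by (rule DERIV_mult[OF derivs_at(1)[OF t] DERIV_exp_within[OF DERIV_minus[OF G.derivs(3)[OF t]]]])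
      moreover have "a1 t = G.w t * a t" using ww[OF t] eqs(1)[OF t] by (simp add: w_def field_simps)
      ultimately show ?thesis by simp
    qed
    have cL: "continuous_on {0..r} L"
      unfolding L_def by (intro continuous_intros G.cont_regular continuous_on_subset[OF smooth_continuous(1)]) auto
    have "L r = L 0" using DERIV_isconst2[OF r cL, of r] L' r by auto
    then have "a r = a0 * exp (G.gW r)" by (simp add: L_def initial G.at_0 exp_minus field_simps)
    moreover have "a1 r = w r * a r" using eqs(1)[OF r] by (simp add: w_def)
    ultimately show ?thesis using ww[OF r] by simp
  qed
  have B: "b1 r = G.p r" if r: "r > 0" for r
  proof -
    \<comment> \<open>As \<open>b\<close> vanishes at 0, b / r is compared with exp gV instead, and
      the constant quotient is identified by its limit at 0.\<close>
    define L where "L t = b t / t * exp (- G.gV t)" for t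
    have L': "(L has_real_derivative 0) (at t)" if t: "t > 0" for t
    proof -
      have DL: "(L has_real_derivative (b1 t * t - b t * 1) / (t * t) * exp (- G.gV t)
          + exp (- G.gV t) * - (t * FV s t) * (b t / t)) (at t)"
        unfolding L_def[abs_def] using t
        by (intro DERIV_mult DERIV_divide DERIV_ident derivs_at DERIV_exp_within DERIV_minus G.derivs(2)) auto
      have "b1 t = (1 / t + t * FV s t) * b t" using ww'[OF t] eqs(2)[OF t] by (simp add: v_def field_simps)
      then have q: "(b1 t * t - b t * 1) / (t * t) = (t * FV s t) * (b t / t)" using t by (simp add: field_simps)
      show ?thesis using DL t unfolding q by (simp add: algebra_simps)
    qed
    have const: "L t = L r" if t: "t > 0" for t
    proof -
      have "L constant_on {0<..}"
        by (rule has_field_derivative_0_imp_constant_on[OF L']) auto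
      then show ?thesis using r t unfolding constant_on_def by auto
    qed
    have "(G.gV \<longlongrightarrow> G.gV 0) (at 0 within {0..1})"
      using G.cont_regular(6)[of 1] by (simp add: continuous_on_def)
    then have g: "(G.gV \<longlongrightarrow> 0) (at_right 0)"
      by (simp add: G.at_0 at_within_Icc_at_right)
    have "(L \<longlongrightarrow> 1 * exp (- 0)) (at_right 0)"
      unfolding L_def[abs_def] by (intro tendsto_intros quotients_0 g)
    moreover have "\<forall>\<^sub>F t in at_right 0. L t = L r"
      using pos_at_right by eventually_elim (rule const)
    ultimately have "((\<lambda>t. L r) \<longlongrightarrow> 1) (at_right (0::real))"
      using Lim_transform_eventually by fastforce
    then have "L r = 1" using tendsto_const tendsto_unique trivial_limit_at_right_real by blast
    then have "b r = r * exp (G.gV r)" using r by (simp add: L_def exp_minus field_simps)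
    moreover have "b1 r = v r * b r" using eqs(2)[OF r] by (simp add: v_def)
    ultimately have "b1 r = v r * G.b r" by (simp add: G.b_def)
    then show ?thesis using G.derivs(9)[OF r] ww'[OF r] by (simp add: G.v_def)
  qed
  have nb: "(at_top :: real filter) \<noteq> bot" by simp
  have pos: "\<forall>\<^sub>F r::real in at_top. r > 0" by (rule eventually_gt_at_top)
  have "((\<lambda>r. a0 * (G.w r * exp (G.gW r))) \<longlongrightarrow> a0 * \<phi> s) at_top"
    by (intro tendsto_mult_left tendsto_\<phi>_\<psi>(1) s0)
  moreover have "\<forall>\<^sub>F r in at_top. a0 * (G.w r * exp (G.gW r)) = a1 r"
    using pos by eventually_elim (simp add: A)
  ultimately have "(a1 \<longlongrightarrow> a0 * \<phi> s) at_top" by (rule Lim_transform_eventually)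
  then show "\<alpha> = a0 * \<phi> s" using tendsto_unique[OF nb assms(1)] by blast
  have "\<forall>\<^sub>F r in at_top. G.p r = b1 r"
    using pos by eventually_elim (simp add: B)
  then have "(b1 \<longlongrightarrow> \<psi> s) at_top" by (rule Lim_transform_eventually[OF tendsto_\<phi>_\<psi>(2)[OF s0]])
  then show "\<beta> = \<psi> s" using tendsto_unique[OF nb assms(2)] by blast
qed

end

text \<open>Existence for the description comes from \<open>flow.is_expander\<close>, uniqueness
  from \<open>expander.limits\<close>. The factor \<open>a0\<close> splits off because the
  regularised equations see a only through a' / a.\<close>

lemma expander_map_eq:
  assumes a0: "a0 > 0" and s: "s > 0"
  shows "expander_map (a0, s) = (a0 * \<phi> s, \<psi> s)"
proof -
  interpret G: flow s "FU s" "FW s" "FV s" by (rule flow_family[OF s])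
  define P where "P q \<longleftrightarrow> (case q of (\<alpha>, \<beta>) \<Rightarrow> \<exists>a b f. expander_system a b f \<and>
      S1_R3_boundary_conditions a0 (- s) a b f \<and> (hderiv a \<longlongrightarrow> \<alpha>) at_top \<and> (hderiv b \<longlongrightarrow> \<beta>) at_top)" for q
  have pos: "\<forall>\<^sub>F r::real in at_top. r > 0" by (rule eventually_gt_at_top)
  have "((\<lambda>r. a0 * (G.w r * exp (G.gW r))) \<longlongrightarrow> a0 * \<phi> s) at_top"
    by (intro tendsto_mult_left tendsto_\<phi>_\<psi>(1) s)
  moreover have "\<forall>\<^sub>F r in at_top. a0 * (G.w r * exp (G.gW r)) = hderiv (G.a a0) r"
    using pos by eventually_elim (simp add: G.solution_derivs)
  ultimately have A: "(hderiv (G.a a0) \<longlongrightarrow> a0 * \<phi> s) at_top" by (rule Lim_transform_eventually)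
  have "\<forall>\<^sub>F r in at_top. G.p r = hderiv G.b r"
    using pos by eventually_elim (simp add: G.solution_derivs)
  then have B: "(hderiv G.b \<longlongrightarrow> \<psi> s) at_top" by (rule Lim_transform_eventually[OF tendsto_\<phi>_\<psi>(2)[OF s]])
  have "P (a0 * \<phi> s, \<psi> s)"
    unfolding P_def using G.is_expander[OF a0] A B by blast
  moreover have "q = (a0 * \<phi> s, \<psi> s)" if "P q" for q
  proof -
    obtain \<alpha> \<beta> where q: "q = (\<alpha>, \<beta>)" by (cases q)
    obtain a b f where 1: "expander_system a b f" "S1_R3_boundary_conditions a0 (- s) a b f"
      and 2: "(hderiv a \<longlongrightarrow> \<alpha>) at_top" "(hderiv b \<longlongrightarrow> \<beta>) at_top"
      using \<open>P q\<close> unfolding P_def q by auto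
    interpret expander a b f a0 s using 1 a0 s by unfold_locales
    show ?thesis unfolding q using limits[OF 2] by simp
  qed
  ultimately have "(THE q. P q) = (a0 * \<phi> s, \<psi> s)" by (rule the_equality)
  then show ?thesis unfolding expander_map_def P_def by simp
qed

theorem theorem1p1:
  fixes oM oN :: "real \<times> real \<Rightarrow> (real \<times> real) chain set"
  assumes "orientation 2 quadrant oM" and "orientation 2 quadrant oN"
  shows "\<bar>deg_sym_exp_S1_D3 oM oN\<bar> = 1"
proof -
  interpret split_map \<phi> \<psi> expander_map
    by unfold_locales (use continuous_\<phi> continuous_\<psi> \<phi>_pos \<psi>_pos \<psi>_at_0 \<psi>_at_top expander_map_eq in auto)
  show ?thesis unfolding deg_sym_exp_S1_D3_def by (rule abs_proper_degree[OF assms])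
qed

end
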